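(* Let $(M,\varphi)$ be a $7$-manifold with coclosed $G_2$-structure. For any co$G_2$-vector fields $X_1,X_2$ on $M$, there exists a $2$-form $\sigma$ on $M$ such that $[X_1,X_2]\lrcorner\star\varphi=d\sigma$.
   Context: On $\mathbb{R}^7$ let $\varphi_0=dx^{123}+dx^{145}+dx^{167}+dx^{246}-dx^{257}-dx^{347}-dx^{356}$, where $dx^{ijk}=dx^i\wedge dx^j\wedge dx^k$. A $G_2$-structure on a smooth $7$-manifold $M$ is a smooth $3$-form $\varphi$ such that for each $p\in M$ there is a linear isomorphism $T_pM\cong\mathbb{R}^7$ carrying $\varphi_p$ to $\varphi_0$. It determines a Riemannian metric $\langle\cdot,\cdot\rangle_\varphi$ and an orientation by $(X\lrcorner\varphi)\wedge(Y\lrcorner\varphi)\wedge\varphi=6\langle X,Y\rangle_\varphi\, d\mathrm{vol}_\varphi$, where $X\lrcorner\omega=\omega(X,\cdot,\dots)$ is the interior product; $\star$ is the associated Hodge star. The structure is coclosed if $d^*\varphi=0$, equivalently $d(\star\varphi)=0$. A co$G_2$-vector field is a vector field $X$ on $M$ with $\mathcal{L}_X(\star\varphi)=0$, where $\mathcal{L}_X$ is the Lie derivative. $[X_1,X_2]$ denotes the usual Lie bracket of vector fields. *)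

theory Defs
  imports "HOL-Analysis.Analysis"
begin

section \<open>Alternating forms on a Euclidean space\<close>

text \<open>
  A \<open>k\<close>-linear form is a function of a sequence of vectors which looks at the entries
  \<open>0, \<dots>, k - 1\<close> only. This gives every degree the same type, so that equality of forms is equality of
  functions, but it makes the degree an explicit argument of the operations below.
\<close>

type_synonym 'v form = "(nat \<Rightarrow> 'v) \<Rightarrow> real"

definition alternating_form :: "nat \<Rightarrow> ('v::euclidean_space) form \<Rightarrow> bool" where
  "alternating_form k \<alpha> \<longleftrightarrow>
     (\<forall>v w. (\<forall>i<k. v i = w i) \<longrightarrow> \<alpha> v = \<alpha> w) \<and>
     (\<forall>v. \<forall>i<k. linear (\<lambda>u. \<alpha> (v(i := u)))) \<and>
     (\<forall>v i j. i < k \<longrightarrow> j < k \<longrightarrow> i \<noteq> j \<longrightarrow> v i = v j \<longrightarrow> \<alpha> v = 0)"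

definition pullback :: "('v \<Rightarrow> 'w) \<Rightarrow> 'w form \<Rightarrow> 'v form" where
  "pullback L \<alpha> = (\<lambda>v. \<alpha> (\<lambda>i. L (v i)))"

definition interior_product :: "'v \<Rightarrow> 'v form \<Rightarrow> 'v form" where
  "interior_product X \<alpha> = (\<lambda>v. \<alpha> (case_nat X v))"

text \<open>
  The wedge product of a \<open>k\<close>-form and an \<open>l\<close>-form, normalised so that
  \<open>dx\<^sup>1 \<and> \<dots> \<and> dx\<^sup>n\<close> is the determinant.
\<close>

definition wedge :: "nat \<Rightarrow> nat \<Rightarrow> 'v form \<Rightarrow> 'v form \<Rightarrow> 'v form" where
  "wedge k l \<alpha> \<beta> = (\<lambda>v.
     (\<Sum>\<pi> | \<pi> permutes {..<k + l}.
        of_int (sign \<pi>) * \<alpha> (\<lambda>i. v (\<pi> i)) * \<beta> (\<lambda>i. v (\<pi> (k + i)))) / (fact k * fact l))"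


section \<open>Inner products, volume forms and the Hodge star\<close>

definition inner_product :: "('v::euclidean_space \<Rightarrow> 'v \<Rightarrow> real) \<Rightarrow> bool" where
  "inner_product g \<longleftrightarrow> bilinear g \<and> (\<forall>X Y. g X Y = g Y X) \<and> (\<forall>X. X \<noteq> 0 \<longrightarrow> g X X > 0)"

definition orthonormal_basis :: "('v::euclidean_space \<Rightarrow> 'v \<Rightarrow> real) \<Rightarrow> (nat \<Rightarrow> 'v) \<Rightarrow> bool" where
  "orthonormal_basis g e \<longleftrightarrow>
     (\<forall>i<DIM('v). \<forall>j<DIM('v). g (e i) (e j) = (if i = j then 1 else 0))"

text \<open>
  An inner product has exactly two volume forms, one for each orientation, so a volume form also
  records the orientation.
\<close>

definition volume_form :: "('v::euclidean_space \<Rightarrow> 'v \<Rightarrow> real) \<Rightarrow> 'v form \<Rightarrow> bool" where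
  "volume_form g \<mu> \<longleftrightarrow>
     alternating_form DIM('v) \<mu> \<and> (\<forall>e. orthonormal_basis g e \<longrightarrow> \<bar>\<mu> e\<bar> = 1)"

text \<open>
  The inner product induced on \<open>k\<close>-forms, for which the forms \<open>e\<^sup>i \<and> \<dots> \<and> e\<^sup>j\<close> with \<open>i < \<dots> < j\<close>
  dual to an orthonormal basis are orthonormal. The sum runs over all multi-indices, whence
  the factor \<open>1 / k!\<close>; the value does not depend on the orthonormal basis chosen.
\<close>

definition form_inner ::
  "('v::euclidean_space \<Rightarrow> 'v \<Rightarrow> real) \<Rightarrow> nat \<Rightarrow> 'v form \<Rightarrow> 'v form \<Rightarrow> real" where
  "form_inner g k \<alpha> \<beta> =
     (let e = (SOME e. orthonormal_basis g e)
      in (\<Sum>I \<in> {..<k} \<rightarrow>\<^sub>E {..<DIM('v)}. \<alpha> (\<lambda>i. e (I i)) * \<beta> (\<lambda>i. e (I i))) / fact k)"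

definition hodge_star ::
  "('v::euclidean_space \<Rightarrow> 'v \<Rightarrow> real) \<Rightarrow> 'v form \<Rightarrow> nat \<Rightarrow> 'v form \<Rightarrow> 'v form" where
  "hodge_star g \<mu> k \<alpha> =
     (THE \<beta>. alternating_form (DIM('v) - k) \<beta> \<and>
        (\<forall>\<gamma>. alternating_form k \<gamma> \<longrightarrow>
           wedge k (DIM('v) - k) \<gamma> \<beta> = (\<lambda>v. form_inner g k \<gamma> \<alpha> * \<mu> v)))"


section \<open>The linear algebra of \<open>G\<^sub>2\<close>-structures\<close>

definition dx3 :: "7 \<Rightarrow> 7 \<Rightarrow> 7 \<Rightarrow> (real^7) form" where
  "dx3 i j k =
     wedge 1 2 (\<lambda>v. v 0 $ i) (wedge 1 1 (\<lambda>v. v 0 $ j) (\<lambda>v. v 0 $ k))"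

text \<open>The numeral \<open>7\<close> of the index type \<open>7\<close> equals \<open>0\<close>; it is the seventh index.\<close>

definition phi0 :: "(real^7) form" where
  "phi0 = (\<lambda>v. dx3 1 2 3 v + dx3 1 4 5 v + dx3 1 6 7 v + dx3 2 4 6 v
             - dx3 2 5 7 v - dx3 3 4 7 v - dx3 3 5 6 v)"

definition g2_metric_volume :: "(real^7) form \<Rightarrow> (real^7 \<Rightarrow> real^7 \<Rightarrow> real) \<Rightarrow> (real^7) form \<Rightarrow> bool" where
  "g2_metric_volume \<phi> g \<mu> \<longleftrightarrow>
     inner_product g \<and> volume_form g \<mu> \<and>
     (\<forall>X Y. wedge 4 3 (wedge 2 2 (interior_product X \<phi>) (interior_product Y \<phi>)) \<phi>
              = (\<lambda>v. 6 * g X Y * \<mu> v))"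

definition g2_metric :: "(real^7) form \<Rightarrow> real^7 \<Rightarrow> real^7 \<Rightarrow> real" where
  "g2_metric \<phi> = (THE g. \<exists>\<mu>. g2_metric_volume \<phi> g \<mu>)"

definition g2_volume :: "(real^7) form \<Rightarrow> (real^7) form" where
  "g2_volume \<phi> = (THE \<mu>. \<exists>g. g2_metric_volume \<phi> g \<mu>)"


section \<open>Calculus on open subsets of a Euclidean space\<close>

text \<open>Both notions below are meant for open \<open>S\<close>.\<close>

primrec Ck_on :: "nat \<Rightarrow> 'v::euclidean_space set \<Rightarrow> ('v \<Rightarrow> 'w::real_normed_vector) \<Rightarrow> bool" where
  "Ck_on 0 S f \<longleftrightarrow> continuous_on S f"
| "Ck_on (Suc k) S f \<longleftrightarrow>
     (\<exists>f'. (\<forall>x\<in>S. (f has_derivative f' x) (at x)) \<and> (\<forall>v. Ck_on k S (\<lambda>x. f' x v)))"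

definition smooth_on :: "'v::euclidean_space set \<Rightarrow> ('v \<Rightarrow> 'w::real_normed_vector) \<Rightarrow> bool" where
  "smooth_on S f \<longleftrightarrow> (\<forall>k. Ck_on k S f)"

text \<open>
  The exterior derivative of a \<open>k\<close>-form \<open>\<omega>\<close>:
  \<open>d\<omega>(v\<^sub>0, \<dots>, v\<^sub>k) = \<Sum>\<^sub>i (-1)\<^sup>i D(\<omega>(v\<^sub>0, \<dots>, v\<^sub>k without v\<^sub>i))(v\<^sub>i)\<close> for constant vectors \<open>v\<^sub>0, \<dots>, v\<^sub>k\<close>.
\<close>

definition ext_deriv :: "nat \<Rightarrow> ('v::euclidean_space \<Rightarrow> 'v form) \<Rightarrow> 'v \<Rightarrow> 'v form" where
  "ext_deriv k \<omega> x = (\<lambda>v. \<Sum>i\<le>k.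
     (-1) ^ i * frechet_derivative (\<lambda>y. \<omega> y (\<lambda>j. v (if j < i then j else Suc j))) (at x) (v i))"

definition lie_bracket ::
  "('v::euclidean_space \<Rightarrow> 'v) \<Rightarrow> ('v \<Rightarrow> 'v) \<Rightarrow> 'v \<Rightarrow> 'v" where
  "lie_bracket X Y x = frechet_derivative Y (at x) (X x) - frechet_derivative X (at x) (Y x)"

text \<open>
  \<open>\<Phi>\<close> is a local flow, near \<open>x\<close> and for times in \<open>(-\<epsilon>, \<epsilon>)\<close>, of the vector field \<open>X\<close> on the open
  set \<open>V\<close>.
\<close>

definition local_flow ::
  "'v::euclidean_space set \<Rightarrow> ('v \<Rightarrow> 'v) \<Rightarrow> 'v \<Rightarrow> real \<Rightarrow> 'v set \<Rightarrow> (real \<times> 'v \<Rightarrow> 'v) \<Rightarrow> bool" where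
  "local_flow V X x \<epsilon> W \<Phi> \<longleftrightarrow>
     \<epsilon> > 0 \<and> open W \<and> x \<in> W \<and> W \<subseteq> V \<and>
     smooth_on ({-\<epsilon><..<\<epsilon>} \<times> W) \<Phi> \<and> \<Phi> ` ({-\<epsilon><..<\<epsilon>} \<times> W) \<subseteq> V \<and>
     (\<forall>y\<in>W. \<Phi> (0, y) = y) \<and>
     (\<forall>t\<in>{-\<epsilon><..<\<epsilon>}. \<forall>y\<in>W. ((\<lambda>s. \<Phi> (s, y)) has_vector_derivative X (\<Phi> (t, y))) (at t))"

text \<open>
  \<open>\<eta>\<close> is the value at \<open>x\<close> of the Lie derivative of \<open>\<omega>\<close> along \<open>X\<close>, that is the derivative at
  \<open>t = 0\<close> of the pullback of \<open>\<omega>\<close> under the time-\<open>t\<close> flow map of \<open>X\<close>. A smooth vector field has a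
  local flow near every point and two of them agree on their common domain, so it
  does not matter which one is used.
\<close>

definition has_lie_derivative ::
  "'v::euclidean_space set \<Rightarrow> ('v \<Rightarrow> 'v) \<Rightarrow> ('v \<Rightarrow> 'v form) \<Rightarrow> 'v \<Rightarrow> 'v form \<Rightarrow> bool" where
  "has_lie_derivative V X \<omega> x \<eta> \<longleftrightarrow>
     (\<exists>\<epsilon> W \<Phi>. local_flow V X x \<epsilon> W \<Phi> \<and>
        (\<forall>v. ((\<lambda>t. pullback (frechet_derivative (\<lambda>y. \<Phi> (t, y)) (at x)) (\<omega> (\<Phi> (t, x))) v)
                has_real_derivative \<eta> v) (at 0)))"


section \<open>Smooth \<open>7\<close>-manifolds\<close>

text \<open>
  A chart is a pair of its domain and its coordinate map, whose values off the domain are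
  irrelevant. The atlas need not be maximal.
\<close>

type_synonym 'a chart = "'a set \<times> ('a \<Rightarrow> real^7)"

definition chart_image :: "'a chart \<Rightarrow> (real^7) set" where
  "chart_image c = snd c ` fst c"

definition transition :: "'a chart \<Rightarrow> 'a chart \<Rightarrow> real^7 \<Rightarrow> real^7" where
  "transition c d = snd d \<circ> inv_into (fst c) (snd c)"

definition smooth_7_manifold :: "'a topology \<Rightarrow> 'a chart set \<Rightarrow> bool" where
  "smooth_7_manifold T A \<longleftrightarrow>
     Hausdorff_space T \<and> second_countable T \<and>
     (\<forall>c\<in>A. openin T (fst c) \<and> open (chart_image c) \<and>
        homeomorphic_map (subtopology T (fst c)) (top_of_set (chart_image c)) (snd c)) \<and>
     (\<Union>c\<in>A. fst c) = topspace T \<and>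
     (\<forall>c\<in>A. \<forall>d\<in>A. smooth_on (snd c ` (fst c \<inter> fst d)) (transition c d))"

text \<open>
  Vector fields and differential forms are given by their coordinate representations in the charts
  of the atlas, which must be related by the transition maps. At a point of \<open>chart_image c\<close> the
  chart \<open>c\<close> identifies the tangent space with \<open>real^7\<close>.
\<close>

type_synonym 'a vfield = "'a chart \<Rightarrow> real^7 \<Rightarrow> real^7"
type_synonym 'a dform = "'a chart \<Rightarrow> real^7 \<Rightarrow> (real^7) form"

definition vector_field :: "'a chart set \<Rightarrow> 'a vfield \<Rightarrow> bool" where
  "vector_field A X \<longleftrightarrow>
     (\<forall>c\<in>A. smooth_on (chart_image c) (X c)) \<and>
     (\<forall>c\<in>A. \<forall>d\<in>A. \<forall>p\<in>fst c \<inter> fst d.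
        X d (snd d p) = frechet_derivative (transition c d) (at (snd c p)) (X c (snd c p)))"

definition differential_form :: "'a chart set \<Rightarrow> nat \<Rightarrow> 'a dform \<Rightarrow> bool" where
  "differential_form A k \<omega> \<longleftrightarrow>
     (\<forall>c\<in>A. \<forall>x\<in>chart_image c. alternating_form k (\<omega> c x)) \<and>
     (\<forall>c\<in>A. \<forall>v. smooth_on (chart_image c) (\<lambda>x. \<omega> c x v)) \<and>
     (\<forall>c\<in>A. \<forall>d\<in>A. \<forall>p\<in>fst c \<inter> fst d.
        \<omega> c (snd c p)
          = pullback (frechet_derivative (transition c d) (at (snd c p))) (\<omega> d (snd d p)))"

definition form_eq :: "'a chart set \<Rightarrow> 'a dform \<Rightarrow> 'a dform \<Rightarrow> bool" where
  "form_eq A \<omega> \<eta> \<longleftrightarrow> (\<forall>c\<in>A. \<forall>x\<in>chart_image c. \<omega> c x = \<eta> c x)"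

definition exterior_derivative :: "nat \<Rightarrow> 'a dform \<Rightarrow> 'a dform" where
  "exterior_derivative k \<omega> = (\<lambda>c. ext_deriv k (\<omega> c))"

definition vf_bracket :: "'a vfield \<Rightarrow> 'a vfield \<Rightarrow> 'a vfield" where
  "vf_bracket X Y = (\<lambda>c. lie_bracket (X c) (Y c))"

definition contraction :: "'a vfield \<Rightarrow> 'a dform \<Rightarrow> 'a dform" where
  "contraction X \<omega> = (\<lambda>c x. interior_product (X c x) (\<omega> c x))"


section \<open>\<open>G\<^sub>2\<close>-structures\<close>

definition g2_structure :: "'a chart set \<Rightarrow> 'a dform \<Rightarrow> bool" where
  "g2_structure A \<phi> \<longleftrightarrow>
     differential_form A 3 \<phi> \<and>
     (\<forall>c\<in>A. \<forall>x\<in>chart_image c. \<exists>L. linear L \<and> bij L \<and> \<phi> c x = pullback L phi0)"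

definition g2_star :: "'a dform \<Rightarrow> 'a dform" where
  "g2_star \<phi> = (\<lambda>c x. hodge_star (g2_metric (\<phi> c x)) (g2_volume (\<phi> c x)) 3 (\<phi> c x))"

definition coclosed_g2_structure :: "'a chart set \<Rightarrow> 'a dform \<Rightarrow> bool" where
  "coclosed_g2_structure A \<phi> \<longleftrightarrow>
     g2_structure A \<phi> \<and> form_eq A (exterior_derivative 4 (g2_star \<phi>)) (\<lambda>c x v. 0)"

definition cog2_vector_field :: "'a chart set \<Rightarrow> 'a dform \<Rightarrow> 'a vfield \<Rightarrow> bool" where
  "cog2_vector_field A \<phi> X \<longleftrightarrow>
     vector_field A X \<and>
     (\<forall>c\<in>A. \<forall>x\<in>chart_image c.
        has_lie_derivative (chart_image c) (X c) (g2_star \<phi> c) x (\<lambda>v. 0))"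

end

(*
  Since X1 and X2 preserve psi = *phi, [X1,X2]_|psi = L_X1 (X2_|psi); Cartan's formula and
  d(X2_|psi) = L_X2 psi - X2_|dpsi = 0 turn this into d(X1_|(X2_|psi)), so sigma = psi(X2, X1, -, -)
  works. In a chart only first derivatives of psi and of the fields enter, once the Lie derivative
  defined by the flow has been rewritten in coordinates; that needs the symmetry of the mixed second
  derivatives of the flow.

  The other half of the work is to see that psi is a smooth tensorial form. Pointwise phi = L^* phi0,
  and the defining equations of metric, volume and Hodge star then force psi = L^* psi0. Smoothness does
  not use L: with B(x,y) = (x_|phi)^(y_|phi)^phi on the standard basis, B = 6 m g, where m is the
  component of the volume form, and det B = 6^7 m^9, so m and g are smooth. Finally
  psi(x,y,z,w) = phi(x,y,u) - g(x,z)g(y,w) + g(x,w)g(y,z), where u is the cross product of z and w,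
  that is the solution of the linear system g(u,-) = phi(z,w,-), smooth by Cramer's rule.
*)
theory Submission
  imports Defs
begin

section \<open>Alternating forms and the wedge product\<close>

text \<open>The map \<open>L\<close> in the definition of a G2-structure is supplied point by point,
  with no smoothness in the point and no compatibility between charts, so the formula psi = L^* psi0
  serves only for pointwise identities. Independence of \<open>L\<close> comes for free: metric,
  volume form and star are determined by phi through uniqueness (\<open>THE\<close>), so the
  stabiliser of phi0 never has to be studied. The change of charts follows from this, since a frame
  of the target chart composed with the derivative of the transition map is again an admissible
  frame. The power m^9 arises from the seven rows of B, each scaled by 6 m, and a Gram determinant
  m^2. Because 9 is odd, m is recovered with its sign, and no orientation has to be chosen. The
  formula for psi is the contraction identity for two copies of phi, checked on basis vectors of the
  model. Forms are functions of sequences and carry no norm, so differentiation and smoothness are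
  first stated for constant arguments and then extended to varying ones by expanding one argument at
  a time in the basis.\<close>

lemma alternating_cong:
  assumes "alternating_form k \<alpha>" "\<And>i. i < k \<Longrightarrow> v i = w i"
  shows "\<alpha> v = \<alpha> w"
  using assms unfolding alternating_form_def by blast

lemma alternating_linear:
  assumes "alternating_form k \<alpha>" "i < k"
  shows "linear (\<lambda>u. \<alpha> (v(i := u)))"
  using assms unfolding alternating_form_def by blast

lemma alternating_eq_zero:
  assumes "alternating_form k \<alpha>" "i < k" "j < k" "i \<noteq> j" "v i = v j"
  shows "\<alpha> v = 0"
  using assms unfolding alternating_form_def by blast

text \<open>Polarisation: the form vanishes when \<open>v i + v j\<close> stands in both slots, and
  expanding that leaves only the two mixed terms.\<close>

lemma alternating_swap:
  assumes "alternating_form k \<alpha>" "i < k" "j < k" "i \<noteq> j"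
  shows "\<alpha> (v \<circ> Transposition.transpose i j) = - \<alpha> v"
proof -
  define w where "w x y = \<alpha> (v(i := x, j := y))" for x y
  have diag: "w x x = 0" for x
    unfolding w_def using assms by (intro alternating_eq_zero[of k \<alpha> i j]) auto
  have add2: "w x (y + y') = w x y + w x y'" for x y y'
    unfolding w_def by (rule linear_add[OF alternating_linear[OF assms(1,3)]])
  have add1: "w (x + x') y = w x y + w x' y" for x x' y
    unfolding w_def fun_upd_twist[OF assms(4)]
    by (rule linear_add[OF alternating_linear[OF assms(1,2)]])
  have "w (v i + v j) (v i + v j) = w (v i) (v j) + w (v j) (v i)"
    by (simp add: add1 add2 diag[of "v i"] diag[of "v j"])
  hence "w (v j) (v i) = - w (v i) (v j)" using diag[of "v i + v j"] by simp
  moreover have "v \<circ> Transposition.transpose i j = v(i := v j, j := v i)"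
    by (auto simp: fun_eq_iff Transposition.transpose_def)
  ultimately show ?thesis by (simp add: w_def)
qed

lemma sign_transpose_comp:
  assumes "p permutes S" "finite S" "a \<noteq> b"
  shows "sign (Transposition.transpose a b \<circ> p) = - sign p"
    and "sign (p \<circ> Transposition.transpose a b) = - sign p"
proof -
  have "permutation p" using assms permutes_imp_permutation by blast
  note * = sign_compose[OF permutation_swap_id this] sign_compose[OF this permutation_swap_id]
  show "sign (Transposition.transpose a b \<circ> p) = - sign p"
    unfolding * using assms by (simp add: sign_swap_id)
  show "sign (p \<circ> Transposition.transpose a b) = - sign p"
    unfolding * using assms by (simp add: sign_swap_id)
qed

lemma alternating_permutes:
  assumes "alternating_form k \<alpha>" "\<pi> permutes {..<k}"
  shows "\<alpha> (v \<circ> \<pi>) = of_int (sign \<pi>) * \<alpha> v"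
proof -
  have "finite {..<k}" by simp
  with assms(2) show ?thesis
  proof (induction arbitrary: v rule: permutes_induct)
    case id
    show ?case by simp
  next
    case (swap a b p)
    have "\<alpha> (v \<circ> (Transposition.transpose a b \<circ> p)) = of_int (sign p) * \<alpha> (v \<circ> Transposition.transpose a b)"
      using swap.IH[of "v \<circ> Transposition.transpose a b"] by (simp only: o_assoc)
    also have "\<dots> = - of_int (sign p) * \<alpha> v"
      using alternating_swap[OF assms(1), of a b v] swap by simp
    also have "sign (Transposition.transpose a b \<circ> p) = - sign p"
      using swap by (intro sign_transpose_comp) auto
    hence "- of_int (sign p) * \<alpha> v = of_int (sign (Transposition.transpose a b \<circ> p)) * \<alpha> v" by simp
    finally show ?case .
  qed
qed

lemma alternating_combination:
  assumes \<alpha>: "alternating_form k \<alpha>" and \<beta>: "alternating_form k \<beta>"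
  shows "alternating_form k (\<lambda>v. a * \<alpha> v + b * \<beta> v)"
  unfolding alternating_form_def
proof (intro conjI allI impI)
  fix v w :: "nat \<Rightarrow> 'a"
  assume "\<forall>i<k. v i = w i"
  thus "a * \<alpha> v + b * \<beta> v = a * \<alpha> w + b * \<beta> w"
    using alternating_cong[OF \<alpha>, of v w] alternating_cong[OF \<beta>, of v w] by simp
next
  fix v :: "nat \<Rightarrow> 'a" and i
  assume i: "i < k"
  show "linear (\<lambda>u. a * \<alpha> (v(i := u)) + b * \<beta> (v(i := u)))"
    using linear_compose_add[OF
        linear_compose_scale_right[OF alternating_linear[OF \<alpha> i, of v], of a]
        linear_compose_scale_right[OF alternating_linear[OF \<beta> i, of v], of b]] by simp
next
  fix v :: "nat \<Rightarrow> 'a" and i j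
  assume *: "i < k" "j < k" "i \<noteq> j" "v i = v j"
  show "a * \<alpha> v + b * \<beta> v = 0"
    using alternating_eq_zero[OF \<alpha> *] alternating_eq_zero[OF \<beta> *] by simp
qed

lemma alternating_diff:
  assumes "alternating_form k \<alpha>" "alternating_form k \<beta>"
  shows "alternating_form k (\<lambda>v. \<alpha> v - \<beta> v)"
  using alternating_combination[OF assms, of 1 "-1"] by simp

lemma alternating_add:
  assumes "alternating_form k \<alpha>" "alternating_form k \<beta>"
  shows "alternating_form k (\<lambda>v. \<alpha> v + \<beta> v)"
  using alternating_combination[OF assms, of 1 1] by simp

lemma alternating_scale:
  assumes "alternating_form k \<alpha>"
  shows "alternating_form k (\<lambda>v. c * \<alpha> v)"
  using alternating_combination[OF assms assms, of c 0] by simp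

lemma alternating_pullback:
  fixes L :: "'a::euclidean_space \<Rightarrow> 'b::euclidean_space"
  assumes "alternating_form k \<alpha>" "linear L"
  shows "alternating_form k (pullback L \<alpha>)"
  unfolding alternating_form_def pullback_def
proof (intro conjI allI impI)
  fix v w :: "nat \<Rightarrow> 'a"
  assume "\<forall>i<k. v i = w i"
  thus "\<alpha> (\<lambda>i. L (v i)) = \<alpha> (\<lambda>i. L (w i))"
    by (intro alternating_cong[OF assms(1)]) auto
next
  fix v :: "nat \<Rightarrow> 'a" and i
  assume "i < k"
  have "(\<lambda>j. L ((v(i := u)) j)) = (\<lambda>j. L (v j))(i := L u)" for u by auto
  thus "linear (\<lambda>u. \<alpha> (\<lambda>j. L ((v(i := u)) j)))"
    using linear_compose[OF assms(2) alternating_linear[OF assms(1) \<open>i < k\<close>]]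
    by (simp add: o_def)
next
  fix v :: "nat \<Rightarrow> 'a" and i j
  assume "i < k" "j < k" "i \<noteq> j" "v i = v j"
  thus "\<alpha> (\<lambda>i. L (v i)) = 0" by (intro alternating_eq_zero[OF assms(1), of i j]) auto
qed

lemma alternating_interior:
  assumes "alternating_form (Suc k) \<alpha>"
  shows "alternating_form k (interior_product x \<alpha>)"
  unfolding alternating_form_def interior_product_def
proof (intro conjI allI impI)
  fix v w :: "nat \<Rightarrow> 'a"
  assume "\<forall>i<k. v i = w i"
  thus "\<alpha> (case_nat x v) = \<alpha> (case_nat x w)"
    by (intro alternating_cong[OF assms]) (auto split: nat.split)
next
  fix v :: "nat \<Rightarrow> 'a" and i
  assume "i < k"
  have "case_nat x (v(i := u)) = (case_nat x v)(Suc i := u)" for u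
    by (auto split: nat.split)
  thus "linear (\<lambda>u. \<alpha> (case_nat x (v(i := u))))"
    using alternating_linear[OF assms, of "Suc i"] \<open>i < k\<close> by simp
next
  fix v :: "nat \<Rightarrow> 'a" and i j
  assume "i < k" "j < k" "i \<noteq> j" "v i = v j"
  thus "\<alpha> (case_nat x v) = 0"
    by (intro alternating_eq_zero[OF assms, of "Suc i" "Suc j"]) auto
qed

text \<open>Under a permutation, argument \<open>m\<close> is read at the single position
  \<open>inv \<pi> m\<close>, which belongs to exactly one of the factors; this gives linearity. If
  two arguments agree, composing all permutations with their transposition reverses the sign of
  every summand, so the sum equals its own negative.\<close>

lemma alternating_wedge:
  assumes \<alpha>: "alternating_form k \<alpha>" and \<beta>: "alternating_form l \<beta>"
  shows "alternating_form (k + l) (wedge k l \<alpha> \<beta>)"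
proof -
  define F where "F v \<pi> = of_int (sign \<pi>) * \<alpha> (\<lambda>i. v (\<pi> i)) * \<beta> (\<lambda>i. v (\<pi> (k + i)))"
    for v \<pi>
  define S where "S = {\<pi>. \<pi> permutes {..<k + l}}"
  have W: "wedge k l \<alpha> \<beta> = (\<lambda>v. (\<Sum>\<pi>\<in>S. F v \<pi>) / (fact k * fact l))"
    unfolding wedge_def F_def S_def by simp
  have inS: "\<pi> i < k + l" if "\<pi> \<in> S" "i < k + l" for \<pi> i
    using that permutes_in_image[of \<pi> "{..<k+l}" i] by (auto simp: S_def)
  show ?thesis
    unfolding alternating_form_def W
  proof (intro conjI allI impI)
    fix v w :: "nat \<Rightarrow> 'a"
    assume *: "\<forall>i<k+l. v i = w i"
    have "F v \<pi> = F w \<pi>" if "\<pi> \<in> S" for \<pi>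
    proof -
      have "\<alpha> (\<lambda>i. v (\<pi> i)) = \<alpha> (\<lambda>i. w (\<pi> i))"
        by (rule alternating_cong[OF \<alpha>]) (use * inS[OF that] in auto)
      moreover have "\<beta> (\<lambda>i. v (\<pi> (k + i))) = \<beta> (\<lambda>i. w (\<pi> (k + i)))"
        by (rule alternating_cong[OF \<beta>]) (use * inS[OF that] in auto)
      ultimately show ?thesis by (simp add: F_def)
    qed
    thus "(\<Sum>\<pi>\<in>S. F v \<pi>) / (fact k * fact l) = (\<Sum>\<pi>\<in>S. F w \<pi>) / (fact k * fact l)" by simp
  next
    fix v :: "nat \<Rightarrow> 'a" and m
    assume m: "m < k + l"
    have "linear (\<lambda>u. F (v(m := u)) \<pi>)" if "\<pi> \<in> S" for \<pi>
    proof -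
      have p: "\<pi> permutes {..<k + l}" using that by (simp add: S_def)
      define j where "j = inv \<pi> m"
      have j: "\<pi> i = m \<longleftrightarrow> i = j" for i
        unfolding j_def using p by (metis permutes_inverses)
      have "j < k + l" using m p unfolding j_def
        by (metis lessThan_iff permutes_in_image permutes_inv)
      then consider "j < k" | j' where "j = k + j'" "j' < l"
        by (metis add_diff_inverse_nat nat_add_left_cancel_less)
      thus ?thesis
      proof cases
        case 1
        have "(\<lambda>i. (v(m := u)) (\<pi> i)) = (\<lambda>i. v (\<pi> i))(j := u)" for u
          by (auto simp: j)
        moreover have "(\<lambda>i. (v(m := u)) (\<pi> (k + i))) = (\<lambda>i. v (\<pi> (k + i)))" for u
          using 1 by (auto simp: j)
        ultimately have "(\<lambda>u. F (v(m := u)) \<pi>) =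
            (\<lambda>u. (of_int (sign \<pi>) * \<beta> (\<lambda>i. v (\<pi> (k + i)))) *\<^sub>R \<alpha> ((\<lambda>i. v (\<pi> i))(j := u)))"
          by (simp add: F_def mult_ac)
        thus ?thesis
          using linear_compose_scale_right[OF alternating_linear[OF \<alpha> 1]] by metis
      next
        case 2
        have "\<alpha> (\<lambda>i. (v(m := u)) (\<pi> i)) = \<alpha> (\<lambda>i. v (\<pi> i))" for u
          by (rule alternating_cong[OF \<alpha>]) (use 2 in \<open>auto simp: j\<close>)
        moreover have "(\<lambda>i. (v(m := u)) (\<pi> (k + i))) = (\<lambda>i. v (\<pi> (k + i)))(j' := u)" for u
          using 2 by (auto simp: j)
        ultimately have "(\<lambda>u. F (v(m := u)) \<pi>) =
            (\<lambda>u. (of_int (sign \<pi>) * \<alpha> (\<lambda>i. v (\<pi> i))) *\<^sub>R \<beta> ((\<lambda>i. v (\<pi> (k + i)))(j' := u)))"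
          by (simp add: F_def mult_ac)
        thus ?thesis
          using linear_compose_scale_right[OF alternating_linear[OF \<beta> 2(2)]] by metis
      qed
    qed
    hence "linear (\<lambda>u. \<Sum>\<pi>\<in>S. F (v(m := u)) \<pi>)"
      by (intro linear_compose_sum) auto
    from linear_compose_scale_right[OF this, of "1 / (fact k * fact l)"]
    show "linear (\<lambda>u. (\<Sum>\<pi>\<in>S. F (v(m := u)) \<pi>) / (fact k * fact l))" by simp
  next
    fix v :: "nat \<Rightarrow> 'a" and i j
    assume ij: "i < k + l" "j < k + l" "i \<noteq> j" "v i = v j"
    have t: "Transposition.transpose i j permutes {..<k + l}" using ij by (auto intro: permutes_swap_id)
    have "(\<Sum>\<pi>\<in>S. F v \<pi>) = (\<Sum>\<pi>\<in>S. F v (Transposition.transpose i j \<circ> \<pi>))"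
      unfolding S_def by (rule setum_permutations_compose_left[OF t])
    also have "\<dots> = (\<Sum>\<pi>\<in>S. - F v \<pi>)"
    proof (rule sum.cong[OF refl])
      fix \<pi> assume "\<pi> \<in> S"
      hence p: "\<pi> permutes {..<k + l}" by (simp add: S_def)
      have "v (Transposition.transpose i j a) = v a" for a using ij by (auto simp: Transposition.transpose_def)
      moreover have "sign (Transposition.transpose i j \<circ> \<pi>) = - sign \<pi>"
        using p ij by (intro sign_transpose_comp) auto
      ultimately show "F v (Transposition.transpose i j \<circ> \<pi>) = - F v \<pi>" by (simp add: F_def)
    qed
    finally show "(\<Sum>\<pi>\<in>S. F v \<pi>) / (fact k * fact l) = 0" by (simp add: sum_negf)
  qed
qed

lemma pullback_wedge:
  "wedge k l (pullback L \<alpha>) (pullback L \<beta>) = pullback L (wedge k l \<alpha> \<beta>)"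
  by (simp add: wedge_def pullback_def)

lemma interior_pullback:
  "interior_product x (pullback L \<alpha>) = pullback L (interior_product (L x) \<alpha>)"
proof -
  have "(\<lambda>i. L (case i of 0 \<Rightarrow> x | Suc n \<Rightarrow> v n)) = case_nat (L x) (\<lambda>i. L (v i))" for v
    by (auto split: nat.split)
  thus ?thesis by (simp add: interior_product_def pullback_def)
qed

section \<open>Permutations sorted by the position of the value 0\<close>

definition lift_perm :: "(nat \<Rightarrow> nat) \<Rightarrow> nat \<Rightarrow> nat" where
  "lift_perm \<rho> = case_nat 0 (\<lambda>i. Suc (\<rho> i))"

lemma lift_perm_simps [simp]: "lift_perm \<rho> 0 = 0" "lift_perm \<rho> (Suc i) = Suc (\<rho> i)"
  by (simp_all add: lift_perm_def)

lemma lift_perm: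
  assumes "\<rho> permutes {..<n}"
  shows "lift_perm \<rho> permutes {..<Suc n} \<and> sign (lift_perm \<rho>) = sign \<rho>"
proof -
  have "finite {..<n}" by simp
  with assms show ?thesis
  proof (induction rule: permutes_induct)
    case id
    have "lift_perm id = id" by (auto simp: lift_perm_def fun_eq_iff split: nat.split)
    thus ?case by (simp add: permutes_id[unfolded id_def] id_def)
  next
    case (swap a b p)
    have eq: "lift_perm (Transposition.transpose a b \<circ> p) = Transposition.transpose (Suc a) (Suc b) \<circ> lift_perm p"
      by (auto simp: lift_perm_def fun_eq_iff Transposition.transpose_def split: nat.split)
    have t: "Transposition.transpose (Suc a) (Suc b) permutes {..<Suc n}"
      using swap by (intro permutes_swap_id) auto
    show ?case
    proof
      show "lift_perm (Transposition.transpose a b \<circ> p) permutes {..<Suc n}"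
        unfolding eq using swap t by (intro permutes_compose) auto
      have "sign (lift_perm (Transposition.transpose a b \<circ> p)) = - sign (lift_perm p)"
        unfolding eq using swap by (intro sign_transpose_comp(1)[of _ "{..<Suc n}"]) auto
      also have "\<dots> = sign (Transposition.transpose a b \<circ> p)"
        using swap sign_transpose_comp(1)[of p "{..<n}" a b] by simp
      finally show "sign (lift_perm (Transposition.transpose a b \<circ> p)) = sign (Transposition.transpose a b \<circ> p)" .
    qed
  qed
qed

text \<open>The lifts are exactly the permutations fixing 0, the terms in which the first vector
  stays in front.\<close>

lemma sum_lift_perm:
  "(\<Sum>\<pi> | \<pi> permutes {..<Suc n} \<and> \<pi> 0 = 0. f \<pi>) = (\<Sum>\<rho> | \<rho> permutes {..<n}. f (lift_perm \<rho>))"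
proof (rule sym, rule sum.reindex_bij_witness[where i = "\<lambda>\<pi> i. \<pi> (Suc i) - 1" and j = lift_perm])
  fix \<rho> assume "\<rho> \<in> {\<rho>. \<rho> permutes {..<n}}"
  thus "lift_perm \<rho> \<in> {\<pi>. \<pi> permutes {..<Suc n} \<and> \<pi> 0 = 0}"
    using lift_perm by auto
next
  fix \<pi> assume "\<pi> \<in> {\<pi>. \<pi> permutes {..<Suc n} \<and> \<pi> 0 = 0}"
  hence p: "\<pi> permutes {..<Suc n}" "\<pi> 0 = 0" by auto
  \<comment> \<open>Injectivity keeps the values at successors away from 0, so the truncated
    subtraction really inverts \<open>Suc\<close>.\<close>
  have pos: "\<pi> (Suc i) > 0" for i
    using p by (metis Zero_neq_Suc gr0I permutes_inj inj_eq)
  show "lift_perm (\<lambda>i. \<pi> (Suc i) - 1) = \<pi>"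
    using pos p(2) by (auto simp: lift_perm_def fun_eq_iff split: nat.split)
  show "(\<lambda>i. \<pi> (Suc i) - 1) \<in> {\<rho>. \<rho> permutes {..<n}}"
    unfolding mem_Collect_eq
  proof (rule bij_imp_permutes)
    show "bij_betw (\<lambda>i. \<pi> (Suc i) - 1) {..<n} {..<n}"
    proof (rule bij_betwI[where g = "\<lambda>i. inv \<pi> (Suc i) - 1"])
      have inv0: "inv \<pi> 0 = 0" using p by (metis permutes_inverses(2))
      have ipos: "inv \<pi> (Suc i) > 0" for i
        using p inv0 by (metis Zero_neq_Suc gr0I permutes_inverses(1))
      have lt: "\<pi> (Suc i) < Suc n" if "i < n" for i
        using that permutes_in_image[OF p(1), of "Suc i"] by simp
      have ilt: "inv \<pi> (Suc i) < Suc n" if "i < n" for i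
        using that permutes_in_image[OF permutes_inv[OF p(1)], of "Suc i"] by simp
      show "(\<lambda>i. \<pi> (Suc i) - 1) \<in> {..<n} \<rightarrow> {..<n}"
      proof
        fix i assume "i \<in> {..<n}"
        thus "\<pi> (Suc i) - 1 \<in> {..<n}" using lt[of i] pos[of i] by simp
      qed
      show "(\<lambda>i. inv \<pi> (Suc i) - 1) \<in> {..<n} \<rightarrow> {..<n}"
      proof
        fix i assume "i \<in> {..<n}"
        thus "inv \<pi> (Suc i) - 1 \<in> {..<n}" using ilt[of i] ipos[of i] by simp
      qed
      show "inv \<pi> (Suc (\<pi> (Suc i) - 1)) - 1 = i" for i
        using pos[of i] p by (simp add: permutes_inverses(2))
      show "\<pi> (Suc (inv \<pi> (Suc i) - 1)) - 1 = i" for i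
        using ipos[of i] p by (simp add: permutes_inverses(1))
    qed
    show "\<pi> (Suc i) - 1 = i" if "i \<notin> {..<n}" for i
      using that permutes_not_in[OF p(1), of "Suc i"] by simp
  qed
qed auto

text \<open>The cycle that sends k to 0 and each i < k to i + 1. Building it from k adjacent
  transpositions makes its sign (-1)^k visible; this is the origin of the sign in the antiderivation
  rule.\<close>

primrec front_cycle :: "nat \<Rightarrow> nat \<Rightarrow> nat" where
  "front_cycle 0 = id"
| "front_cycle (Suc k) = front_cycle k \<circ> Transposition.transpose k (Suc k)"

lemma front_cycle_apply:
  "front_cycle k i = (if i < k then Suc i else if i = k then 0 else i)"
  by (induction k arbitrary: i) (simp_all add: Transposition.transpose_def)

lemma front_cycle:
  "k < n \<Longrightarrow> front_cycle k permutes {..<n} \<and> sign (front_cycle k) = (-1) ^ k"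
proof (induction k)
  case 0
  thus ?case by (simp add: permutes_id[unfolded id_def] id_def)
next
  case (Suc k)
  have t: "Transposition.transpose k (Suc k) permutes {..<n}" using Suc by (intro permutes_swap_id) auto
  have IH: "front_cycle k permutes {..<n}" "sign (front_cycle k) = (-1) ^ k"
    using Suc by auto
  have eq: "front_cycle (Suc k) = front_cycle k \<circ> Transposition.transpose k (Suc k)"
    by (simp add: fun_eq_iff)
  show ?case
    using permutes_compose[OF t IH(1)] sign_transpose_comp(2)[OF IH(1), of k "Suc k"] IH(2)
    unfolding eq by (simp del: o_apply)
qed

text \<open>Each permutation takes the value 0 at exactly one position, namely
  \<open>inv \<pi> 0\<close>.\<close>

lemma sum_permutes_split:
  assumes "0 < n"
  shows "(\<Sum>\<pi> | \<pi> permutes {..<n::nat}. f \<pi>) = (\<Sum>j<n. \<Sum>\<pi> | \<pi> permutes {..<n} \<and> \<pi> j = 0. f \<pi>)"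
proof -
  let ?S = "{\<pi>. \<pi> permutes {..<n}}"
  have fin: "finite ?S" by (rule finite_permutations) simp
  have "(\<Sum>j<n. \<Sum>\<pi> | \<pi> permutes {..<n} \<and> \<pi> j = 0. f \<pi>) =
      (\<Sum>j<n. \<Sum>\<pi>\<in>?S. if inv \<pi> 0 = j then f \<pi> else 0)"
  proof (rule sum.cong[OF refl])
    fix j
    have eq: "{\<pi>. \<pi> permutes {..<n} \<and> \<pi> j = 0} = {\<pi> \<in> ?S. inv \<pi> 0 = j}"
      by (auto dest: permutes_inverses) (metis permutes_inverses)+
    show "(\<Sum>\<pi> | \<pi> permutes {..<n} \<and> \<pi> j = 0. f \<pi>) = (\<Sum>\<pi>\<in>?S. if inv \<pi> 0 = j then f \<pi> else 0)"
      unfolding eq by (rule sum.inter_filter[OF fin])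
  qed
  also have "\<dots> = (\<Sum>\<pi>\<in>?S. \<Sum>j<n. if inv \<pi> 0 = j then f \<pi> else 0)"
    by (rule sum.swap)
  also have "\<dots> = (\<Sum>\<pi>\<in>?S. f \<pi>)"
  proof (rule sum.cong[OF refl])
    fix \<pi> assume "\<pi> \<in> ?S"
    hence "inv \<pi> 0 < n" using permutes_in_image[OF permutes_inv, of \<pi> "{..<n}" 0] assms by simp
    thus "(\<Sum>j<n. if inv \<pi> 0 = j then f \<pi> else 0) = f \<pi>" by simp
  qed
  finally show ?thesis by simp
qed

lemma sum_lessThan_add:
  fixes f :: "nat \<Rightarrow> 'a::comm_monoid_add"
  shows "(\<Sum>j<a + b. f j) = (\<Sum>j<a. f j) + (\<Sum>j<b. f (a + j))"
  by (induction b) (simp_all add: add.assoc)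

text \<open>
  Interior multiplication is an antiderivation of the wedge product. The permutations in the definition
  of the product are sorted by the position of the first vector; by alternation, all positions among
  the arguments of \<open>\<alpha>\<close> contribute equally, and so do all positions among those of \<open>\<beta>\<close>.
\<close>

lemma wedge_case_nat:
  assumes \<alpha>: "alternating_form (Suc k) \<alpha>" and \<beta>: "alternating_form (Suc l) \<beta>"
  shows "wedge (Suc k) (Suc l) \<alpha> \<beta> (case_nat x u) =
    wedge k (Suc l) (interior_product x \<alpha>) \<beta> u
      + (-1) ^ Suc k * wedge (Suc k) l \<alpha> (interior_product x \<beta>) u"
proof -
  define v where "v = case_nat x u"
  define n where "n = Suc (k + l)"
  define F where "F \<pi> = of_int (sign \<pi>) * \<alpha> (\<lambda>i. v (\<pi> i)) * \<beta> (\<lambda>i. v (\<pi> (Suc k + i)))" for \<pi>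
  define S where "S j = {\<pi>. \<pi> permutes {..<Suc n} \<and> \<pi> j = (0::nat)}" for j
  have n: "Suc k + Suc l = Suc n" by (simp add: n_def)
  have swap: "(\<Sum>\<pi>\<in>S i. F \<pi>) = (\<Sum>\<pi>\<in>S j. F \<pi>)"
    if ij: "i < Suc n" "j < Suc n" and
      inv: "\<And>\<pi>. \<pi> permutes {..<Suc n} \<Longrightarrow> i \<noteq> j \<Longrightarrow> F (\<pi> \<circ> Transposition.transpose i j) = F \<pi>" for i j
  proof (cases "i = j")
    case False
    have t: "Transposition.transpose i j permutes {..<Suc n}" using ij by (intro permutes_swap_id) auto
    show ?thesis
    proof (rule sum.reindex_bij_witness[where i = "\<lambda>\<pi>. \<pi> \<circ> Transposition.transpose i j" and j = "\<lambda>\<pi>. \<pi> \<circ> Transposition.transpose i j"])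
    qed (use inv t False in \<open>auto simp: S_def o_assoc[symmetric] permutes_compose\<close>)
  qed simp
  have sgn: "sign (\<pi> \<circ> Transposition.transpose i j) = - sign \<pi>" if "\<pi> permutes {..<Suc n}" "i \<noteq> j" for \<pi> i j
    using that by (intro sign_transpose_comp(2)) auto
  \<comment> \<open>Exchanging two positions inside \<alpha> reverses both \<open>sign \<pi>\<close>
    and the value of \<alpha>, and \<beta> does not see the change.\<close>
  have left: "(\<Sum>\<pi>\<in>S j. F \<pi>) = (\<Sum>\<pi>\<in>S 0. F \<pi>)" if j: "j < Suc k" for j
  proof (rule swap)
    fix \<pi> assume p: "\<pi> permutes {..<Suc n}" "j \<noteq> 0"
    have "\<alpha> (\<lambda>i. v ((\<pi> \<circ> Transposition.transpose j 0) i)) = - \<alpha> (\<lambda>i. v (\<pi> i))"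
      using alternating_swap[OF \<alpha> j, of 0 "v \<circ> \<pi>"] p by (simp add: o_def)
    moreover have "Transposition.transpose j 0 (Suc k + i) = Suc k + i" for i
      using j by (simp add: Transposition.transpose_def)
    ultimately show "F (\<pi> \<circ> Transposition.transpose j 0) = F \<pi>"
      unfolding F_def sgn[OF p] by simp
  qed (use j in \<open>auto simp: n_def\<close>)
  have right: "(\<Sum>\<pi>\<in>S (Suc k + j). F \<pi>) = (\<Sum>\<pi>\<in>S (Suc k). F \<pi>)" if j: "j < Suc l" for j
  proof (rule swap)
    fix \<pi> assume p: "\<pi> permutes {..<Suc n}" "Suc k + j \<noteq> Suc k"
    have t: "Transposition.transpose (Suc k + j) (Suc k) (Suc k + i) = Suc k + Transposition.transpose j 0 i" for i
      by (simp add: Transposition.transpose_def)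
    have "\<beta> (\<lambda>i. v ((\<pi> \<circ> Transposition.transpose (Suc k + j) (Suc k)) (Suc k + i))) = - \<beta> (\<lambda>i. v (\<pi> (Suc k + i)))"
      using alternating_swap[OF \<beta> j, of 0 "\<lambda>i. v (\<pi> (Suc k + i))"] p
      by (simp add: o_def t del: add_Suc)
    moreover have "\<alpha> (\<lambda>i. v ((\<pi> \<circ> Transposition.transpose (Suc k + j) (Suc k)) i)) = \<alpha> (\<lambda>i. v (\<pi> i))"
      by (rule alternating_cong[OF \<alpha>]) (simp add: Transposition.transpose_def)
    ultimately show "F (\<pi> \<circ> Transposition.transpose (Suc k + j) (Suc k)) = F \<pi>"
      unfolding F_def sgn[OF p] by simp
  qed (use j in \<open>auto simp: n_def\<close>)
  have F0: "F (lift_perm \<rho>) = of_int (sign \<rho>) * interior_product x \<alpha> (\<lambda>i. u (\<rho> i)) * \<beta> (\<lambda>i. u (\<rho> (k + i)))"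
    if "\<rho> permutes {..<n}" for \<rho>
  proof -
    have "(\<lambda>i. v (lift_perm \<rho> i)) = case_nat x (\<lambda>i. u (\<rho> i))"
      by (auto simp: v_def lift_perm_def fun_eq_iff split: nat.split)
    thus ?thesis using lift_perm[OF that]
      by (simp add: F_def interior_product_def) (simp add: v_def)
  qed
  have fc: "front_cycle (Suc k) permutes {..<Suc n}" "sign (front_cycle (Suc k)) = (-1) ^ Suc k"
    using front_cycle[of "Suc k" "Suc n"] by (simp_all add: n_def del: front_cycle.simps)
  \<comment> \<open>Precomposition with the cycle carries the zero from position 0 to position
    \<open>Suc k\<close>, the first slot of \<beta>, and keeps the other vectors in order.\<close>
  have S_Suc: "(\<Sum>\<pi>\<in>S (Suc k). F \<pi>) = (\<Sum>\<pi>\<in>S 0. F (\<pi> \<circ> front_cycle (Suc k)))"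
  proof (rule sum.reindex_bij_witness[where j = "\<lambda>\<pi>. \<pi> \<circ> inv (front_cycle (Suc k))"
        and i = "\<lambda>\<pi>. \<pi> \<circ> front_cycle (Suc k)"])
    fix \<pi> assume "\<pi> \<in> S (Suc k)"
    moreover have "inv (front_cycle (Suc k)) 0 = Suc k"
      using permutes_inverses(2)[OF fc(1), of "Suc k"] by (simp add: front_cycle_apply del: front_cycle.simps)
    ultimately show "\<pi> \<circ> inv (front_cycle (Suc k)) \<in> S 0"
      using fc(1) by (auto simp: S_def permutes_compose permutes_inv simp del: front_cycle.simps)
  next
    fix \<pi> assume "\<pi> \<in> S 0"
    thus "\<pi> \<circ> front_cycle (Suc k) \<in> S (Suc k)"
      using fc(1) by (auto simp: S_def permutes_compose front_cycle_apply simp del: front_cycle.simps)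
  qed (simp_all add: o_assoc[symmetric] permutes_inv_o[OF fc(1)] del: front_cycle.simps)
  have F1: "F (lift_perm \<rho> \<circ> front_cycle (Suc k)) = (-1) ^ Suc k *
      (of_int (sign \<rho>) * \<alpha> (\<lambda>i. u (\<rho> i)) * interior_product x \<beta> (\<lambda>i. u (\<rho> (Suc k + i))))"
    if "\<rho> permutes {..<n}" for \<rho>
  proof -
    have "\<alpha> (\<lambda>i. v ((lift_perm \<rho> \<circ> front_cycle (Suc k)) i)) = \<alpha> (\<lambda>i. u (\<rho> i))"
      by (rule alternating_cong[OF \<alpha>]) (simp add: front_cycle_apply v_def del: front_cycle.simps)
    moreover have "(\<lambda>i. v ((lift_perm \<rho> \<circ> front_cycle (Suc k)) (Suc k + i))) = case_nat x (\<lambda>i. u (\<rho> (Suc k + i)))"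
      by (auto simp: front_cycle_apply v_def fun_eq_iff simp del: front_cycle.simps split: nat.split)
    moreover have "sign (lift_perm \<rho> \<circ> front_cycle (Suc k)) = (-1) ^ Suc k * sign \<rho>"
      using fc lift_perm[OF that]
      by (simp add: sign_compose permutes_imp_permutation[of "{..<Suc n}"] del: front_cycle.simps)
    ultimately show ?thesis by (simp add: F_def interior_product_def del: front_cycle.simps)
  qed
  define A where "A = wedge k (Suc l) (interior_product x \<alpha>) \<beta> u"
  define B where "B = wedge (Suc k) l \<alpha> (interior_product x \<beta>) u"
  have "(\<Sum>\<pi>\<in>S 0. F \<pi>) = (\<Sum>\<rho> | \<rho> permutes {..<n}.
      of_int (sign \<rho>) * interior_product x \<alpha> (\<lambda>i. u (\<rho> i)) * \<beta> (\<lambda>i. u (\<rho> (k + i))))"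
    unfolding S_def sum_lift_perm by (rule sum.cong[OF refl], rule F0) simp
  hence s0: "(\<Sum>\<pi>\<in>S 0. F \<pi>) = fact k * fact (Suc l) * A"
    by (simp add: A_def wedge_def n_def del: fact_Suc)
  have "(\<Sum>\<pi>\<in>S (Suc k). F \<pi>) = (\<Sum>\<rho> | \<rho> permutes {..<n}. (-1) ^ Suc k *
      (of_int (sign \<rho>) * \<alpha> (\<lambda>i. u (\<rho> i)) * interior_product x \<beta> (\<lambda>i. u (\<rho> (Suc k + i)))))"
    unfolding S_Suc unfolding S_def sum_lift_perm
    by (rule sum.cong[OF refl], rule F1) simp
  hence s1: "(\<Sum>\<pi>\<in>S (Suc k). F \<pi>) = (-1) ^ Suc k * (fact (Suc k) * fact l * B)"
    unfolding sum_distrib_left[symmetric] by (simp add: B_def wedge_def n_def del: fact_Suc power_Suc)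
  have "(\<Sum>\<pi> | \<pi> permutes {..<Suc n}. F \<pi>) = (\<Sum>j<Suc n. \<Sum>\<pi>\<in>S j. F \<pi>)"
    unfolding S_def by (rule sum_permutes_split) simp
  also have "\<dots> = (\<Sum>j<Suc k. \<Sum>\<pi>\<in>S j. F \<pi>) + (\<Sum>j<Suc l. \<Sum>\<pi>\<in>S (Suc k + j). F \<pi>)"
    unfolding n[symmetric] by (rule sum_lessThan_add)
  also have "\<dots> = (\<Sum>j<Suc k. \<Sum>\<pi>\<in>S 0. F \<pi>) + (\<Sum>j<Suc l. \<Sum>\<pi>\<in>S (Suc k). F \<pi>)"
    by (intro arg_cong2[where f = "(+)"] sum.cong[OF refl, where A = "{..<Suc k}"]
        sum.cong[OF refl, where A = "{..<Suc l}"] left right) auto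
  also have "\<dots> = real (Suc k) * (fact k * fact (Suc l) * A)
      + real (Suc l) * ((-1) ^ Suc k * (fact (Suc k) * fact l * B))"
    unfolding s0 s1 sum_constant card_lessThan ..
  \<comment> \<open>The k + 1 equal positions turn k! into (k + 1)!, and likewise for l; after the
    normalisation of \<open>wedge\<close> both terms have a coefficient of modulus 1.\<close>
  also have "\<dots> = fact (Suc k) * fact (Suc l) * (A + (-1) ^ Suc k * B)"
    by (simp add: algebra_simps del: power_Suc)
  finally have "(\<Sum>\<pi> | \<pi> permutes {..<Suc n}. F \<pi>) =
      fact (Suc k) * fact (Suc l) * (A + (-1) ^ Suc k * B)" .
  moreover have "wedge (Suc k) (Suc l) \<alpha> \<beta> v = (\<Sum>\<pi> | \<pi> permutes {..<Suc n}. F \<pi>) / (fact (Suc k) * fact (Suc l))"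
    unfolding wedge_def n F_def by simp
  ultimately show ?thesis by (simp add: v_def A_def B_def del: fact_Suc power_Suc)
qed

text \<open>Endpoint of the expansion: a 0-form is constant, alternation makes all l! summands
  equal, and their number cancels against the normalising factor.\<close>

lemma wedge_0_left:
  assumes "alternating_form 0 \<alpha>" "alternating_form l \<beta>"
  shows "wedge 0 l \<alpha> \<beta> v = \<alpha> v * \<beta> v"
proof -
  have "of_int (sign \<pi>) * \<alpha> (\<lambda>i. v (\<pi> i)) * \<beta> (\<lambda>i. v (\<pi> i)) = \<alpha> v * \<beta> v"
    if "\<pi> permutes {..<l}" for \<pi>
  proof -
    have "\<alpha> (\<lambda>i. v (\<pi> i)) = \<alpha> v" by (rule alternating_cong[OF assms(1)]) simp
    moreover have "\<beta> (\<lambda>i. v (\<pi> i)) = of_int (sign \<pi>) * \<beta> v"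
      using alternating_permutes[OF assms(2) that, of v] by (simp add: o_def)
    moreover have "of_int (sign \<pi>) * of_int (sign \<pi>) = (1::real)"
      by (metis of_int_1 of_int_mult sign_idempotent)
    ultimately show ?thesis by simp
  qed
  hence "(\<Sum>\<pi> | \<pi> permutes {..<l}. of_int (sign \<pi>) * \<alpha> (\<lambda>i. v (\<pi> i)) * \<beta> (\<lambda>i. v (\<pi> i)))
      = fact l * (\<alpha> v * \<beta> v)"
    by (simp add: card_permutations)
  thus ?thesis by (simp add: wedge_def)
qed

lemma wedge_0_right:
  assumes "alternating_form k \<alpha>" "alternating_form 0 \<beta>"
  shows "wedge k 0 \<alpha> \<beta> v = \<alpha> v * \<beta> v"
proof -
  have "of_int (sign \<pi>) * \<alpha> (\<lambda>i. v (\<pi> i)) * \<beta> (\<lambda>i. v (\<pi> (k + i))) = \<alpha> v * \<beta> v"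
    if "\<pi> permutes {..<k}" for \<pi>
  proof -
    have "\<beta> (\<lambda>i. v (\<pi> (k + i))) = \<beta> v" by (rule alternating_cong[OF assms(2)]) simp
    moreover have "\<alpha> (\<lambda>i. v (\<pi> i)) = of_int (sign \<pi>) * \<alpha> v"
      using alternating_permutes[OF assms(1) that, of v] by (simp add: o_def)
    moreover have "of_int (sign \<pi>) * of_int (sign \<pi>) = (1::real)"
      by (metis of_int_1 of_int_mult sign_idempotent)
    ultimately show ?thesis by simp
  qed
  hence "(\<Sum>\<pi> | \<pi> permutes {..<k}. of_int (sign \<pi>) * \<alpha> (\<lambda>i. v (\<pi> i)) * \<beta> (\<lambda>i. v (\<pi> (k + i))))
      = fact k * (\<alpha> v * \<beta> v)"
    by (simp add: card_permutations)
  thus ?thesis by (simp add: wedge_def)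
qed

text \<open>
  Forms are evaluated on lists \<open>xs\<close> of vectors, that is at the sequence \<open>(!) xs\<close>. Its entries from
  \<open>length xs\<close> on are unspecified, but a form of degree at most \<open>length xs\<close> does not see them. Iterating
  \<open>wedge_nth\<close> expands a wedge product into its shuffles.
\<close>

lemma case_nat_nth: "case_nat x ((!) xs) = (!) (x # xs)"
  by (auto simp: fun_eq_iff split: nat.split)

lemma interior_nth: "interior_product x \<alpha> ((!) xs) = \<alpha> ((!) (x # xs))"
  by (simp add: interior_product_def case_nat_nth)

lemma nth_list_update_fun: "i < length xs \<Longrightarrow> (!) (xs[i := u]) = ((!) xs)(i := u)"
  by (auto simp: fun_eq_iff nth_list_update)

lemma wedge_nth:
  assumes "alternating_form k \<alpha>" "alternating_form l \<beta>" "0 < k" "0 < l"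
  shows "wedge k l \<alpha> \<beta> ((!) (x # xs)) =
    wedge (k - 1) l (interior_product x \<alpha>) \<beta> ((!) xs)
      + (-1) ^ k * wedge k (l - 1) \<alpha> (interior_product x \<beta>) ((!) xs)"
  using wedge_case_nat[of "k - 1" \<alpha> "l - 1" \<beta> x "(!) xs"] assms by (simp add: case_nat_nth)

lemma alternating_coord: "alternating_form (Suc 0) (\<lambda>v. v 0 $ i)"
  by (auto simp: alternating_form_def intro!: linearI)

lemma alternating_nth_cong:
  assumes "alternating_form k \<alpha>" "take k xs = take k ys" "k \<le> length xs" "k \<le> length ys"
  shows "\<alpha> ((!) xs) = \<alpha> ((!) ys)"
  by (rule alternating_cong[OF assms(1)]) (metis assms(2) nth_take)

lemma alternating_nth_swap:
  assumes "alternating_form k \<alpha>" "i < k" "j < k" "i \<noteq> j" "k \<le> length xs"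
  shows "\<alpha> ((!) (xs[i := xs ! j, j := xs ! i])) = - \<alpha> ((!) xs)"
proof -
  have "\<alpha> ((!) (xs[i := xs ! j, j := xs ! i])) = \<alpha> ((!) xs \<circ> Transposition.transpose i j)"
    by (rule alternating_cong[OF assms(1)])
      (use assms in \<open>auto simp: nth_list_update Transposition.transpose_def\<close>)
  thus ?thesis using alternating_swap[OF assms(1-4), of "(!) xs"] by simp
qed

lemma alternating_expand:
  assumes "alternating_form k \<alpha>" "m < k"
  shows "\<alpha> v = (\<Sum>b\<in>Basis. (v m \<bullet> b) * \<alpha> (v(m := b)))"
proof -
  have "\<alpha> v = \<alpha> (v(m := (\<Sum>b\<in>Basis. (v m \<bullet> b) *\<^sub>R b)))"
    by (simp add: euclidean_representation)
  also have "\<dots> = (\<Sum>b\<in>Basis. (v m \<bullet> b) * \<alpha> (v(m := b)))"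
    by (simp add: linear_sum[OF alternating_linear[OF assms]] linear_scale[OF alternating_linear[OF assms]])
  finally show ?thesis .
qed

section \<open>The standard basis and the reduction to increasing basis tuples\<close>

text \<open>
  Vectors are numbered from \<open>0\<close> while the coordinates of the paper are numbered from \<open>1\<close>.
\<close>

definition sidx :: "nat \<Rightarrow> 7" where "sidx i = of_nat (Suc i)"

definition ebasis :: "nat \<Rightarrow> real^7" where "ebasis i = axis (sidx i) 1"

lemma sidx_eq:
  assumes "i < 7" "j < 7"
  shows "sidx i = sidx j \<longleftrightarrow> i = j"
proof -
  have "i = j" if "i < 7" "j < 7" "i \<le> j" "sidx i = sidx j" for i j
  proof -
    have "(of_nat (j - i) :: 7) = 0" using that by (simp add: sidx_def of_nat_diff)
    hence "7 dvd j - i" by (simp add: of_nat_eq_0_iff_char_dvd)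
    thus ?thesis using that by (auto dest: dvd_imp_le)
  qed
  thus ?thesis using assms by (metis nle_le)
qed

lemma bij_sidx: "bij_betw sidx {..<7} UNIV"
proof -
  have "inj_on sidx {..<7}" by (auto simp: inj_on_def sidx_eq)
  moreover from this have "sidx ` {..<7} = UNIV"
    by (intro card_seteq) (auto simp: card_image)
  ultimately show ?thesis by (simp add: bij_betw_def)
qed

lemma sidx_numeral:
  "sidx 0 = 1" "sidx (Suc 0) = 2" "sidx 2 = 3" "sidx 3 = 4" "sidx 4 = 5" "sidx 5 = 6" "sidx 6 = 7"
  by (simp_all add: sidx_def)

lemma sum_UNIV_7: "(\<Sum>a\<in>(UNIV::7 set). f a) = (\<Sum>i<7. f (sidx i))"
  using sum.reindex_bij_betw[OF bij_sidx, of f] by simp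

lemma Basis_7: "(Basis :: (real^7) set) = ebasis ` {..<7}"
proof -
  have "(Basis :: (real^7) set) = range (\<lambda>i. axis i 1)" by (auto simp: Basis_vec_def)
  also have "\<dots> = (\<lambda>i. axis i 1) ` (sidx ` {..<7})"
    using bij_sidx by (simp add: bij_betw_def)
  finally show ?thesis by (simp add: image_image ebasis_def)
qed

lemma ebasis_nth: "i < 7 \<Longrightarrow> j < 7 \<Longrightarrow> ebasis i $ sidx j = (if i = j then 1 else 0)"
  by (simp add: ebasis_def axis_def sidx_eq eq_commute)

lemma ebasis_component:
  assumes "i < 7"
  shows "ebasis i $ 1 = (if i = 0 then 1 else 0)" "ebasis i $ 2 = (if i = 1 then 1 else 0)"
    "ebasis i $ 3 = (if i = 2 then 1 else 0)" "ebasis i $ 4 = (if i = 3 then 1 else 0)"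
    "ebasis i $ 5 = (if i = 4 then 1 else 0)" "ebasis i $ 6 = (if i = 5 then 1 else 0)"
    "ebasis i $ 7 = (if i = 6 then 1 else 0)"
  using assms ebasis_nth[of i 0] ebasis_nth[of i 1] ebasis_nth[of i 2] ebasis_nth[of i 3]
    ebasis_nth[of i 4] ebasis_nth[of i 5] ebasis_nth[of i 6] by (simp_all add: sidx_numeral)

text \<open>Multilinearity reduces to basis vectors, alternation to distinct ones, and sorting them
  costs only a sign. Identities of forms thus become finite checks.\<close>

lemma alternating_zeroI:
  fixes \<alpha> :: "(real^7) form"
  assumes \<alpha>: "alternating_form k \<alpha>"
    and incr: "\<And>xs. length xs = k \<Longrightarrow> sorted_wrt (<) xs \<Longrightarrow> set xs \<subseteq> {..<7} \<Longrightarrow>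
      \<alpha> ((!) (map ebasis xs)) = 0"
  shows "\<alpha> v = 0"
proof -
  have basis: "\<alpha> v = 0" if v: "\<And>i. i < k \<Longrightarrow> v i \<in> Basis" for v
  proof -
    have "\<exists>I. \<forall>i<k. I i < 7 \<and> v i = ebasis (I i)"
      using v unfolding Basis_7 image_iff by (metis lessThan_iff)
    then obtain I where I: "\<And>i. i < k \<Longrightarrow> I i < 7" "\<And>i. i < k \<Longrightarrow> v i = ebasis (I i)" by blast
    define xs where "xs = map I [0..<k]"
    have len: "length xs = k" by (simp add: xs_def)
    show ?thesis
    proof (cases "distinct xs")
      case False
      then obtain i j where "i < k" "j < k" "i \<noteq> j" "I i = I j"
        by (auto simp: xs_def distinct_conv_nth)
      thus ?thesis using I by (intro alternating_eq_zero[OF \<alpha>, of i j]) auto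
    next
      case True
      have "mset (sort xs) = mset xs" by simp
      then obtain p where p: "p permutes {..<length xs}" "permute_list p xs = sort xs"
        by (rule mset_eq_permutation)
      have *: "\<alpha> (v \<circ> p) = \<alpha> ((!) (map ebasis (sort xs)))"
      proof (rule alternating_cong[OF \<alpha>])
        fix i assume i: "i < k"
        have pi: "p i < k" using permutes_in_image[OF p(1), of i] i len by simp
        have "sort xs ! i = xs ! p i"
          using permute_list_nth[OF p(1), of i] p(2) i len by simp
        thus "(v \<circ> p) i = map ebasis (sort xs) ! i" using i pi I by (simp add: len) (simp add: xs_def)
      qed
      have "sorted_wrt (<) (sort xs)" using True by (simp add: strict_sorted_iff)
      moreover have "set (sort xs) \<subseteq> {..<7}" using I by (auto simp: xs_def)
      ultimately have "\<alpha> (v \<circ> p) = 0" unfolding * using len by (intro incr) auto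
      thus ?thesis using alternating_permutes[OF \<alpha>, of p v] p(1) len by simp
    qed
  qed
  \<comment> \<open>\<open>m\<close> bounds the slots that may still be arbitrary; those from
    \<open>m\<close> on hold basis vectors. Expanding one more slot lowers the bound.\<close>
  have "\<alpha> v = 0" if "m \<le> k" "\<And>i. i < k \<Longrightarrow> m \<le> i \<Longrightarrow> v i \<in> Basis" for m v
    using that
  proof (induction m arbitrary: v)
    case 0
    thus ?case using basis by simp
  next
    case (Suc m)
    have "\<alpha> (v(m := b)) = 0" if "b \<in> Basis" for b
      using Suc.prems that by (intro Suc.IH) auto
    thus ?case using alternating_expand[OF \<alpha>, of m v] Suc.prems by simp
  qed
  from this[of k v] show ?thesis by simp
qed

definition e7 :: "(real^7) list" where
  "e7 = [ebasis 0, ebasis 1, ebasis 2, ebasis 3, ebasis 4, ebasis 5, ebasis 6]"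

text \<open>The only increasing list of seven numbers below 7 is \<open>[0..<7]\<close>, so a 7-form
  has a single component.\<close>

lemma alternating_top_eqI:
  fixes \<alpha> \<beta> :: "(real^7) form"
  assumes "alternating_form 7 \<alpha>" "alternating_form 7 \<beta>" "\<alpha> ((!) e7) = \<beta> ((!) e7)"
  shows "\<alpha> = \<beta>"
proof
  fix v
  have "\<alpha> v - \<beta> v = 0"
  proof (rule alternating_zeroI[OF alternating_diff[OF assms(1,2)]])
    fix xs :: "nat list"
    assume xs: "length xs = 7" "sorted_wrt (<) xs" "set xs \<subseteq> {..<7}"
    have "set xs = {..<7}"
      using xs by (intro card_seteq) (auto simp: distinct_card strict_sorted_iff)
    hence "xs = [0..<7]"
      using xs(2) strict_sorted_equal[of xs "[0..<7]"] by (auto simp: atLeast0LessThan)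
    hence "map ebasis xs = e7" by (simp add: e7_def upt_rec numeral_eq_Suc)
    thus "\<alpha> ((!) (map ebasis xs)) - \<beta> ((!) (map ebasis xs)) = 0" using assms(3) by simp
  qed
  thus "\<alpha> v = \<beta> v" by simp
qed

lemma alternating_dx3: "alternating_form 3 (dx3 i j k)"
  using alternating_wedge[OF alternating_coord[of i]
      alternating_wedge[OF alternating_coord[of j] alternating_coord[of k]]]
  by (simp add: dx3_def numeral_eq_Suc)

lemma alternating_phi0: "alternating_form 3 phi0"
  unfolding phi0_def by (intro alternating_add alternating_diff alternating_dx3)

definition dx4 :: "7 \<Rightarrow> 7 \<Rightarrow> 7 \<Rightarrow> 7 \<Rightarrow> (real^7) form" where
  "dx4 i j k l = wedge 1 3 (\<lambda>v. v 0 $ i) (dx3 j k l)"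

lemma alternating_dx4: "alternating_form 4 (dx4 i j k l)"
  using alternating_wedge[OF alternating_coord[of i] alternating_dx3[of j k l]]
  by (simp add: dx4_def)

text \<open>
  The Hodge dual of \<open>phi0\<close>; see \<open>wedge_psi0\<close>.
\<close>

definition psi0 :: "(real^7) form" where
  "psi0 = (\<lambda>v. dx4 4 5 6 7 v + dx4 2 3 6 7 v + dx4 2 3 4 5 v + dx4 1 3 5 7 v
             - dx4 1 3 4 6 v - dx4 1 2 5 6 v - dx4 1 2 4 7 v)"

lemma alternating_psi0: "alternating_form 4 psi0"
  unfolding psi0_def by (intro alternating_add alternating_diff alternating_dx4)

section \<open>The model forms on \<open>real^7\<close>\<close>

lemma alternating_interior_diff_1:
  assumes "alternating_form k \<alpha>" "0 < k"
  shows "alternating_form (k - 1) (interior_product x \<alpha>)"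
  using assms alternating_interior[of "k - 1" \<alpha> x] by simp

text \<open>Peeling off the vectors with \<open>wedge_nth\<close> until a factor has degree 0 yields
  the 3 by 3 minor, expanded along coordinate i.\<close>

lemma dx3_nth:
  "dx3 i j k ((!) [x, y, z]) = x $ i * (y $ j * z $ k - y $ k * z $ j)
     - y $ i * (x $ j * z $ k - x $ k * z $ j) + z $ i * (x $ j * y $ k - x $ k * y $ j)"
proof -
  have s: "Suc (Suc 0) = 2" by simp
  have i: "interior_product x (\<lambda>v::nat\<Rightarrow>real^7. v 0 $ i) = (\<lambda>v. x $ i)" for x i
    by (simp add: interior_product_def)
  have c: "alternating_form 0 (\<lambda>v::nat\<Rightarrow>real^7. c)" for c
    by (simp add: alternating_form_def)
  note a = alternating_coord
  have a2: "alternating_form 2 (wedge (Suc 0) (Suc 0) (\<lambda>v::nat\<Rightarrow>real^7. v 0 $ i) (\<lambda>v. v 0 $ j))" for i j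
    using alternating_wedge[OF a a, of i j] by (simp add: numeral_2_eq_2)
  note a2' = alternating_interior_diff_1[OF a2, simplified]
  note a2'' = alternating_interior_diff_1[OF a2', simplified]
  show ?thesis unfolding dx3_def
    by (simp add: wedge_nth wedge_0_left wedge_0_right interior_nth i a c a2 a2' a2'' algebra_simps)
qed

lemma dx4_nth:
  "dx4 i j k l ((!) [w, x, y, z]) = w $ i * dx3 j k l ((!) [x, y, z]) - x $ i * dx3 j k l ((!) [w, y, z])
     + y $ i * dx3 j k l ((!) [w, x, z]) - z $ i * dx3 j k l ((!) [w, x, y])"
proof -
  have i: "interior_product x (\<lambda>v::nat\<Rightarrow>real^7. v 0 $ i) = (\<lambda>v. x $ i)" for x i
    by (simp add: interior_product_def)
  have c: "alternating_form 0 (\<lambda>v::nat\<Rightarrow>real^7. c)" for c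
    by (simp add: alternating_form_def)
  note a3 = alternating_dx3
  note a2 = alternating_interior_diff_1[OF a3, simplified]
  note a1 = alternating_interior_diff_1[OF a2, simplified]
  note a0 = alternating_interior_diff_1[OF a1, simplified]
  \<comment> \<open>\<open>wedge_0_right\<close> evaluates the exhausted factor at what is left of
    the list, which appends a fourth vector that a 3-form ignores.\<close>
  have t: "dx3 j k l ((!) [x,y,z,w]) = dx3 j k l ((!) [x,y,z])" for x y z w
    by (rule alternating_nth_cong[OF a3]) simp_all
  show ?thesis unfolding dx4_def
    by (simp add: wedge_nth wedge_0_left wedge_0_right interior_nth i alternating_coord c a3 a2 a1 a0 t algebra_simps)
qed

lemmas phi0_nth = phi0_def[THEN fun_cong, of "(!) [x, y, z]" for x y z, unfolded dx3_nth]
lemmas psi0_nth = psi0_def[THEN fun_cong, of "(!) [x, y, z, w]" for x y z w, unfolded dx4_nth dx3_nth]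

lemma phi0_nth_more: "phi0 ((!) (x # y # z # w # ws)) = phi0 ((!) [x, y, z])"
  by (rule alternating_nth_cong[OF alternating_phi0]) simp_all

lemma sum_lessThan_7: "(\<Sum>i<7::nat. f i) = f 0 + f 1 + f 2 + f 3 + f 4 + f 5 + f 6"
  by (simp add: numeral_eq_Suc add.assoc)

lemma inner_7: "x \<bullet> y = x $ 1 * y $ 1 + x $ 2 * y $ 2 + x $ 3 * y $ 3 + x $ 4 * y $ 4
    + x $ 5 * y $ 5 + x $ 6 * y $ 6 + x $ 7 * y $ (7::7)"
  by (simp add: inner_vec_def sum_UNIV_7 sum_lessThan_7 sidx_numeral)

text \<open>A 7-form is determined by this single value. The computation says that
  \<open>phi0\<close> induces the Euclidean metric and makes the standard basis positive; 6 is the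
  constant in \<open>g2_metric_volume\<close>.\<close>

lemma phi0_bilinear_form:
  "wedge 4 3 (wedge 2 2 (interior_product x phi0) (interior_product y phi0)) phi0 ((!) e7)
     = 6 * (x \<bullet> y)"
proof -
  note p3 = alternating_phi0
  note p2 = alternating_interior_diff_1[OF p3, simplified]
  note p1 = alternating_interior_diff_1[OF p2, simplified]
  note p0 = alternating_interior_diff_1[OF p1, simplified]
  note w4 = alternating_wedge[OF p2 p2, simplified]
  note w3 = alternating_interior_diff_1[OF w4, simplified]
  note w2 = alternating_interior_diff_1[OF w3, simplified]
  note w1 = alternating_interior_diff_1[OF w2, simplified]
  note w0 = alternating_interior_diff_1[OF w1, simplified]
  show ?thesis
    by (simp add: wedge_nth wedge_0_left wedge_0_right interior_nth
        p3 p2 p1 p0 w4 w3 w2 w1 w0 phi0_nth_more e7_def)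
      (simp add: phi0_nth ebasis_component inner_7)
qed

lemma alternating_3_perm:
  assumes "alternating_form 3 \<gamma>"
  shows "\<gamma> ((!) [y, x, z]) = - \<gamma> ((!) [x, y, z])"
    and "\<gamma> ((!) [x, z, y]) = - \<gamma> ((!) [x, y, z])"
    and "\<gamma> ((!) [y, z, x]) = \<gamma> ((!) [x, y, z])"
    and "\<gamma> ((!) [z, x, y]) = \<gamma> ((!) [x, y, z])"
    and "\<gamma> ((!) [z, y, x]) = - \<gamma> ((!) [x, y, z])"
proof -
  have 01: "\<gamma> ((!) [y, x, z]) = - \<gamma> ((!) [x, y, z])" for x y z
    using alternating_nth_swap[OF assms, of 0 1 "[x, y, z]"] by simp
  have 12: "\<gamma> ((!) [x, z, y]) = - \<gamma> ((!) [x, y, z])" for x y z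
    using alternating_nth_swap[OF assms, of 1 2 "[x, y, z]"] by (simp add: numeral_2_eq_2)
  show "\<gamma> ((!) [y, x, z]) = - \<gamma> ((!) [x, y, z])" "\<gamma> ((!) [x, z, y]) = - \<gamma> ((!) [x, y, z])"
    by (rule 01, rule 12)
  show "\<gamma> ((!) [y, z, x]) = \<gamma> ((!) [x, y, z])" using 01[of y x z] 12[of y z x] by simp
  show "\<gamma> ((!) [z, x, y]) = \<gamma> ((!) [x, y, z])" using 01[of x z y] 12[of x y z] by simp
  show "\<gamma> ((!) [z, y, x]) = - \<gamma> ((!) [x, y, z])" using 01[of y z x] 12[of y z x] 01[of x y z] by simp
qed

text \<open>Each of the seven monomials of \<open>phi0\<close> is met in 3! = 6 orders, and an odd
  reordering reverses the sign of both factors.\<close>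

lemma sum_phi0_ebasis:
  assumes \<gamma>: "alternating_form 3 \<gamma>"
  shows "(\<Sum>a<7. \<Sum>b<7. \<Sum>c<7. \<gamma> ((!) [ebasis a, ebasis b, ebasis c]) * phi0 ((!) [ebasis a, ebasis b, ebasis c]))
    = 6 * (\<gamma> ((!) [ebasis 0, ebasis 1, ebasis 2]) + \<gamma> ((!) [ebasis 0, ebasis 3, ebasis 4])
         + \<gamma> ((!) [ebasis 0, ebasis 5, ebasis 6]) + \<gamma> ((!) [ebasis 1, ebasis 3, ebasis 5])
         - \<gamma> ((!) [ebasis 1, ebasis 4, ebasis 6]) - \<gamma> ((!) [ebasis 2, ebasis 3, ebasis 6])
         - \<gamma> ((!) [ebasis 2, ebasis 4, ebasis 5]))"
proof -
  note alt = alternating_3_perm[OF \<gamma>]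
  note perms =
    alt[where x = "ebasis 0" and y = "ebasis (Suc 0)" and z = "ebasis 2"]
    alt[where x = "ebasis 0" and y = "ebasis 3" and z = "ebasis 4"]
    alt[where x = "ebasis 0" and y = "ebasis 5" and z = "ebasis 6"]
    alt[where x = "ebasis (Suc 0)" and y = "ebasis 3" and z = "ebasis 5"]
    alt[where x = "ebasis (Suc 0)" and y = "ebasis 4" and z = "ebasis 6"]
    alt[where x = "ebasis 2" and y = "ebasis 3" and z = "ebasis 6"]
    alt[where x = "ebasis 2" and y = "ebasis 4" and z = "ebasis 5"]
  show ?thesis
    by (simp add: sum_lessThan_7 phi0_nth ebasis_component perms)
qed

text \<open>The 35 ways to deal seven indices into an increasing triple and an increasing quadruple,
  each led by the sign of the resulting permutation.\<close>

definition shuffles_3_4 :: "(real \<times> nat \<times> nat \<times> nat \<times> nat \<times> nat \<times> nat \<times> nat) list" where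
  "shuffles_3_4 =
    [(1, 0, 1, 2, 3, 4, 5, 6), (-1, 0, 1, 3, 2, 4, 5, 6), (1, 0, 1, 4, 2, 3, 5, 6), (-1, 0, 1, 5, 2, 3, 4, 6), (1, 0, 1, 6, 2, 3, 4, 5),
     (1, 0, 2, 3, 1, 4, 5, 6), (-1, 0, 2, 4, 1, 3, 5, 6), (1, 0, 2, 5, 1, 3, 4, 6), (-1, 0, 2, 6, 1, 3, 4, 5), (1, 0, 3, 4, 1, 2, 5, 6),
     (-1, 0, 3, 5, 1, 2, 4, 6), (1, 0, 3, 6, 1, 2, 4, 5), (1, 0, 4, 5, 1, 2, 3, 6), (-1, 0, 4, 6, 1, 2, 3, 5), (1, 0, 5, 6, 1, 2, 3, 4),
     (-1, 1, 2, 3, 0, 4, 5, 6), (1, 1, 2, 4, 0, 3, 5, 6), (-1, 1, 2, 5, 0, 3, 4, 6), (1, 1, 2, 6, 0, 3, 4, 5), (-1, 1, 3, 4, 0, 2, 5, 6),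
     (1, 1, 3, 5, 0, 2, 4, 6), (-1, 1, 3, 6, 0, 2, 4, 5), (-1, 1, 4, 5, 0, 2, 3, 6), (1, 1, 4, 6, 0, 2, 3, 5), (-1, 1, 5, 6, 0, 2, 3, 4),
     (1, 2, 3, 4, 0, 1, 5, 6), (-1, 2, 3, 5, 0, 1, 4, 6), (1, 2, 3, 6, 0, 1, 4, 5), (1, 2, 4, 5, 0, 1, 3, 6), (-1, 2, 4, 6, 0, 1, 3, 5),
     (1, 2, 5, 6, 0, 1, 3, 4), (-1, 3, 4, 5, 0, 1, 2, 6), (1, 3, 4, 6, 0, 1, 2, 5), (-1, 3, 5, 6, 0, 1, 2, 4), (1, 4, 5, 6, 0, 1, 2, 3)]"

lemma wedge_3_4_e7:
  assumes \<beta>: "alternating_form 4 \<beta>" and \<gamma>: "alternating_form 3 \<gamma>"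
  shows "wedge 3 4 \<gamma> \<beta> ((!) e7) =
    (\<Sum>(s, i, j, k, a, b, c, d) \<leftarrow> shuffles_3_4. s * \<gamma> ((!) [ebasis i, ebasis j, ebasis k])
      * \<beta> ((!) [ebasis a, ebasis b, ebasis c, ebasis d]))"
proof -
  note b3 = alternating_interior_diff_1[OF \<beta>, simplified]
  note b2 = alternating_interior_diff_1[OF b3, simplified]
  note b1 = alternating_interior_diff_1[OF b2, simplified]
  note b0 = alternating_interior_diff_1[OF b1, simplified]
  note g2 = alternating_interior_diff_1[OF \<gamma>, simplified]
  note g1 = alternating_interior_diff_1[OF g2, simplified]
  note g0 = alternating_interior_diff_1[OF g1, simplified]
  have more: "\<gamma> ((!) (x # y # z # w # ws)) = \<gamma> ((!) [x, y, z])" for x y z w ws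
    by (rule alternating_nth_cong[OF \<gamma>]) simp_all
  have more': "\<beta> ((!) (x # y # z # w # v # vs)) = \<beta> ((!) [x, y, z, w])" for x y z w v vs
    by (rule alternating_nth_cong[OF \<beta>]) simp_all
  show ?thesis
    by (simp add: wedge_nth wedge_0_left wedge_0_right interior_nth
        \<beta> b3 b2 b1 b0 \<gamma> g2 g1 g0 more more' shuffles_3_4_def e7_def)
qed

text \<open>The defining equation of the Hodge star of \<open>phi0\<close>, tested on the standard
  basis. The factor 6 is 3!: the right-hand side runs over ordered triples, the expanded wedge
  product over increasing ones.\<close>

lemma wedge_psi0:
  assumes \<gamma>: "alternating_form 3 \<gamma>"
  shows "6 * wedge 3 4 \<gamma> psi0 ((!) e7) =
    (\<Sum>a<7. \<Sum>b<7. \<Sum>c<7. \<gamma> ((!) [ebasis a, ebasis b, ebasis c]) * phi0 ((!) [ebasis a, ebasis b, ebasis c]))"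
  unfolding sum_phi0_ebasis[OF \<gamma>] wedge_3_4_e7[OF alternating_psi0 \<gamma>] shuffles_3_4_def
  by (simp add: psi0_nth ebasis_component)

lemma dx3_ebasis:
  assumes "i < j" "j < k" "k < 7" "a < b" "b < c" "c < 7"
  shows "dx3 (sidx i) (sidx j) (sidx k) ((!) [ebasis a, ebasis b, ebasis c])
    = (if a = i \<and> b = j \<and> c = k then 1 else 0)"
  using assms unfolding dx3_nth by (simp add: ebasis_nth)

text \<open>Wedging with a basis 3-form isolates, up to sign, the component of \<beta> on the four
  complementary indices. This makes the Hodge star unique.\<close>

lemma wedge_3_4_nondegenerate:
  fixes \<beta> :: "(real^7) form"
  assumes \<beta>: "alternating_form 4 \<beta>"
    and eq0: "\<And>\<gamma>. alternating_form 3 \<gamma> \<Longrightarrow> wedge 3 4 \<gamma> \<beta> ((!) e7) = 0"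
  shows "\<beta> v = 0"
proof (rule alternating_zeroI[OF \<beta>])
  have "\<forall>(s, i, j, k, t) \<in> set shuffles_3_4.
      wedge 3 4 (dx3 (sidx i) (sidx j) (sidx k)) \<beta> ((!) e7) = 0"
    using eq0[OF alternating_dx3] by auto
  hence zero: "\<forall>(s, i, j, k, a, b, c, d) \<in> set shuffles_3_4.
      \<beta> ((!) [ebasis a, ebasis b, ebasis c, ebasis d]) = 0"
    unfolding wedge_3_4_e7[OF \<beta> alternating_dx3] shuffles_3_4_def
    by (simp add: dx3_ebasis)
  fix xs :: "nat list"
  assume xs: "length xs = 4" "sorted_wrt (<) xs" "set xs \<subseteq> {..<7}"
  then obtain a b c d where abcd: "xs = [a, b, c, d]"
    by (auto simp: length_Suc_conv numeral_eq_Suc)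
  hence "a < b" "b < c" "c < d" "d < 7" using xs by auto
  \<comment> \<open>Every increasing quadruple is the complement of a triple, hence occurs in the
    table.\<close>
  hence "(a, b, c, d) \<in> (\<lambda>(s, i, j, k, t). t) ` set shuffles_3_4"
    unfolding shuffles_3_4_def by simp presburger
  thus "\<beta> ((!) (map ebasis xs)) = 0"
    using zero unfolding abcd by auto
qed

section \<open>The Euclidean volume form and orthonormal frames\<close>

definition idx :: "7 \<Rightarrow> nat" where "idx = inv_into {..<7} sidx"

lemma idx_less: "idx i < 7" and sidx_idx [simp]: "sidx (idx i) = i"
proof -
  have i: "i \<in> sidx ` {..<7}" using bij_sidx by (simp add: bij_betw_def)
  show "idx i < 7" "sidx (idx i) = i"
    using inv_into_into[OF i] f_inv_into_f[OF i] by (simp_all add: idx_def)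
qed

lemma idx_sidx [simp]: "i < 7 \<Longrightarrow> idx (sidx i) = i"
  using sidx_eq[OF idx_less, of i "sidx i"] by simp

lemma idx_eq_iff: "j < 7 \<Longrightarrow> idx i = j \<longleftrightarrow> i = sidx j"
  using sidx_idx idx_sidx by metis

text \<open>As a determinant rather than an iterated wedge product, the volume form inherits row
  linearity and its values 1 or -1 on orthonormal frames from matrix algebra.\<close>

definition vol0 :: "(real^7) form" where "vol0 v = det (\<chi> i. v (idx i))"

lemma alternating_vol0: "alternating_form 7 vol0"
  unfolding alternating_form_def
proof (intro conjI allI impI)
  fix v w :: "nat \<Rightarrow> real^7"
  assume "\<forall>i<7. v i = w i"
  thus "vol0 v = vol0 w" by (simp add: vol0_def idx_less)
next
  fix v :: "nat \<Rightarrow> real^7" and j :: nat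
  assume j: "j < 7"
  have row: "vol0 (v(j := u)) = det (\<chi> i. if i = sidx j then u else v (idx i))" for u
  proof -
    have "(v(j := u)) (idx i) = (if i = sidx j then u else v (idx i))" for i
      using idx_eq_iff[OF j, of i] by simp
    thus ?thesis by (simp add: vol0_def)
  qed
  show "linear (\<lambda>u. vol0 (v(j := u)))"
  proof (rule linearI)
    show "vol0 (v(j := u + u')) = vol0 (v(j := u)) + vol0 (v(j := u'))" for u u'
      unfolding row by (rule det_row_add)
    show "vol0 (v(j := c *\<^sub>R u)) = c *\<^sub>R vol0 (v(j := u))" for c u
      unfolding row scalar_mult_eq_scaleR[symmetric] real_scaleR_def by (rule det_row_mul)
  qed
next
  fix v :: "nat \<Rightarrow> real^7" and i j
  assume ij: "i < 7" "j < 7" "i \<noteq> j" "v i = v j"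
  show "vol0 v = 0"
    unfolding vol0_def
  proof (rule det_identical_rows)
    show "sidx i \<noteq> sidx j" using ij sidx_eq by simp
    show "row (sidx i) (\<chi> i. v (idx i)) = row (sidx j) (\<chi> i. v (idx i))"
      using ij by (simp add: row_def)
  qed
qed

lemma e7_nth: "i < 7 \<Longrightarrow> e7 ! i = ebasis i"
  by (auto simp: e7_def less_Suc_eq numeral_eq_Suc)

lemma ebasis_idx: "ebasis (idx i) = axis i 1"
  by (simp add: ebasis_def)

lemma vol0_e7: "vol0 ((!) e7) = 1"
proof -
  have "(\<chi> i. e7 ! idx i) = (mat 1 :: real^7^7)"
    by (simp only: e7_nth[OF idx_less] ebasis_idx)
      (auto simp: vec_eq_iff mat_def axis_def)
  thus ?thesis by (simp add: vol0_def)
qed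

lemma inner_ebasis: "i < 7 \<Longrightarrow> j < 7 \<Longrightarrow> ebasis i \<bullet> ebasis j = (if i = j then 1 else 0)"
  by (simp add: ebasis_def inner_axis_axis sidx_eq)

lemma inner_ebasis_right: "v \<bullet> ebasis i = v $ sidx i"
  by (simp add: ebasis_def inner_axis)

lemma orthonormal_frame_matrix:
  fixes f :: "nat \<Rightarrow> real^7"
  assumes "\<And>i j. i < 7 \<Longrightarrow> j < 7 \<Longrightarrow> f i \<bullet> f j = (if i = j then 1 else 0)"
  shows "orthogonal_matrix (\<chi> i. f (idx i))"
proof -
  have r: "row i (\<chi> i. f (idx i)) = f (idx i)" for i by (simp add: row_def)
  have "idx i \<noteq> idx j" if "i \<noteq> j" for i j using that sidx_idx by metis
  thus ?thesis
    unfolding orthogonal_matrix_orthonormal_rows r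
    using assms idx_less by (simp add: norm_eq_1 orthogonal_def)
qed

lemma linear_ebasis_expand:
  fixes A :: "real^7 \<Rightarrow> real"
  assumes "linear A"
  shows "A v = (\<Sum>i<7. v $ sidx i * A (ebasis i))"
proof -
  have "A v = A (\<Sum>i\<in>UNIV. v $ i *\<^sub>R axis i 1)"
    using basis_expansion[of v] by (simp add: scalar_mult_eq_scaleR)
  also have "\<dots> = (\<Sum>i\<in>UNIV. v $ i * A (axis i 1))"
    by (simp add: linear_sum[OF assms] linear_scale[OF assms])
  finally show ?thesis by (simp add: sum_UNIV_7 ebasis_def)
qed

text \<open>The matrix of an orthonormal frame is orthogonal, so its columns are orthonormal as
  well; their inner products are the coefficients that appear when A and B are expanded.\<close>

lemma sum_orthonormal_frame:
  fixes f :: "nat \<Rightarrow> real^7"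
  assumes f: "\<And>i j. i < 7 \<Longrightarrow> j < 7 \<Longrightarrow> f i \<bullet> f j = (if i = j then 1 else 0)"
    and A: "linear A" and B: "linear B"
  shows "(\<Sum>a<7. A (f a) * B (f a)) = (\<Sum>a<7. A (ebasis a) * (B (ebasis a) :: real))"
proof -
  define M where "M = (\<chi> i. f (idx i))"
  have "transpose M ** M = mat 1"
    using orthonormal_frame_matrix[OF f] by (simp add: M_def orthogonal_matrix)
  hence "(transpose M ** M) $ p $ q = (if p = q then 1 else 0)" for p q by (simp add: mat_def)
  hence MM: "(\<Sum>a<7. f a $ p * f a $ q) = (if p = q then 1 else 0)" for p q
    by (simp add: matrix_matrix_mult_def transpose_def M_def sum_UNIV_7)
  have "(\<Sum>a<7. A (f a) * B (f a)) = (\<Sum>a<7. (\<Sum>i<7. f a $ sidx i * A (ebasis i)) * (\<Sum>j<7. f a $ sidx j * B (ebasis j)))"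
    by (simp only: linear_ebasis_expand[OF A, symmetric] linear_ebasis_expand[OF B, symmetric])
  also have "\<dots> = (\<Sum>a<7. \<Sum>i<7. \<Sum>j<7. (f a $ sidx i * f a $ sidx j) * (A (ebasis i) * B (ebasis j)))"
    unfolding sum_product by (intro sum.cong refl) (simp add: mult_ac)
  also have "\<dots> = (\<Sum>i<7. \<Sum>a<7. \<Sum>j<7. (f a $ sidx i * f a $ sidx j) * (A (ebasis i) * B (ebasis j)))"
    by (rule sum.swap)
  also have "\<dots> = (\<Sum>i<7. \<Sum>j<7. \<Sum>a<7. (f a $ sidx i * f a $ sidx j) * (A (ebasis i) * B (ebasis j)))"
    by (intro sum.cong refl sum.swap)
  also have "\<dots> = (\<Sum>i<7. \<Sum>j<7. if i = j then A (ebasis i) * B (ebasis j) else 0)"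
    unfolding sum_distrib_right[symmetric] MM by (intro sum.cong refl) (simp add: sidx_eq)
  also have "\<dots> = (\<Sum>a<7. A (ebasis a) * B (ebasis a))" by simp
  finally show ?thesis .
qed

lemma alternating_nth_linear:
  assumes "alternating_form k \<alpha>" "i < k" "i < length xs"
  shows "linear (\<lambda>u. \<alpha> ((!) (xs[i := u])))"
  using alternating_linear[OF assms(1,2), of "(!) xs"] assms(3) by (simp add: nth_list_update_fun)

lemma alternating_3_linear:
  assumes "alternating_form 3 \<alpha>"
  shows "linear (\<lambda>u. \<alpha> ((!) [u, y, z]))" "linear (\<lambda>u. \<alpha> ((!) [x, u, z]))" "linear (\<lambda>u. \<alpha> ((!) [x, y, u]))"
  using alternating_nth_linear[OF assms, of 0 "[0, y, z]"] alternating_nth_linear[OF assms, of 1 "[x, 0, z]"]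
    alternating_nth_linear[OF assms, of 2 "[x, y, 0]"] by simp_all

text \<open>One index is replaced at a time, brought innermost by \<open>sum.swap\<close> where
  necessary. This frees \<open>form_inner\<close> from the basis picked by
  \<open>SOME\<close>.\<close>

lemma sum_3_orthonormal_frame:
  fixes f :: "nat \<Rightarrow> real^7"
  assumes f: "\<And>i j. i < 7 \<Longrightarrow> j < 7 \<Longrightarrow> f i \<bullet> f j = (if i = j then 1 else 0)"
    and \<alpha>: "alternating_form 3 \<alpha>" and \<beta>: "alternating_form 3 \<beta>"
  shows "(\<Sum>a<7. \<Sum>b<7. \<Sum>c<7. \<alpha> ((!) [f a, f b, f c]) * \<beta> ((!) [f a, f b, f c])) =
    (\<Sum>a<7. \<Sum>b<7. \<Sum>c<7. \<alpha> ((!) [ebasis a, ebasis b, ebasis c]) * \<beta> ((!) [ebasis a, ebasis b, ebasis c]))"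
proof -
  note A = alternating_3_linear[OF \<alpha>] and B = alternating_3_linear[OF \<beta>]
  have "(\<Sum>a<7. \<Sum>b<7. \<Sum>c<7. \<alpha> ((!) [f a, f b, f c]) * \<beta> ((!) [f a, f b, f c])) =
    (\<Sum>a<7. \<Sum>b<7. \<Sum>c<7. \<alpha> ((!) [f a, f b, ebasis c]) * \<beta> ((!) [f a, f b, ebasis c]))"
    by (intro sum.cong refl sum_orthonormal_frame f A B)
  also have "\<dots> = (\<Sum>a<7. \<Sum>c<7. \<Sum>b<7. \<alpha> ((!) [f a, f b, ebasis c]) * \<beta> ((!) [f a, f b, ebasis c]))"
    by (intro sum.cong refl sum.swap)
  also have "\<dots> = (\<Sum>a<7. \<Sum>c<7. \<Sum>b<7. \<alpha> ((!) [f a, ebasis b, ebasis c]) * \<beta> ((!) [f a, ebasis b, ebasis c]))"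
    by (intro sum.cong refl sum_orthonormal_frame f A B)
  also have "\<dots> = (\<Sum>c<7. \<Sum>a<7. \<Sum>b<7. \<alpha> ((!) [f a, ebasis b, ebasis c]) * \<beta> ((!) [f a, ebasis b, ebasis c]))"
    by (rule sum.swap)
  also have "\<dots> = (\<Sum>c<7. \<Sum>b<7. \<Sum>a<7. \<alpha> ((!) [f a, ebasis b, ebasis c]) * \<beta> ((!) [f a, ebasis b, ebasis c]))"
    by (intro sum.cong refl sum.swap)
  also have "\<dots> = (\<Sum>c<7. \<Sum>b<7. \<Sum>a<7. \<alpha> ((!) [ebasis a, ebasis b, ebasis c]) * \<beta> ((!) [ebasis a, ebasis b, ebasis c]))"
    by (intro sum.cong refl sum_orthonormal_frame f A B)
  also have "\<dots> = (\<Sum>b<7. \<Sum>c<7. \<Sum>a<7. \<alpha> ((!) [ebasis a, ebasis b, ebasis c]) * \<beta> ((!) [ebasis a, ebasis b, ebasis c]))"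
    by (rule sum.swap)
  also have "\<dots> = (\<Sum>b<7. \<Sum>a<7. \<Sum>c<7. \<alpha> ((!) [ebasis a, ebasis b, ebasis c]) * \<beta> ((!) [ebasis a, ebasis b, ebasis c]))"
    by (intro sum.cong refl sum.swap)
  also have "\<dots> = (\<Sum>a<7. \<Sum>b<7. \<Sum>c<7. \<alpha> ((!) [ebasis a, ebasis b, ebasis c]) * \<beta> ((!) [ebasis a, ebasis b, ebasis c]))"
    by (rule sum.swap)
  finally show ?thesis .
qed

text \<open>By hypothesis F looks at three entries only, so extensional functions and
  \<open>(!) [a, b, c]\<close> may differ beyond them.\<close>

lemma sum_PiE_3:
  fixes F :: "(nat \<Rightarrow> nat) \<Rightarrow> real"
  assumes "\<And>I J. I 0 = J 0 \<Longrightarrow> I 1 = J 1 \<Longrightarrow> I 2 = J 2 \<Longrightarrow> F I = F J"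
  shows "(\<Sum>I \<in> {..<3} \<rightarrow>\<^sub>E {..<n}. F I) = (\<Sum>a<n. \<Sum>b<n. \<Sum>c<n. F ((!) [a, b, c]))"
proof -
  have "(\<Sum>I \<in> {..<3} \<rightarrow>\<^sub>E {..<n}. F I) = (\<Sum>(a, b, c) \<in> {..<n} \<times> {..<n} \<times> {..<n}. F ((!) [a, b, c]))"
  proof (rule sum.reindex_bij_witness[where j = "\<lambda>I. (I 0, I 1, I 2)"
        and i = "\<lambda>(a, b, c). restrict ((!) [a, b, c]) {..<3}"])
    fix I assume I: "I \<in> {..<3::nat} \<rightarrow>\<^sub>E {..<n}"
    show "(case (I 0, I 1, I 2) of (a, b, c) \<Rightarrow> restrict ((!) [a, b, c]) {..<3}) = I"
    proof
      fix i
      show "(case (I 0, I 1, I 2) of (a, b, c) \<Rightarrow> restrict ((!) [a, b, c]) {..<3}) i = I i"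
      proof (cases "i < 3")
        case True
        then consider "i = 0" | "i = 1" | "i = 2" by linarith
        thus ?thesis by cases simp_all
      qed (use I in \<open>auto simp: PiE_def extensional_def\<close>)
    qed
    show "(I 0, I 1, I 2) \<in> {..<n} \<times> {..<n} \<times> {..<n}" using I by (auto simp: PiE_def Pi_def)
    show "(case (I 0, I 1, I 2) of (a, b, c) \<Rightarrow> F ((!) [a, b, c])) = F I"
      using assms[of "(!) [I 0, I 1, I 2]" I] by simp
  next
    fix t assume t: "t \<in> {..<n} \<times> {..<n} \<times> {..<n}"
    thus "(\<lambda>I. (I 0, I 1, I 2)) (case t of (a, b, c) \<Rightarrow> restrict ((!) [a, b, c]) {..<3}) = t" by auto
    show "(case t of (a, b, c) \<Rightarrow> restrict ((!) [a, b, c]) {..<3}) \<in> {..<3} \<rightarrow>\<^sub>E {..<n}"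
    proof -
      obtain a b c where abc: "t = (a, b, c)" "a < n" "b < n" "c < n" using t by auto
      have "[a, b, c] ! i < n" if i: "i < 3" for i
      proof -
        consider "i = 0" | "i = 1" | "i = 2" using i by linarith
        thus ?thesis by cases (simp_all add: abc)
      qed
      thus ?thesis by (simp add: abc(1))
    qed
  qed
  thus ?thesis by (simp add: sum.cartesian_product)
qed

section \<open>The contraction identity relating phi0 and psi0\<close>

lemma phi0_ebasis:
  "phi0 ((!) [x, y, ebasis 0]) = (x $ 2 * y $ 3 - x $ 3 * y $ 2) + (x $ 4 * y $ 5 - x $ 5 * y $ 4) + (x $ 6 * y $ 7 - x $ 7 * y $ 6)"
  "phi0 ((!) [x, y, ebasis (Suc 0)]) = - (x $ 1 * y $ 3 - x $ 3 * y $ 1) + (x $ 4 * y $ 6 - x $ 6 * y $ 4) - (x $ 5 * y $ 7 - x $ 7 * y $ 5)"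
  "phi0 ((!) [x, y, ebasis 2]) = (x $ 1 * y $ 2 - x $ 2 * y $ 1) - (x $ 4 * y $ 7 - x $ 7 * y $ 4) - (x $ 5 * y $ 6 - x $ 6 * y $ 5)"
  "phi0 ((!) [x, y, ebasis 3]) = - (x $ 1 * y $ 5 - x $ 5 * y $ 1) - (x $ 2 * y $ 6 - x $ 6 * y $ 2) + (x $ 3 * y $ 7 - x $ 7 * y $ 3)"
  "phi0 ((!) [x, y, ebasis 4]) = (x $ 1 * y $ 4 - x $ 4 * y $ 1) + (x $ 2 * y $ 7 - x $ 7 * y $ 2) + (x $ 3 * y $ 6 - x $ 6 * y $ 3)"
  "phi0 ((!) [x, y, ebasis 5]) = - (x $ 1 * y $ 7 - x $ 7 * y $ 1) + (x $ 2 * y $ 4 - x $ 4 * y $ 2) - (x $ 3 * y $ 5 - x $ 5 * y $ 3)"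
  "phi0 ((!) [x, y, ebasis 6]) = (x $ 1 * y $ 6 - x $ 6 * y $ 1) - (x $ 2 * y $ 5 - x $ 5 * y $ 2) - (x $ 3 * y $ 4 - x $ 4 * y $ 3)"
  by (simp_all add: phi0_nth ebasis_component algebra_simps)

lemma psi0_ebasis:
  "psi0 ((!) [x, y, z, ebasis 0]) = dx3 2 4 7 ((!) [x, y, z]) + dx3 2 5 6 ((!) [x, y, z]) + dx3 3 4 6 ((!) [x, y, z]) - dx3 3 5 7 ((!) [x, y, z])"
  "psi0 ((!) [x, y, z, ebasis (Suc 0)]) = - dx3 1 4 7 ((!) [x, y, z]) - dx3 1 5 6 ((!) [x, y, z]) - dx3 3 4 5 ((!) [x, y, z]) - dx3 3 6 7 ((!) [x, y, z])"
  "psi0 ((!) [x, y, z, ebasis 2]) = - dx3 1 4 6 ((!) [x, y, z]) + dx3 1 5 7 ((!) [x, y, z]) + dx3 2 4 5 ((!) [x, y, z]) + dx3 2 6 7 ((!) [x, y, z])"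
  "psi0 ((!) [x, y, z, ebasis 3]) = dx3 1 2 7 ((!) [x, y, z]) + dx3 1 3 6 ((!) [x, y, z]) - dx3 2 3 5 ((!) [x, y, z]) - dx3 5 6 7 ((!) [x, y, z])"
  "psi0 ((!) [x, y, z, ebasis 4]) = dx3 1 2 6 ((!) [x, y, z]) - dx3 1 3 7 ((!) [x, y, z]) + dx3 2 3 4 ((!) [x, y, z]) + dx3 4 6 7 ((!) [x, y, z])"
  "psi0 ((!) [x, y, z, ebasis 5]) = - dx3 1 2 5 ((!) [x, y, z]) - dx3 1 3 4 ((!) [x, y, z]) - dx3 2 3 7 ((!) [x, y, z]) - dx3 4 5 7 ((!) [x, y, z])"
  "psi0 ((!) [x, y, z, ebasis 6]) = - dx3 1 2 4 ((!) [x, y, z]) + dx3 1 3 5 ((!) [x, y, z]) + dx3 2 3 6 ((!) [x, y, z]) + dx3 4 5 6 ((!) [x, y, z])"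
  by (simp_all add: psi0_nth dx3_nth ebasis_component algebra_simps)

text \<open>For each of the 49 index pairs this is a polynomial identity in the coordinates of x and
  y. The preceding tables supply the components; those of \<open>phi0\<close> are the coordinates of
  the cross product of x and y.\<close>

lemma psi0_ebasis_identity:
  assumes "a < 7" "b < 7"
  shows "psi0 ((!) [x, y, ebasis a, ebasis b]) =
    (\<Sum>c<7. phi0 ((!) [ebasis a, ebasis b, ebasis c]) * phi0 ((!) [x, y, ebasis c]))
      - (x \<bullet> ebasis a) * (y \<bullet> ebasis b) + (x \<bullet> ebasis b) * (y \<bullet> ebasis a)"
proof -
  have "\<forall>a\<in>{0, 1, 2, 3, 4, 5, 6::nat}. \<forall>b\<in>{0, 1, 2, 3, 4, 5, 6::nat}.
    psi0 ((!) [x, y, ebasis a, ebasis b]) =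
    (\<Sum>c<7. phi0 ((!) [ebasis a, ebasis b, ebasis c]) * phi0 ((!) [x, y, ebasis c]))
      - (x \<bullet> ebasis a) * (y \<bullet> ebasis b) + (x \<bullet> ebasis b) * (y \<bullet> ebasis a)"
    unfolding inner_ebasis_right sum_lessThan_7
    by (simp add: phi0_ebasis psi0_ebasis dx3_nth ebasis_component sidx_numeral)
  moreover have "a \<in> {0, 1, 2, 3, 4, 5, 6}" "b \<in> {0, 1, 2, 3, 4, 5, 6}"
    using assms by (simp; linarith)+
  ultimately show ?thesis by blast
qed

text \<open>Both sides are bilinear in z and w, so basis pairs suffice. The vector u is the cross
  product of z and w: its coordinates are the numbers \<open>phi0 ((!) [z, w, ebasis c])\<close>,
  which turns the contracted sum into one value of \<open>phi0\<close>.\<close>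

lemma psi0_identity:
  assumes u: "\<And>v. u \<bullet> v = phi0 ((!) [z, w, v])"
  shows "psi0 ((!) [x, y, z, w]) = phi0 ((!) [x, y, u]) - (x \<bullet> z) * (y \<bullet> w) + (x \<bullet> w) * (y \<bullet> z)"
proof -
  define f where "f z w = psi0 ((!) [x, y, z, w])" for z w
  define g where "g z w = (\<Sum>c<7. phi0 ((!) [z, w, ebasis c]) * phi0 ((!) [x, y, ebasis c]))
      - (x \<bullet> z) * (y \<bullet> w) + (x \<bullet> w) * (y \<bullet> z)" for z w
  note lin = alternating_3_linear[OF alternating_phi0]
  have "bilinear f"
    unfolding bilinear_def f_def
    using alternating_nth_linear[OF alternating_psi0, of 2 "[x, y, 0, w]" for w]
      alternating_nth_linear[OF alternating_psi0, of 3 "[x, y, z, 0]" for z] by simp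
  moreover have "bilinear g"
    unfolding bilinear_def g_def
    by (intro conjI allI linearI)
      (simp_all add: linear_add[OF lin(1)] linear_add[OF lin(2)] linear_scale[OF lin(1)]
        linear_scale[OF lin(2)] algebra_simps inner_add sum.distrib sum_distrib_left sum_subtractf)
  ultimately have "f = g"
    by (rule bilinear_eq_stdbasis) (auto simp: Basis_7 f_def g_def psi0_ebasis_identity)
  hence "f z w = g z w" by simp
  also have "(\<Sum>c<7. phi0 ((!) [z, w, ebasis c]) * phi0 ((!) [x, y, ebasis c])) = phi0 ((!) [x, y, u])"
    unfolding linear_ebasis_expand[OF lin(3)[of x y], of u] u[symmetric] inner_ebasis_right ..
  hence "g z w = phi0 ((!) [x, y, u]) - (x \<bullet> z) * (y \<bullet> w) + (x \<bullet> w) * (y \<bullet> z)"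
    by (simp add: g_def)
  finally show ?thesis by (simp add: f_def)
qed

section \<open>Metric, volume and Hodge star of a \<open>G\<^sub>2\<close>-form\<close>

lemma alternating_scale_arguments:
  assumes "alternating_form k \<alpha>"
  shows "\<alpha> (\<lambda>i. c *\<^sub>R v i) = c ^ k * \<alpha> v"
proof -
  have "\<alpha> (\<lambda>i. if i < m then c *\<^sub>R v i else v i) = c ^ m * \<alpha> v" if "m \<le> k" for m
    using that
  proof (induction m)
    case (Suc m)
    let ?v = "\<lambda>i. if i < m then c *\<^sub>R v i else v i"
    have "(\<lambda>i. if i < Suc m then c *\<^sub>R v i else v i) = ?v(m := c *\<^sub>R v m)" by auto
    hence "\<alpha> (\<lambda>i. if i < Suc m then c *\<^sub>R v i else v i) = c * \<alpha> (?v(m := v m))"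
      using linear_scale[OF alternating_linear[OF assms, of m ?v]] Suc.prems by simp
    also have "?v(m := v m) = ?v" by auto
    finally show ?case using Suc by simp
  qed simp
  from this[of k] have "c ^ k * \<alpha> v = \<alpha> (\<lambda>i. if i < k then c *\<^sub>R v i else v i)" by simp
  also have "\<dots> = \<alpha> (\<lambda>i. c *\<^sub>R v i)" by (rule alternating_cong[OF assms]) simp
  finally show ?thesis by simp
qed

lemma wedge_phi0:
  "wedge 4 3 (wedge 2 2 (interior_product x phi0) (interior_product y phi0)) phi0
     = (\<lambda>v. 6 * (x \<bullet> y) * vol0 v)"
proof (rule alternating_top_eqI)
  note p2 = alternating_interior_diff_1[OF alternating_phi0, simplified]
  show "alternating_form 7 (wedge 4 3 (wedge 2 2 (interior_product x phi0) (interior_product y phi0)) phi0)"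
    using alternating_wedge[OF alternating_wedge[OF p2 p2] alternating_phi0] by simp
qed (use phi0_bilinear_form vol0_e7 in \<open>auto intro: alternating_scale alternating_vol0\<close>)

lemma wedge_pullback_phi0:
  "wedge 4 3 (wedge 2 2 (interior_product x (pullback L phi0)) (interior_product y (pullback L phi0)))
      (pullback L phi0) = (\<lambda>v. 6 * (L x \<bullet> L y) * pullback L vol0 v)"
  unfolding interior_pullback pullback_wedge wedge_phi0 by (simp add: pullback_def)

lemma vol0_orthonormal:
  assumes "\<And>i j. i < 7 \<Longrightarrow> j < 7 \<Longrightarrow> f i \<bullet> f j = (if i = j then 1 else 0)"
  shows "\<bar>vol0 f\<bar> = 1"
  using det_orthogonal_matrix[OF orthonormal_frame_matrix[OF assms]] by (auto simp: vol0_def)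

locale linear_bijection =
  fixes L :: "real^7 \<Rightarrow> real^7"
  assumes lin: "linear L" and bij: "bij L"
begin

lemma L_inv [simp]: "L (inv L x) = x" and inv_L [simp]: "inv L (L x) = x"
  using bij by (simp_all add: bij_is_surj surj_f_inv_f bij_is_inj)

lemma linear_inv: "linear (inv L)"
proof (rule linearI)
  show "inv L (x + y) = inv L x + inv L y" for x y
    using linear_add[OF lin, of "inv L x" "inv L y"] by (metis L_inv inv_L)
  show "inv L (c *\<^sub>R x) = c *\<^sub>R inv L x" for c x
    using linear_scale[OF lin, of c "inv L x"] by (metis L_inv inv_L)
qed

lemma pullback_inv [simp]: "pullback L (pullback (inv L) \<alpha>) = \<alpha>" "pullback (inv L) (pullback L \<alpha>) = \<alpha>"
  by (simp_all add: pullback_def)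

lemma g2_metric_volume_pullback:
  "g2_metric_volume (pullback L phi0) (\<lambda>x y. L x \<bullet> L y) (pullback L vol0)"
  unfolding g2_metric_volume_def
proof (intro conjI allI)
  have "L x \<noteq> 0" if "x \<noteq> 0" for x
    using that linear_0[OF linear_inv] inv_L by metis
  thus "inner_product (\<lambda>x y. L x \<bullet> L y)"
    unfolding inner_product_def bilinear_def
    by (intro conjI allI impI linearI)
      (simp_all add: linear_add[OF lin] linear_scale[OF lin] inner_add_left inner_add_right inner_commute)
  show "volume_form (\<lambda>x y. L x \<bullet> L y) (pullback L vol0)"
    unfolding volume_form_def orthonormal_basis_def
    using alternating_pullback[OF alternating_vol0 lin] vol0_orthonormal[of "\<lambda>i. L (e i)" for e]
    by (simp add: pullback_def)
qed (rule wedge_pullback_phi0)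

text \<open>
  A solution differs from the standard one by a factor \<open>c\<close> on the metric and \<open>1 / c\<close> on the volume form;
  on an orthonormal basis the normalisation of the volume form gives \<open>c\<close> to the power \<open>9 / 2\<close> equal to \<open>1\<close>.
\<close>

lemma g2_metric_volume_unique:
  assumes "g2_metric_volume (pullback L phi0) g \<mu>"
  shows "g = (\<lambda>x y. L x \<bullet> L y)" "\<mu> = pullback L vol0"
proof -
  have g: "bilinear g" "\<And>x. x \<noteq> 0 \<Longrightarrow> g x x > 0"
    and \<mu>: "alternating_form 7 \<mu>" "\<And>e. orthonormal_basis g e \<Longrightarrow> \<bar>\<mu> e\<bar> = 1"
    and eq: "\<And>x y v. g x y * \<mu> v = (L x \<bullet> L y) * vol0 (\<lambda>i. L (v i))"
    using assms unfolding g2_metric_volume_def inner_product_def volume_form_def wedge_pullback_phi0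
    by (simp_all add: fun_eq_iff pullback_def)
  \<comment> \<open>The basis that L carries to the standard one. The standard metric and volume
    form are normalised on it, so \<mu> differs from its model by the factor m and g by 1 /
    m.\<close>
  define e where "e i = inv L (e7 ! i)" for i
  have Le: "L (e i) = e7 ! i" for i by (simp add: e_def)
  define m where "m = \<mu> e"
  have em: "g (e i) (e j) * m = (if i = j then 1 else 0)" if "i < 7" "j < 7" for i j
    using eq[of "e i" "e j" e] that by (simp add: Le m_def vol0_e7 e7_nth inner_ebasis)
  have m0: "m \<noteq> 0" using em[of 0 0] by auto
  have "e 0 \<noteq> 0"
    using em[of 0 0] bilinear_lzero[OF g(1)] by auto
  \<comment> \<open>Positive definiteness of g excludes m < 0, that is the opposite
    orientation.\<close>
  from g(2)[OF this] have mpos: "0 < m"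
    using em[of 0 0] zero_less_mult_pos[of "g (e 0) (e 0)" m] by simp
  \<comment> \<open>Since \<open>g (e i) (e i)\<close> is 1 / m, rescaling by \<open>sqrt m\<close>
    gives unit vectors, and the 7-form picks up the seventh power of that scale.\<close>
  have "orthonormal_basis g (\<lambda>i. sqrt m *\<^sub>R e i)"
    unfolding orthonormal_basis_def
  proof (intro allI impI)
    fix i j assume "i < DIM(real^7)" "j < DIM(real^7)"
    hence ij: "i < 7" "j < 7" by simp_all
    have "g (sqrt m *\<^sub>R e i) (sqrt m *\<^sub>R e j) = g (e i) (e j) * (sqrt m * sqrt m)"
      by (simp add: bilinear_lmul[OF g(1)] bilinear_rmul[OF g(1)])
    also have "\<dots> = (if i = j then 1 else 0)" using em[OF ij] mpos by simp
    finally show "g (sqrt m *\<^sub>R e i) (sqrt m *\<^sub>R e j) = (if i = j then 1 else 0)" .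
  qed
  from \<mu>(2)[OF this] have "\<bar>sqrt m ^ 7 * m\<bar> = 1"
    by (simp add: alternating_scale_arguments[OF \<mu>(1)] m_def)
  moreover have "sqrt m ^ 7 * m = sqrt m ^ 9"
  proof -
    have "m = sqrt m ^ 2" using mpos by simp
    hence "sqrt m ^ 7 * m = sqrt m ^ 7 * sqrt m ^ 2" by metis
    thus ?thesis by (simp add: power_add[symmetric])
  qed
  ultimately have "sqrt m ^ 9 = 1" using mpos by simp
  hence "sqrt m = 1" using mpos power_eq_imp_eq_base[of "sqrt m" 9 1] by simp
  hence m1: "m = 1" by simp
  have geq: "g x y = L x \<bullet> L y" for x y
    using eq[of x y e] m1 by (simp add: Le m_def vol0_e7)
  thus "g = (\<lambda>x y. L x \<bullet> L y)" by (simp add: fun_eq_iff)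
  have "g (e 0) (e 0) = 1" using em[of 0 0] m1 by simp
  hence "\<mu> v = vol0 (\<lambda>i. L (v i))" for v
    using eq[of "e 0" "e 0" v] geq[of "e 0" "e 0"] by simp
  thus "\<mu> = pullback L vol0" by (simp add: fun_eq_iff pullback_def)
qed

lemma g2_metric_pullback: "g2_metric (pullback L phi0) = (\<lambda>x y. L x \<bullet> L y)"
  unfolding g2_metric_def using g2_metric_volume_pullback g2_metric_volume_unique by blast

lemma g2_volume_pullback: "g2_volume (pullback L phi0) = pullback L vol0"
  unfolding g2_volume_def using g2_metric_volume_pullback g2_metric_volume_unique by blast

lemma form_inner_pullback:
  assumes \<alpha>: "alternating_form 3 \<alpha>" and \<beta>: "alternating_form 3 \<beta>"
  shows "form_inner (\<lambda>x y. L x \<bullet> L y) 3 (pullback L \<alpha>) (pullback L \<beta>) =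
    (\<Sum>a<7. \<Sum>b<7. \<Sum>c<7. \<alpha> ((!) [ebasis a, ebasis b, ebasis c]) * \<beta> ((!) [ebasis a, ebasis b, ebasis c])) / 6"
proof -
  define e where "e = (SOME e. orthonormal_basis (\<lambda>x y. L x \<bullet> L y) e)"
  \<comment> \<open>Witness that an orthonormal basis exists, so that the \<open>SOME\<close> in
    \<open>form_inner\<close> yields one.\<close>
  have "orthonormal_basis (\<lambda>x y. L x \<bullet> L y) (\<lambda>i. inv L (ebasis i))"
    by (simp add: orthonormal_basis_def inner_ebasis)
  hence "orthonormal_basis (\<lambda>x y. L x \<bullet> L y) e"
    unfolding e_def by (rule someI[where P = "orthonormal_basis (\<lambda>x y. L x \<bullet> L y)"])
  hence e: "L (e i) \<bullet> L (e j) = (if i = j then 1 else 0)" if "i < 7" "j < 7" for i j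
    using that by (simp add: orthonormal_basis_def)
  have cong: "\<gamma> (\<lambda>i. L (e (I i))) = \<gamma> (\<lambda>i. L (e (J i)))"
    if "alternating_form 3 \<gamma>" "I 0 = J 0" "I 1 = J 1" "I 2 = J 2" for \<gamma> and I J :: "nat \<Rightarrow> nat"
    by (rule alternating_cong[OF that(1)]) (use that(2-) in \<open>auto simp: less_Suc_eq numeral_eq_Suc\<close>)
  have nth: "\<gamma> (\<lambda>i. L (e ([a, b, c] ! i))) = \<gamma> ((!) [L (e a), L (e b), L (e c)])"
    if "alternating_form 3 \<gamma>" for \<gamma> a b c
    by (rule alternating_cong[OF that]) (auto simp: less_Suc_eq numeral_eq_Suc)
  have "form_inner (\<lambda>x y. L x \<bullet> L y) 3 (pullback L \<alpha>) (pullback L \<beta>) =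
     (\<Sum>I \<in> {..<3} \<rightarrow>\<^sub>E {..<7}. \<alpha> (\<lambda>i. L (e (I i))) * \<beta> (\<lambda>i. L (e (I i)))) / 6"
    unfolding form_inner_def e_def[symmetric] Let_def by (simp add: pullback_def fact_numeral)
  also have "(\<Sum>I \<in> {..<3} \<rightarrow>\<^sub>E {..<7}. \<alpha> (\<lambda>i. L (e (I i))) * \<beta> (\<lambda>i. L (e (I i)))) =
     (\<Sum>a<7. \<Sum>b<7. \<Sum>c<7. \<alpha> ((!) [L (e a), L (e b), L (e c)]) * \<beta> ((!) [L (e a), L (e b), L (e c)]))"
  proof -
    define F where "F I = \<alpha> (\<lambda>i. L (e (I i))) * \<beta> (\<lambda>i. L (e (I i)))" for I :: "nat \<Rightarrow> nat"
    have "F I = F J" if "I 0 = J 0" "I 1 = J 1" "I 2 = J 2" for I J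
      unfolding F_def using cong[OF \<alpha> that] cong[OF \<beta> that] by simp
    from sum_PiE_3[of F 7, OF this] show ?thesis unfolding F_def nth[OF \<alpha>] nth[OF \<beta>] .
  qed
  also have "\<dots> = (\<Sum>a<7. \<Sum>b<7. \<Sum>c<7. \<alpha> ((!) [ebasis a, ebasis b, ebasis c]) * \<beta> ((!) [ebasis a, ebasis b, ebasis c]))"
    by (rule sum_3_orthonormal_frame[OF _ \<alpha> \<beta>]) (rule e)
  finally show ?thesis .
qed

text \<open>Wedge product and inner product are natural under pullback. Carried to the model by
  \<open>inv L\<close>, this is an equation between 7-forms, which the single component in
  \<open>wedge_psi0\<close> decides.\<close>

lemma wedge_pullback_psi0:
  assumes \<gamma>: "alternating_form 3 \<gamma>"
  shows "wedge 3 4 \<gamma> (pullback L psi0) =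
    (\<lambda>v. form_inner (\<lambda>x y. L x \<bullet> L y) 3 \<gamma> (pullback L phi0) * pullback L vol0 v)"
proof -
  define \<gamma>' where "\<gamma>' = pullback (inv L) \<gamma>"
  have \<gamma>': "alternating_form 3 \<gamma>'"
    unfolding \<gamma>'_def by (rule alternating_pullback[OF \<gamma> linear_inv])
  define c where "c = form_inner (\<lambda>x y. L x \<bullet> L y) 3 \<gamma> (pullback L phi0)"
  have "c = form_inner (\<lambda>x y. L x \<bullet> L y) 3 (pullback L \<gamma>') (pullback L phi0)"
    by (simp add: c_def \<gamma>'_def)
  also have "\<dots> = wedge 3 4 \<gamma>' psi0 ((!) e7)"
    using wedge_psi0[OF \<gamma>'] unfolding form_inner_pullback[OF \<gamma>' alternating_phi0] by simp
  finally have c: "wedge 3 4 \<gamma>' psi0 ((!) e7) = c" by simp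
  have "wedge 3 4 \<gamma>' psi0 = (\<lambda>v. c * vol0 v)"
    using alternating_wedge[OF \<gamma>' alternating_psi0]
    by (intro alternating_top_eqI alternating_scale alternating_vol0) (simp_all add: c vol0_e7)
  hence "wedge 3 4 (pullback L \<gamma>') (pullback L psi0) = (\<lambda>v. c * pullback L vol0 v)"
    unfolding pullback_wedge by (simp add: pullback_def)
  thus ?thesis by (simp add: c_def \<gamma>'_def)
qed

text \<open>Existence is \<open>wedge_pullback_psi0\<close>. For uniqueness, the difference of two
  candidates, carried to the model, has zero wedge product with every 3-form.\<close>

lemma hodge_star_pullback:
  "hodge_star (\<lambda>x y. L x \<bullet> L y) (pullback L vol0) 3 (pullback L phi0) = pullback L psi0"
  unfolding hodge_star_def
proof (rule the_equality)
  show "alternating_form (DIM(real^7) - 3) (pullback L psi0) \<and>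
      (\<forall>\<gamma>. alternating_form 3 \<gamma> \<longrightarrow> wedge 3 (DIM(real^7) - 3) \<gamma> (pullback L psi0) =
        (\<lambda>v. form_inner (\<lambda>x y. L x \<bullet> L y) 3 \<gamma> (pullback L phi0) * pullback L vol0 v))"
    using alternating_pullback[OF alternating_psi0 lin] wedge_pullback_psi0 by simp
next
  fix \<beta>
  assume "alternating_form (DIM(real^7) - 3) \<beta> \<and>
      (\<forall>\<gamma>. alternating_form 3 \<gamma> \<longrightarrow> wedge 3 (DIM(real^7) - 3) \<gamma> \<beta> =
        (\<lambda>v. form_inner (\<lambda>x y. L x \<bullet> L y) 3 \<gamma> (pullback L phi0) * pullback L vol0 v))"
  hence \<beta>: "alternating_form 4 \<beta>" and eq: "\<And>\<gamma>. alternating_form 3 \<gamma> \<Longrightarrow> wedge 3 4 \<gamma> \<beta> =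
        (\<lambda>v. form_inner (\<lambda>x y. L x \<bullet> L y) 3 \<gamma> (pullback L phi0) * pullback L vol0 v)"
    by simp_all
  define \<delta> where "\<delta> = (\<lambda>v. pullback (inv L) \<beta> v - psi0 v)"
  have \<beta>': "alternating_form 4 (pullback (inv L) \<beta>)"
    by (rule alternating_pullback[OF \<beta> linear_inv])
  have "\<delta> v = 0" for v
  proof (rule wedge_3_4_nondegenerate)
    show "alternating_form 4 \<delta>"
      unfolding \<delta>_def by (rule alternating_diff[OF \<beta>' alternating_psi0])
    fix \<gamma> :: "(real^7) form"
    assume \<gamma>: "alternating_form 3 \<gamma>"
    have "wedge 3 4 (pullback L \<gamma>) \<beta> = wedge 3 4 (pullback L \<gamma>) (pullback L psi0)"
      using alternating_pullback[OF \<gamma> lin] by (simp add: eq wedge_pullback_psi0)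
    hence "pullback (inv L) (wedge 3 4 (pullback L \<gamma>) \<beta>) =
        pullback (inv L) (wedge 3 4 (pullback L \<gamma>) (pullback L psi0))" by simp
    hence "wedge 3 4 \<gamma> (pullback (inv L) \<beta>) = wedge 3 4 \<gamma> psi0"
      by (simp add: pullback_wedge[symmetric])
    moreover have "wedge 3 4 \<gamma> \<delta> v = wedge 3 4 \<gamma> (pullback (inv L) \<beta>) v - wedge 3 4 \<gamma> psi0 v" for v
      by (simp add: wedge_def \<delta>_def right_diff_distrib sum_subtractf diff_divide_distrib)
    ultimately show "wedge 3 4 \<gamma> \<delta> ((!) e7) = 0" by simp
  qed
  hence "pullback (inv L) \<beta> = psi0" by (auto simp: \<delta>_def)
  thus "\<beta> = pullback L psi0" using pullback_inv(1) by metis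
qed

lemma g2_star_pullback:
  "hodge_star (g2_metric (pullback L phi0)) (g2_volume (pullback L phi0)) 3 (pullback L phi0)
     = pullback L psi0"
  by (simp add: g2_metric_pullback g2_volume_pullback hodge_star_pullback)

text \<open>Otherwise the pulled back volume form would vanish on the standard basis, hence
  everywhere, although it is 1 on the preimage of that basis.\<close>

lemma det_pullback_nonzero: "vol0 (\<lambda>i. L (e7 ! i)) \<noteq> 0"
proof
  assume *: "vol0 (\<lambda>i. L (e7 ! i)) = 0"
  have "pullback L vol0 = (\<lambda>v. 0)"
    by (rule alternating_top_eqI[OF alternating_pullback[OF alternating_vol0 lin]])
      (use alternating_scale[OF alternating_vol0, of 0] * in \<open>simp_all add: pullback_def\<close>)
  from fun_cong[OF this, of "\<lambda>i. inv L (e7 ! i)"] show False by (simp add: pullback_def vol0_e7)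
qed

end

section \<open>Smooth functions\<close>

lemma Ck_on_SucI:
  assumes "\<And>x. x \<in> S \<Longrightarrow> (f has_derivative f' x) (at x)" "\<And>v. Ck_on k S (\<lambda>x. f' x v)"
  shows "Ck_on (Suc k) S f"
  using assms by auto

lemma Ck_on_SucE:
  assumes "Ck_on (Suc k) S f"
  obtains f' where "\<And>x. x \<in> S \<Longrightarrow> (f has_derivative f' x) (at x)" "\<And>v. Ck_on k S (\<lambda>x. f' x v)"
  using assms by auto

lemma Ck_on_SucD: "Ck_on (Suc k) S f \<Longrightarrow> Ck_on k S f"
proof (induction k arbitrary: f)
  case 0
  then obtain f' where "\<And>x. x \<in> S \<Longrightarrow> (f has_derivative f' x) (at x)"
    by (elim Ck_on_SucE) blast
  hence "continuous_on S f"
    by (auto intro!: continuous_at_imp_continuous_on has_derivative_continuous)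
  thus ?case by simp
next
  case (Suc k)
  from Suc.prems obtain f' where f': "\<And>x. x \<in> S \<Longrightarrow> (f has_derivative f' x) (at x)"
    "\<And>v. Ck_on (Suc k) S (\<lambda>x. f' x v)" by (rule Ck_on_SucE) blast
  show ?case by (rule Ck_on_SucI[OF f'(1)]) (use Suc.IH f'(2) in auto)
qed

lemma Ck_on_cong:
  assumes "open S" "\<And>x. x \<in> S \<Longrightarrow> f x = g x" "Ck_on k S f"
  shows "Ck_on k S g"
proof (cases k)
  case 0
  thus ?thesis using assms by (simp cong: continuous_on_cong)
next
  case (Suc m)
  from assms(3)[unfolded Suc] obtain f' where f': "\<And>x. x \<in> S \<Longrightarrow> (f has_derivative f' x) (at x)"
    "\<And>v. Ck_on m S (\<lambda>x. f' x v)" by (rule Ck_on_SucE) blast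
  have "(g has_derivative f' x) (at x)" if "x \<in> S" for x
    by (rule has_derivative_transform_within_open[OF f'(1)[OF that] assms(1) that]) (rule assms(2))
  thus ?thesis unfolding Suc by (rule Ck_on_SucI[OF _ f'(2)])
qed

lemma Ck_on_const: "Ck_on k S (\<lambda>x. c)"
proof (induction k arbitrary: c)
  case (Suc k)
  show ?case by (rule Ck_on_SucI[where f' = "\<lambda>x v. 0"]) (auto intro: Suc)
qed simp

lemma Ck_on_add: "Ck_on k S f \<Longrightarrow> Ck_on k S g \<Longrightarrow> Ck_on k S (\<lambda>x. f x + g x)"
proof (induction k arbitrary: f g)
  case 0
  thus ?case by (simp add: continuous_on_add)
next
  case (Suc k)
  from Suc.prems(1) obtain f' where f': "\<And>x. x \<in> S \<Longrightarrow> (f has_derivative f' x) (at x)"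
    "\<And>v. Ck_on k S (\<lambda>x. f' x v)" by (rule Ck_on_SucE) blast
  from Suc.prems(2) obtain g' where g': "\<And>x. x \<in> S \<Longrightarrow> (g has_derivative g' x) (at x)"
    "\<And>v. Ck_on k S (\<lambda>x. g' x v)" by (rule Ck_on_SucE) blast
  show ?case
    by (rule Ck_on_SucI[where f' = "\<lambda>x v. f' x v + g' x v"])
      (auto intro!: has_derivative_add f' g' Suc.IH)
qed

lemma Ck_on_bounded_linear:
  assumes "bounded_linear h"
  shows "Ck_on k S f \<Longrightarrow> Ck_on k S (\<lambda>x. h (f x))"
proof (induction k arbitrary: f)
  case 0
  thus ?case using assms by (simp add: bounded_linear.continuous_on)
next
  case (Suc k)
  from Suc.prems obtain f' where f': "\<And>x. x \<in> S \<Longrightarrow> (f has_derivative f' x) (at x)"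
    "\<And>v. Ck_on k S (\<lambda>x. f' x v)" by (rule Ck_on_SucE) blast
  show ?case
    by (rule Ck_on_SucI[where f' = "\<lambda>x v. h (f' x v)"])
      (auto intro!: bounded_linear.has_derivative[OF assms] f' Suc.IH)
qed

lemma Ck_on_mult:
  fixes f g :: "_ \<Rightarrow> real"
  shows "Ck_on k S f \<Longrightarrow> Ck_on k S g \<Longrightarrow> Ck_on k S (\<lambda>x. f x * g x)"
proof (induction k arbitrary: f g)
  case 0
  thus ?case by (simp add: continuous_on_mult)
next
  case (Suc k)
  from Suc.prems(1) obtain f' where f': "\<And>x. x \<in> S \<Longrightarrow> (f has_derivative f' x) (at x)"
    "\<And>v. Ck_on k S (\<lambda>x. f' x v)" by (rule Ck_on_SucE) blast
  from Suc.prems(2) obtain g' where g': "\<And>x. x \<in> S \<Longrightarrow> (g has_derivative g' x) (at x)"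
    "\<And>v. Ck_on k S (\<lambda>x. g' x v)" by (rule Ck_on_SucE) blast
  show ?case
    by (rule Ck_on_SucI[where f' = "\<lambda>x v. f x * g' x v + f' x v * g x"])
      (auto intro!: has_derivative_mult f' g' Suc.IH Ck_on_add Suc.prems[THEN Ck_on_SucD])
qed

text \<open>The derivative of 1 / f is a polynomial in 1 / f and f', so the order k supplied by the
  induction hypothesis gives order k + 1.\<close>

lemma Ck_on_inverse:
  fixes f :: "_ \<Rightarrow> real"
  assumes "\<And>x. x \<in> S \<Longrightarrow> f x \<noteq> 0"
  shows "Ck_on k S f \<Longrightarrow> Ck_on k S (\<lambda>x. inverse (f x))"
proof (induction k)
  case 0
  thus ?case using assms by (simp add: continuous_on_inverse)
next
  case (Suc k)
  from Suc.prems obtain f' where f': "\<And>x. x \<in> S \<Longrightarrow> (f has_derivative f' x) (at x)"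
    "\<And>v. Ck_on k S (\<lambda>x. f' x v)" by (rule Ck_on_SucE) blast
  note inv = Suc.IH[OF Ck_on_SucD[OF Suc.prems]]
  show ?case
  proof (rule Ck_on_SucI[where f' = "\<lambda>x v. - (inverse (f x) * f' x v * inverse (f x))"])
    show "Ck_on k S (\<lambda>x. - (inverse (f x) * f' x v * inverse (f x)))" for v
      using Ck_on_bounded_linear[OF bounded_linear_minus[OF bounded_linear_ident]
          Ck_on_mult[OF Ck_on_mult[OF inv f'(2)] inv], of v] by simp
  next
    fix x assume "x \<in> S"
    thus "((\<lambda>x. inverse (f x)) has_derivative (\<lambda>v. - (inverse (f x) * f' x v * inverse (f x)))) (at x)"
      by (intro Deriv.has_derivative_inverse f'(1) assms)
  qed
qed

lemma Ck_on_sum: "(\<And>i. i \<in> I \<Longrightarrow> Ck_on k S (f i)) \<Longrightarrow> Ck_on k S (\<lambda>x. \<Sum>i\<in>I. f i x)"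
  by (induction I rule: infinite_finite_induct) (auto intro: Ck_on_const Ck_on_add)

lemma Ck_on_prod:
  fixes f :: "'i \<Rightarrow> _ \<Rightarrow> real"
  shows "(\<And>i. i \<in> I \<Longrightarrow> Ck_on k S (f i)) \<Longrightarrow> Ck_on k S (\<lambda>x. \<Prod>i\<in>I. f i x)"
  by (induction I rule: infinite_finite_induct) (auto intro: Ck_on_const Ck_on_mult)

text \<open>The same bootstrap: the derivative of the root is f' divided by a multiple of a power of
  the root. Odd degree admits negative values of f; at 0 the root can fail to be
  differentiable.\<close>

lemma Ck_on_root:
  fixes f :: "_ \<Rightarrow> real"
  assumes "odd n" "\<And>x. x \<in> S \<Longrightarrow> f x \<noteq> 0"
  shows "Ck_on k S f \<Longrightarrow> Ck_on k S (\<lambda>x. root n (f x))"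
proof (induction k)
  case 0
  thus ?case by (simp add: continuous_on_real_root)
next
  case (Suc k)
  have n: "0 < n" using assms(1) by (rule odd_pos)
  from Suc.prems obtain f' where f': "\<And>x. x \<in> S \<Longrightarrow> (f has_derivative f' x) (at x)"
    "\<And>v. Ck_on k S (\<lambda>x. f' x v)" by (rule Ck_on_SucE) blast
  define r where "r x = inverse (real n * root n (f x) ^ (n - 1))" for x
  \<comment> \<open>The power is written as a product so that \<open>Ck_on_prod\<close>
    applies.\<close>
  have "Ck_on k S (\<lambda>x. real n * (\<Prod>i<n - 1. root n (f x)))"
    by (intro Ck_on_mult Ck_on_prod Ck_on_const Suc.IH Ck_on_SucD[OF Suc.prems])
  hence r: "Ck_on k S r"
    unfolding r_def using assms(2) n by (intro Ck_on_inverse) (auto simp: real_root_eq_0_iff)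
  show ?case
  proof (rule Ck_on_SucI[where f' = "\<lambda>x v. f' x v * r x"])
    show "Ck_on k S (\<lambda>x. f' x v * r x)" for v
      by (intro Ck_on_mult f' r)
    show "((\<lambda>x. root n (f x)) has_derivative (\<lambda>v. f' x v * r x)) (at x)" if "x \<in> S" for x
    proof -
      have "(root n has_real_derivative r x) (at (f x))"
        unfolding r_def using assms that n by (intro DERIV_real_root_generic) auto
      from DERIV_compose_FDERIV[OF this f'(1)[OF that]] show ?thesis .
    qed
  qed
qed

lemma smooth_on_cong:
  "open S \<Longrightarrow> (\<And>x. x \<in> S \<Longrightarrow> f x = g x) \<Longrightarrow> smooth_on S f \<Longrightarrow> smooth_on S g"
  unfolding smooth_on_def using Ck_on_cong by metis

lemma smooth_on_const: "smooth_on S (\<lambda>x. c)"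
  by (simp add: smooth_on_def Ck_on_const)

lemma smooth_on_add: "smooth_on S f \<Longrightarrow> smooth_on S g \<Longrightarrow> smooth_on S (\<lambda>x. f x + g x)"
  by (simp add: smooth_on_def Ck_on_add)

lemma smooth_on_mult:
  "smooth_on S f \<Longrightarrow> smooth_on S g \<Longrightarrow> smooth_on S (\<lambda>x. f x * g x :: real)"
  by (simp add: smooth_on_def Ck_on_mult)

lemma smooth_on_diff:
  "smooth_on S f \<Longrightarrow> smooth_on S g \<Longrightarrow> smooth_on S (\<lambda>x. f x - g x :: real)"
  using smooth_on_add[of S f "\<lambda>x. - 1 * g x"] smooth_on_mult[OF smooth_on_const[of S "-1"], of g]
  by simp

lemma smooth_on_inverse:
  "(\<And>x. x \<in> S \<Longrightarrow> f x \<noteq> 0) \<Longrightarrow> smooth_on S f \<Longrightarrow> smooth_on S (\<lambda>x. inverse (f x :: real))"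
  by (simp add: smooth_on_def Ck_on_inverse)

lemma smooth_on_divide:
  "smooth_on S f \<Longrightarrow> smooth_on S g \<Longrightarrow> (\<And>x. x \<in> S \<Longrightarrow> g x \<noteq> 0) \<Longrightarrow> smooth_on S (\<lambda>x. f x / g x :: real)"
  unfolding divide_inverse by (intro smooth_on_mult smooth_on_inverse)

lemma smooth_on_root:
  "odd n \<Longrightarrow> (\<And>x. x \<in> S \<Longrightarrow> f x \<noteq> 0) \<Longrightarrow> smooth_on S f \<Longrightarrow> smooth_on S (\<lambda>x. root n (f x))"
  by (simp add: smooth_on_def Ck_on_root)

lemma smooth_on_sum:
  "(\<And>i. i \<in> I \<Longrightarrow> smooth_on S (f i)) \<Longrightarrow> smooth_on S (\<lambda>x. \<Sum>i\<in>I. f i x)"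
  by (simp add: smooth_on_def Ck_on_sum)

lemma smooth_on_prod:
  "(\<And>i. i \<in> I \<Longrightarrow> smooth_on S (f i)) \<Longrightarrow> smooth_on S (\<lambda>x. \<Prod>i\<in>I. f i x :: real)"
  by (simp add: smooth_on_def Ck_on_prod)

lemma smooth_on_inner_const: "smooth_on S f \<Longrightarrow> smooth_on S (\<lambda>x. f x \<bullet> b)"
  unfolding smooth_on_def by (intro allI Ck_on_bounded_linear[OF bounded_linear_inner_left]) simp

lemma smooth_on_has_frechet_derivative:
  assumes "smooth_on S f" "x \<in> S"
  shows "(f has_derivative frechet_derivative f (at x)) (at x)"
proof -
  have "Ck_on (Suc 0) S f" using assms(1) by (simp add: smooth_on_def del: Ck_on.simps)
  then obtain f' where "(f has_derivative f' x) (at x)" using assms(2) by (blast elim: Ck_on_SucE)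
  thus ?thesis using frechet_derivative_works differentiableI by blast
qed

section \<open>Symmetry of second derivatives\<close>

lemma second_difference:
  fixes f :: "'a::real_normed_vector \<Rightarrow> real"
  assumes s: "0 < s" and U: "\<And>a b. 0 \<le> a \<Longrightarrow> a \<le> s \<Longrightarrow> 0 \<le> b \<Longrightarrow> b \<le> s \<Longrightarrow> x + a *\<^sub>R v + b *\<^sub>R w \<in> U"
    and f': "\<And>z. z \<in> U \<Longrightarrow> (f has_derivative f' z) (at z)"
    and f'': "\<And>z. z \<in> U \<Longrightarrow> ((\<lambda>z. f' z v) has_derivative A z) (at z)"
  obtains a b where "0 < a" "a < s" "0 < b" "b < s"
    "f (x + s *\<^sub>R v + s *\<^sub>R w) - f (x + s *\<^sub>R v) - f (x + s *\<^sub>R w) + f x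
       = s * (s * A (x + a *\<^sub>R v + b *\<^sub>R w) w)"
proof -
  have d1: "((\<lambda>a. f (x + a *\<^sub>R v + c *\<^sub>R w)) has_real_derivative f' (x + a *\<^sub>R v + c *\<^sub>R w) v) (at a)"
    if "0 \<le> a" "a \<le> s" "0 \<le> c" "c \<le> s" for a c
  proof -
    have g: "((\<lambda>a. x + a *\<^sub>R v + c *\<^sub>R w) has_derivative (\<lambda>h. h *\<^sub>R v)) (at a)"
      by (auto intro!: derivative_eq_intros)
    have lin: "linear (f' (x + a *\<^sub>R v + c *\<^sub>R w))"
      using f'[OF U[OF that]] has_derivative_linear by blast
    from has_derivative_compose[OF g f'[OF U[OF that]]] show ?thesis
      by (simp add: has_field_derivative_def linear_scale[OF lin] mult_commute_abs)
  qed
  \<comment> \<open>The mean value theorem along v, for the difference of f across the step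
    \<open>s *\<^sub>R w\<close>; a second application, along w, follows for the derivative in
    direction v.\<close>
  have "((\<lambda>a. f (x + a *\<^sub>R v + s *\<^sub>R w) - f (x + a *\<^sub>R v + 0 *\<^sub>R w)) has_real_derivative
      f' (x + a *\<^sub>R v + s *\<^sub>R w) v - f' (x + a *\<^sub>R v + 0 *\<^sub>R w) v) (at a)"
    if "0 \<le> a" "a \<le> s" for a
    using that s by (intro DERIV_diff d1) auto
  from MVT2[OF s this] obtain a where a: "0 < a" "a < s"
    "f (x + s *\<^sub>R v + s *\<^sub>R w) - f (x + s *\<^sub>R v) - (f (x + s *\<^sub>R w) - f x)
      = s * (f' (x + a *\<^sub>R v + s *\<^sub>R w) v - f' (x + a *\<^sub>R v) v)"
    by auto
  have d2: "((\<lambda>b. f' (x + a *\<^sub>R v + b *\<^sub>R w) v) has_real_derivative A (x + a *\<^sub>R v + b *\<^sub>R w) w) (at b)"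
    if "0 \<le> b" "b \<le> s" for b
  proof -
    have g: "((\<lambda>b. x + a *\<^sub>R v + b *\<^sub>R w) has_derivative (\<lambda>h. h *\<^sub>R w)) (at b)"
      by (auto intro!: derivative_eq_intros)
    have z: "x + a *\<^sub>R v + b *\<^sub>R w \<in> U" using a that by (intro U) auto
    have lin: "linear (A (x + a *\<^sub>R v + b *\<^sub>R w))"
      using f''[OF z] has_derivative_linear by blast
    from has_derivative_compose[OF g f''[OF z]] show ?thesis
      by (simp add: has_field_derivative_def linear_scale[OF lin] mult_commute_abs)
  qed
  from MVT2[OF s this] obtain b where b: "0 < b" "b < s"
    "f' (x + a *\<^sub>R v + s *\<^sub>R w) v - f' (x + a *\<^sub>R v) v = s * A (x + a *\<^sub>R v + b *\<^sub>R w) w"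
    by auto
  show thesis by (rule that[OF a(1,2) b(1,2)]) (use a(3) b(3) in auto)
qed

text \<open>The second difference is symmetric in v and w. By \<open>second_difference\<close> it
  produces equal values of \<open>A _ w\<close> and \<open>B _ v\<close> at points near x, and
  continuity brings both to x. Only derivatives in fixed directions are assumed, which is what
  \<open>Ck_on\<close> of order 2 provides.\<close>

lemma symmetric_second_derivative_real:
  fixes f :: "'a::real_normed_vector \<Rightarrow> real"
  assumes U: "open U" "x \<in> U"
    and f': "\<And>z. z \<in> U \<Longrightarrow> (f has_derivative f' z) (at z)"
    and A: "\<And>z. z \<in> U \<Longrightarrow> ((\<lambda>z. f' z v) has_derivative A z) (at z)"
    and B: "\<And>z. z \<in> U \<Longrightarrow> ((\<lambda>z. f' z w) has_derivative B z) (at z)"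
    and cA: "continuous_on U (\<lambda>z. A z w)" and cB: "continuous_on U (\<lambda>z. B z v)"
  shows "A x w = B x v"
proof (rule ccontr)
  assume neq: "A x w \<noteq> B x v"
  define e where "e = \<bar>A x w - B x v\<bar> / 2"
  have e: "0 < e" using neq by (simp add: e_def)
  have "isCont (\<lambda>z. A z w) x" "isCont (\<lambda>z. B z v) x"
    using cA cB U continuous_on_eq_continuous_at by blast+
  then obtain dA dB where d: "0 < dA" "\<And>z. dist z x < dA \<Longrightarrow> dist (A z w) (A x w) < e"
     "0 < dB" "\<And>z. dist z x < dB \<Longrightarrow> dist (B z v) (B x v) < e"
    unfolding continuous_at_eps_delta using e by metis
  obtain dU where dU: "0 < dU" "\<And>z. dist z x < dU \<Longrightarrow> z \<in> U"
    using U by (auto simp: open_dist)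
  define r where "r = min dU (min dA dB)"
  have r: "0 < r" using d dU by (simp add: r_def)
  \<comment> \<open>Keeps the whole parallelogram within r / 2 of x; the summand 1 avoids division
    by zero when v and w vanish.\<close>
  define s where "s = r / (2 * (norm v + norm w + 1))"
  have pos: "0 < norm v + norm w + 1" by (smt (verit) norm_ge_zero)
  have s: "0 < s" using r pos by (simp add: s_def)
  have near: "dist (x + a *\<^sub>R v + b *\<^sub>R w) x < r" if "0 \<le> a" "a \<le> s" "0 \<le> b" "b \<le> s" for a b
  proof -
    have "dist (x + a *\<^sub>R v + b *\<^sub>R w) x \<le> a * norm v + b * norm w"
      using norm_triangle_ineq[of "a *\<^sub>R v" "b *\<^sub>R w"] that by (simp add: dist_norm add.assoc)
    also have "\<dots> \<le> s * norm v + s * norm w"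
      using that by (intro add_mono mult_right_mono) auto
    also have "\<dots> \<le> s * (norm v + norm w + 1)" using s by (simp add: algebra_simps)
    also have "\<dots> = r / 2"
    proof -
      have "r / (2 * N) * N = r / 2" if "0 < N" for N :: real using that by simp
      thus ?thesis using pos unfolding s_def by blast
    qed
    finally show ?thesis using r by simp
  qed
  have inU: "x + a *\<^sub>R v + b *\<^sub>R w \<in> U" if "0 \<le> a" "a \<le> s" "0 \<le> b" "b \<le> s" for a b
    using near[OF that] dU by (simp add: r_def)
  have inU': "x + b *\<^sub>R w + a *\<^sub>R v \<in> U" if "0 \<le> b" "b \<le> s" "0 \<le> a" "a \<le> s" for a b
    using inU[of a b] that by (simp add: add_ac)
  obtain a b where ab: "0 < a" "a < s" "0 < b" "b < s"
    "f (x + s *\<^sub>R v + s *\<^sub>R w) - f (x + s *\<^sub>R v) - f (x + s *\<^sub>R w) + f x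
       = s * (s * A (x + a *\<^sub>R v + b *\<^sub>R w) w)"
    using second_difference[OF s inU f' A] by blast
  obtain c d' where cd: "0 < c" "c < s" "0 < d'" "d' < s"
    "f (x + s *\<^sub>R w + s *\<^sub>R v) - f (x + s *\<^sub>R w) - f (x + s *\<^sub>R v) + f x
       = s * (s * B (x + c *\<^sub>R w + d' *\<^sub>R v) v)"
    using second_difference[OF s inU' f' B] by blast
  have swap: "x + s *\<^sub>R w + s *\<^sub>R v = x + s *\<^sub>R v + s *\<^sub>R w"
    by (simp add: add_ac)
  have "s * (s * A (x + a *\<^sub>R v + b *\<^sub>R w) w) = s * (s * B (x + c *\<^sub>R w + d' *\<^sub>R v) v)"
    using ab(5) cd(5) unfolding swap by linarith
  hence eq: "A (x + a *\<^sub>R v + b *\<^sub>R w) w = B (x + c *\<^sub>R w + d' *\<^sub>R v) v" using s by simp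
  have "dist (A (x + a *\<^sub>R v + b *\<^sub>R w) w) (A x w) < e"
    using near[of a b] ab by (intro d) (simp add: r_def)
  moreover have "dist (B (x + c *\<^sub>R w + d' *\<^sub>R v) v) (B x v) < e"
    using near[of d' c] cd by (intro d) (simp add: r_def add_ac)
  ultimately have "\<bar>A x w - B x v\<bar> < 2 * e" unfolding eq by (simp add: dist_real_def)
  thus False by (simp add: e_def)
qed

lemma symmetric_second_derivative:
  fixes f :: "'a::real_normed_vector \<Rightarrow> 'b::euclidean_space"
  assumes U: "open U" "x \<in> U"
    and f': "\<And>z. z \<in> U \<Longrightarrow> (f has_derivative f' z) (at z)"
    and A: "\<And>z. z \<in> U \<Longrightarrow> ((\<lambda>z. f' z v) has_derivative A z) (at z)"
    and B: "\<And>z. z \<in> U \<Longrightarrow> ((\<lambda>z. f' z w) has_derivative B z) (at z)"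
    and cA: "continuous_on U (\<lambda>z. A z w)" and cB: "continuous_on U (\<lambda>z. B z v)"
  shows "A x w = B x v"
proof (rule euclidean_eqI)
  fix b :: 'b
  show "A x w \<bullet> b = B x v \<bullet> b"
    by (rule symmetric_second_derivative_real[OF U, of "\<lambda>z. f z \<bullet> b" "\<lambda>z u. f' z u \<bullet> b" v
          "\<lambda>z u. A z u \<bullet> b" w "\<lambda>z u. B z u \<bullet> b"])
      (intro has_derivative_inner_left f' A B continuous_on_inner cA cB continuous_on_const; assumption)+
qed

section \<open>Smooth families of alternating forms\<close>

lemma alternating_smooth:
  fixes \<omega> :: "'x::euclidean_space \<Rightarrow> ('v::euclidean_space) form"
  assumes S: "open S" and alt: "\<And>x. x \<in> S \<Longrightarrow> alternating_form k (\<omega> x)"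
    and \<omega>: "\<And>v. smooth_on S (\<lambda>x. \<omega> x v)" and w: "\<And>i. i < k \<Longrightarrow> smooth_on S (w i)"
  shows "smooth_on S (\<lambda>x. \<omega> x (\<lambda>i. w i x))"
proof -
  have "smooth_on S (\<lambda>x. \<omega> x (\<lambda>i. if i < m then w i x else u i))" if "m \<le> k" for m u
    using that
  proof (induction m arbitrary: u)
    case 0
    show ?case using \<omega> by simp
  next
    case (Suc m)
    have "smooth_on S (\<lambda>x. \<Sum>b\<in>Basis. (w m x \<bullet> b) * \<omega> x (\<lambda>i. if i < m then w i x else (u(m := b)) i))"
      using Suc by (intro smooth_on_sum smooth_on_mult smooth_on_inner_const w Suc.IH) auto
    moreover have "(\<Sum>b\<in>Basis. (w m x \<bullet> b) * \<omega> x (\<lambda>i. if i < m then w i x else (u(m := b)) i))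
        = \<omega> x (\<lambda>i. if i < Suc m then w i x else u i)" if "x \<in> S" for x
    proof -
      have "(\<lambda>i. if i < m then w i x else (u(m := b)) i)
          = (\<lambda>i. if i < Suc m then w i x else u i)(m := b)" for b by auto
      thus ?thesis
        using alternating_expand[OF alt[OF that], of m "\<lambda>i. if i < Suc m then w i x else u i"] Suc.prems
        by simp
    qed
    ultimately show ?case by (rule smooth_on_cong[OF S, rotated]) auto
  qed
  \<comment> \<open>From slot k on the form ignores its arguments, so any filler serves.\<close>
  from this[of k undefined] have "smooth_on S (\<lambda>x. \<omega> x (\<lambda>i. if i < k then w i x else undefined i))" by simp
  thus ?thesis
    by (rule smooth_on_cong[OF S, rotated]) (auto intro!: alternating_cong[OF alt])
qed

text \<open>The Leibniz rule: differentiate the form at frozen arguments, then each argument in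
  turn.\<close>

lemma alternating_has_derivative:
  fixes \<omega> :: "'x::real_normed_vector \<Rightarrow> ('v::euclidean_space) form"
  assumes S: "open S" "x \<in> S" and alt: "\<And>x. x \<in> S \<Longrightarrow> alternating_form k (\<omega> x)"
    and \<omega>: "\<And>v. ((\<lambda>x. \<omega> x v) has_derivative D v) (at x)"
    and w: "\<And>i. i < k \<Longrightarrow> (w i has_derivative w' i) (at x)"
  shows "((\<lambda>x. \<omega> x (\<lambda>i. w i x)) has_derivative
    (\<lambda>h. D (\<lambda>i. w i x) h + (\<Sum>i<k. \<omega> x ((\<lambda>i. w i x)(i := w' i h))))) (at x)"
proof -
  \<comment> \<open>The derivative inherits linearity in each argument: differentiate the basis
    expansion of \<omega> and use uniqueness of derivatives.\<close>
  have D_expand: "D v h = (\<Sum>b\<in>Basis. (v m \<bullet> b) * D (v(m := b)) h)" if "m < k" for m v h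
  proof -
    have "((\<lambda>x. \<omega> x v) has_derivative (\<lambda>h. \<Sum>b\<in>Basis. (v m \<bullet> b) * D (v(m := b)) h)) (at x)"
    proof (rule has_derivative_transform_within_open[OF _ S])
      show "((\<lambda>x. \<Sum>b\<in>Basis. (v m \<bullet> b) * \<omega> x (v(m := b))) has_derivative
          (\<lambda>h. \<Sum>b\<in>Basis. (v m \<bullet> b) * D (v(m := b)) h)) (at x)"
        by (intro has_derivative_sum has_derivative_mult_right \<omega>)
    qed (use alternating_expand[OF alt that, symmetric] in auto)
    from has_derivative_unique[OF \<omega> this] show ?thesis by simp
  qed
  \<comment> \<open>The first m arguments move with the point, the others are frozen at u.\<close>
  have main: "((\<lambda>y. \<omega> y (\<lambda>i. if i < m then w i y else u i)) has_derivative
      (\<lambda>h. D (\<lambda>i. if i < m then w i x else u i) h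
         + (\<Sum>j<m. \<omega> x ((\<lambda>i. if i < m then w i x else u i)(j := w' j h))))) (at x)"
    if "m \<le> k" for m u
    using that
  proof (induction m arbitrary: u)
    case 0
    show ?case using \<omega> by simp
  next
    case (Suc m)
    hence m: "m < k" by simp
    define c where "c y = (\<lambda>i. if i < Suc m then w i y else u i)" for y
    have c: "(\<lambda>i. if i < m then w i y else (u(m := b)) i) = (c y)(m := b)" for b y
      by (auto simp: c_def)
    have IH: "((\<lambda>y. \<omega> y ((c y)(m := b))) has_derivative
      (\<lambda>h. D ((c x)(m := b)) h + (\<Sum>j<m. \<omega> x ((c x)(m := b, j := w' j h))))) (at x)" for b
      using Suc.IH[of "u(m := b)", unfolded c] m by (simp only: less_imp_le)
    have cm: "c y m = w m y" for y by (simp add: c_def)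
    have "((\<lambda>y. \<omega> y (c y)) has_derivative (\<lambda>h. \<Sum>b\<in>Basis.
       (w m x \<bullet> b) * (D ((c x)(m := b)) h + (\<Sum>j<m. \<omega> x ((c x)(m := b, j := w' j h))))
         + (w' m h \<bullet> b) * \<omega> x ((c x)(m := b)))) (at x)"
    proof (rule has_derivative_transform_within_open[OF _ S])
      show "((\<lambda>y. \<Sum>b\<in>Basis. (w m y \<bullet> b) * \<omega> y ((c y)(m := b))) has_derivative (\<lambda>h. \<Sum>b\<in>Basis.
       (w m x \<bullet> b) * (D ((c x)(m := b)) h + (\<Sum>j<m. \<omega> x ((c x)(m := b, j := w' j h))))
         + (w' m h \<bullet> b) * \<omega> x ((c x)(m := b)))) (at x)"
        by (intro has_derivative_sum has_derivative_mult has_derivative_inner_left w m IH)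
    next
      fix y assume "y \<in> S"
      thus "(\<Sum>b\<in>Basis. (w m y \<bullet> b) * \<omega> y ((c y)(m := b))) = \<omega> y (c y)"
        using alternating_expand[OF alt m, of y "c y"] by (simp only: cm)
    qed
    moreover have "(\<Sum>b\<in>Basis.
       (w m x \<bullet> b) * (D ((c x)(m := b)) h + (\<Sum>j<m. \<omega> x ((c x)(m := b, j := w' j h))))
         + (w' m h \<bullet> b) * \<omega> x ((c x)(m := b)))
      = D (c x) h + (\<Sum>j<Suc m. \<omega> x ((c x)(j := w' j h)))" for h
    proof -
      have "(\<Sum>b\<in>Basis. (w m x \<bullet> b) * (\<Sum>j<m. \<omega> x ((c x)(m := b, j := w' j h))))
          = (\<Sum>j<m. \<Sum>b\<in>Basis. (w m x \<bullet> b) * \<omega> x ((c x)(m := b, j := w' j h)))"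
        unfolding sum_distrib_left by (rule sum.swap)
      also have "\<dots> = (\<Sum>j<m. \<omega> x ((c x)(j := w' j h)))"
      proof (rule sum.cong[OF refl])
        fix j assume "j \<in> {..<m}"
        hence j: "j \<noteq> m" by simp
        show "(\<Sum>b\<in>Basis. (w m x \<bullet> b) * \<omega> x ((c x)(m := b, j := w' j h))) = \<omega> x ((c x)(j := w' j h))"
          using alternating_expand[OF alt[OF S(2)] m, of "(c x)(j := w' j h)"] j
          by (simp add: cm fun_upd_twist[OF j])
      qed
      finally have 1: "(\<Sum>b\<in>Basis. (w m x \<bullet> b) * (\<Sum>j<m. \<omega> x ((c x)(m := b, j := w' j h))))
        = (\<Sum>j<m. \<omega> x ((c x)(j := w' j h)))" .
      have 2: "(\<Sum>b\<in>Basis. (w m x \<bullet> b) * D ((c x)(m := b)) h) = D (c x) h"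
        using D_expand[OF m, of "c x" h] by (simp add: cm)
      have 3: "(\<Sum>b\<in>Basis. (w' m h \<bullet> b) * \<omega> x ((c x)(m := b))) = \<omega> x ((c x)(m := w' m h))"
        using alternating_expand[OF alt[OF S(2)] m, of "(c x)(m := w' m h)"] by simp
      show ?thesis by (simp add: distrib_left sum.distrib 1 2 3)
    qed
    ultimately show ?case by (simp only: c_def)
  qed
  have "((\<lambda>y. \<omega> y (\<lambda>i. if i < k then w i y else w i x)) has_derivative
      (\<lambda>h. D (\<lambda>i. w i x) h + (\<Sum>j<k. \<omega> x ((\<lambda>i. w i x)(j := w' j h))))) (at x)"
    using main[of k "\<lambda>i. w i x"] by simp
  thus ?thesis
    by (rule has_derivative_transform_within_open[OF _ S]) (auto intro!: alternating_cong[OF alt])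
qed

text \<open>The Leibniz rule at t = 0 for \<omega> at the moving point, applied to the vectors
  transported by the derivative of the flow map. The point starts with velocity \<open>X x\<close>;
  the velocity of the transported \<open>v i\<close> is a mixed second derivative of the flow, equal
  to \<open>X' (v i)\<close>.\<close>

lemma lie_derivative_formula:
  fixes X :: "'v::euclidean_space \<Rightarrow> 'v" and \<omega> :: "'v \<Rightarrow> 'v form"
  assumes lie: "has_lie_derivative V X \<omega> x \<eta>" and V: "open V"
    and X: "(X has_derivative X') (at x)"
    and alt: "\<And>y. y \<in> V \<Longrightarrow> alternating_form k (\<omega> y)"
    and \<omega>: "\<And>v. ((\<lambda>y. \<omega> y v) has_derivative D v) (at x)"
  shows "\<eta> v = D v (X x) + (\<Sum>i<k. \<omega> x (v(i := X' (v i))))"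
proof -
  from lie obtain \<epsilon> W \<Phi> where flow: "local_flow V X x \<epsilon> W \<Phi>"
    and der: "\<And>v. ((\<lambda>t. pullback (frechet_derivative (\<lambda>y. \<Phi> (t, y)) (at x)) (\<omega> (\<Phi> (t, x))) v)
                has_real_derivative \<eta> v) (at 0)"
    unfolding has_lie_derivative_def by blast
  define U where "U = {-\<epsilon><..<\<epsilon>} \<times> W"
  have eps: "0 < \<epsilon>" and W: "open W" "x \<in> W" and smooth: "smooth_on U \<Phi>" and into: "\<Phi> ` U \<subseteq> V"
    and \<Phi>0: "\<And>y. y \<in> W \<Longrightarrow> \<Phi> (0, y) = y"
    and ode: "\<And>t y. t \<in> {-\<epsilon><..<\<epsilon>} \<Longrightarrow> y \<in> W \<Longrightarrow>
      ((\<lambda>s. \<Phi> (s, y)) has_vector_derivative X (\<Phi> (t, y))) (at t)"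
    using flow unfolding local_flow_def U_def by blast+
  have U: "open U" "(0, x) \<in> U" using W eps by (auto simp: U_def open_Times)
  have "Ck_on (Suc (Suc 0)) U \<Phi>" using smooth unfolding smooth_on_def by blast
  then obtain \<Phi>' where \<Phi>': "\<And>z. z \<in> U \<Longrightarrow> (\<Phi> has_derivative \<Phi>' z) (at z)"
    and C1: "\<And>v. Ck_on (Suc 0) U (\<lambda>z. \<Phi>' z v)" by (rule Ck_on_SucE) blast
  have "\<exists>B. (\<forall>z\<in>U. ((\<lambda>z. \<Phi>' z v) has_derivative B z) (at z)) \<and> (\<forall>w. continuous_on U (\<lambda>z. B z w))" for v
    using C1[of v] by simp
  then obtain B where B: "\<And>v z. z \<in> U \<Longrightarrow> ((\<lambda>z. \<Phi>' z v) has_derivative B v z) (at z)"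
    and Bc: "\<And>v w. continuous_on U (\<lambda>z. B v z w)" by metis
  have sym: "B v (0, x) w = B w (0, x) v" for v w
    by (rule symmetric_second_derivative[OF U \<Phi>' B B Bc Bc])
  have time: "\<Phi>' z (1, 0) = X (\<Phi> z)" if z: "z \<in> U" for z
  proof -
    obtain t y where ty: "z = (t, y)" "t \<in> {-\<epsilon><..<\<epsilon>}" "y \<in> W" using z by (auto simp: U_def)
    have "((\<lambda>s. (s, y)) has_derivative (\<lambda>h. (h, 0))) (at t)"
      by (intro has_derivative_Pair has_derivative_ident has_derivative_const)
    from has_derivative_compose[OF this] \<Phi>'[OF z]
    have "((\<lambda>s. \<Phi> (s, y)) has_derivative (\<lambda>h. \<Phi>' z (h, 0))) (at t)" unfolding ty(1) by blast
    with ode[OF ty(2,3)] have "(\<lambda>h. \<Phi>' z (h, 0)) = (\<lambda>h. h *\<^sub>R X (\<Phi> (t, y)))"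
      unfolding has_vector_derivative_def by (blast intro: has_derivative_unique)
    from fun_cong[OF this, of 1] show ?thesis by (simp add: ty(1))
  qed
  have space: "((\<lambda>y. \<Phi> (t, y)) has_derivative (\<lambda>h. \<Phi>' (t, y) (0, h))) (at y)" if "(t, y) \<in> U" for t y
  proof -
    have "((\<lambda>y. (t, y)) has_derivative (\<lambda>h. (0, h))) (at y)"
      by (intro has_derivative_Pair has_derivative_ident has_derivative_const)
    from has_derivative_compose[OF this] \<Phi>'[OF that] show ?thesis by blast
  qed
  have space0: "\<Phi>' (0, x) (0, h) = h" for h
  proof -
    have "((\<lambda>y. \<Phi> (0, y)) has_derivative (\<lambda>h. h)) (at x)"
      by (rule has_derivative_transform_within_open[OF has_derivative_ident W]) (simp add: \<Phi>0)
    from has_derivative_unique[OF space[OF U(2)] this] show ?thesis by meson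
  qed
  \<comment> \<open>By symmetry, the time derivative of the spatial derivative is the spatial
    derivative of the velocity \<open>X (\<Phi> z)\<close>; at time 0 the flow map has the identity
    as derivative.\<close>
  have mixed: "B (0, h) (0, x) (1, 0) = X' h" for h
  proof -
    have X0: "(X has_derivative X') (at (\<Phi> (0, x)))" using X \<Phi>0[OF W(2)] by simp
    have "((\<lambda>z. X (\<Phi> z)) has_derivative (\<lambda>h. X' (\<Phi>' (0, x) h))) (at (0, x))"
      using has_derivative_compose[OF \<Phi>'[OF U(2)] X0] .
    hence "((\<lambda>z. \<Phi>' z (1, 0)) has_derivative (\<lambda>h. X' (\<Phi>' (0, x) h))) (at (0, x))"
      by (rule has_derivative_transform_within_open[OF _ U]) (simp add: time)
    from has_derivative_unique[OF B[OF U(2)] this]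
    have "B (1, 0) (0, x) (0, h) = X' (\<Phi>' (0, x) (0, h))" by meson
    thus ?thesis by (simp add: sym[of "(0, h)"] space0)
  qed
  define T where "T = {-\<epsilon><..<\<epsilon>}"
  have T: "open T" "0 \<in> T" using eps by (auto simp: T_def)
  have TU: "(t, x) \<in> U" if "t \<in> T" for t using that W by (simp add: U_def T_def)
  have pair: "((\<lambda>t. (t, x)) has_derivative (\<lambda>h. (h, 0))) (at t)" for t :: real
    by (intro has_derivative_Pair has_derivative_ident has_derivative_const)
  have dw: "((\<lambda>t. \<Phi>' (t, x) (0, v i)) has_derivative (\<lambda>h. h *\<^sub>R X' (v i))) (at 0)" for i
  proof -
    have lin: "linear (B (0, v i) (0, x))" using B[OF U(2)] has_derivative_linear by blast
    have "(h, 0) = h *\<^sub>R (1, 0 :: 'v)" for h :: real by simp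
    hence "B (0, v i) (0, x) (h, 0) = h *\<^sub>R X' (v i)" for h
      using linear_scale[OF lin, of h "(1, 0)"] by (simp add: mixed)
    with has_derivative_compose[OF pair B[OF U(2), of "(0, v i)"]] show ?thesis by simp
  qed
  have d\<omega>: "((\<lambda>t. \<omega> (\<Phi> (t, x)) u) has_derivative (\<lambda>h. D u (h *\<^sub>R X x))) (at 0)" for u
  proof -
    have lin: "linear (\<Phi>' (0, x))" using \<Phi>'[OF U(2)] has_derivative_linear by blast
    have "(h, 0) = h *\<^sub>R (1, 0 :: 'v)" for h :: real by simp
    hence 1: "\<Phi>' (0, x) (h, 0) = h *\<^sub>R X x" for h
      using linear_scale[OF lin, of h "(1, 0)"] by (simp add: time[OF U(2)] \<Phi>0[OF W(2)])
    have "((\<lambda>y. \<omega> y u) has_derivative D u) (at (\<Phi> (0, x)))" using \<omega> \<Phi>0[OF W(2)] by simp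
    from has_derivative_compose[OF has_derivative_compose[OF pair \<Phi>'[OF U(2)]] this]
    show ?thesis by (simp add: 1)
  qed
  have "((\<lambda>t. \<omega> (\<Phi> (t, x)) (\<lambda>i. \<Phi>' (t, x) (0, v i))) has_derivative
     (\<lambda>h. D (\<lambda>i. \<Phi>' (0, x) (0, v i)) (h *\<^sub>R X x)
       + (\<Sum>i<k. \<omega> (\<Phi> (0, x)) ((\<lambda>i. \<Phi>' (0, x) (0, v i))(i := h *\<^sub>R X' (v i)))))) (at 0)"
    using alternating_has_derivative[OF T, where \<omega> = "\<lambda>t. \<omega> (\<Phi> (t, x))" and k = k
        and w = "\<lambda>i t. \<Phi>' (t, x) (0, v i)" and w' = "\<lambda>i h. h *\<^sub>R X' (v i)", OF _ d\<omega> dw]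
      alt into TU by blast
  hence "((\<lambda>t. pullback (frechet_derivative (\<lambda>y. \<Phi> (t, y)) (at x)) (\<omega> (\<Phi> (t, x))) v) has_derivative
     (\<lambda>h. D v (h *\<^sub>R X x) + (\<Sum>i<k. \<omega> x (v(i := h *\<^sub>R X' (v i)))))) (at 0)"
    unfolding space0 \<Phi>0[OF W(2)]
  proof (rule has_derivative_transform_within_open[OF _ T])
    fix t assume "t \<in> T"
    note frechet = frechet_derivative_at[OF space[OF TU[OF this]]]
    show "\<omega> (\<Phi> (t, x)) (\<lambda>i. \<Phi>' (t, x) (0, v i)) =
      pullback (frechet_derivative (\<lambda>y. \<Phi> (t, y)) (at x)) (\<omega> (\<Phi> (t, x))) v"
      unfolding pullback_def frechet[symmetric] ..
  qed
  from has_derivative_unique[OF this der[of v, unfolded has_field_derivative_def]]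
  have "(\<lambda>h. D v (h *\<^sub>R X x) + (\<Sum>i<k. \<omega> x (v(i := h *\<^sub>R X' (v i))))) = (*) (\<eta> v)" .
  from fun_cong[OF this, of 1] show ?thesis by simp
qed

section \<open>Smooth dependence of the dual 4-form on phi\<close>

lemma smooth_on_det:
  fixes M :: "'v::euclidean_space \<Rightarrow> real^'n^'n"
  assumes "\<And>i j. smooth_on S (\<lambda>x. M x $ i $ j)"
  shows "smooth_on S (\<lambda>x. det (M x))"
  unfolding det_def by (intro smooth_on_sum smooth_on_mult smooth_on_const smooth_on_prod assms)

lemma smooth_on_wedge:
  assumes "\<And>v. smooth_on S (\<lambda>x. \<alpha> x v)" "\<And>v. smooth_on S (\<lambda>x. \<beta> x v)"
  shows "smooth_on S (\<lambda>x. wedge k l (\<alpha> x) (\<beta> x) v)"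
  unfolding wedge_def divide_inverse by (intro smooth_on_sum smooth_on_mult smooth_on_const assms)

text \<open>Up to the factor 6 m on each of its seven rows, B is the Gram matrix of the images of
  the standard basis, whose determinant is the square of m; hence (6 m)^7 m^2.\<close>

lemma (in linear_bijection) gram_det:
  fixes B :: "real^7^7"
  assumes m: "m = vol0 (\<lambda>i. L (e7 ! i))"
    and B: "\<And>a b. B $ a $ b = 6 * (L (axis a 1) \<bullet> L (axis b 1)) * m"
  shows "det B = 6 ^ 7 * m ^ 9"
proof -
  define M where "M = (\<chi> i. L (axis i 1))"
  have "m = det M"
    unfolding m vol0_def M_def by (simp only: e7_nth[OF idx_less] ebasis_idx)
  have "B = (\<chi> i. (6 * m) *s (M ** transpose M) $ i)"
    by (simp add: vec_eq_iff B M_def matrix_matrix_mult_def transpose_def inner_vec_def mult_ac)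
  hence "det B = (6 * m) ^ 7 * det (\<chi> i. (M ** transpose M) $ i)"
    by (simp only: det_rows_mul) simp
  also have "(\<chi> i. (M ** transpose M) $ i) = M ** transpose M" by (simp add: vec_eq_iff)
  also have "(6 * m) ^ 7 * det (M ** transpose M) = (6 * m) ^ 7 * m ^ 2"
    by (simp add: det_mul \<open>m = det M\<close> power2_eq_square)
  also have "\<dots> = 6 ^ 7 * (m ^ 7 * m ^ 2)" by (simp only: power_mult_distrib mult.assoc)
  also have "\<dots> = 6 ^ 7 * m ^ 9" by (simp add: power_add[symmetric])
  finally show ?thesis .
qed

lemma smooth_on_pullback_psi0:
  fixes \<phi> :: "real^7 \<Rightarrow> (real^7) form"
  assumes S: "open S" and L: "\<And>p. p \<in> S \<Longrightarrow> linear_bijection (L p)"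
    and \<phi>L: "\<And>p. p \<in> S \<Longrightarrow> \<phi> p = pullback (L p) phi0"
    and \<phi>: "\<And>v. smooth_on S (\<lambda>p. \<phi> p v)"
  shows "smooth_on S (\<lambda>p. pullback (L p) psi0 v)"
proof -
  define b where "b p x y = wedge 4 3 (wedge 2 2 (interior_product x (\<phi> p)) (interior_product y (\<phi> p)))
    (\<phi> p) ((!) e7)" for p x y
  have b_smooth: "smooth_on S (\<lambda>p. b p x y)" for x y
    unfolding b_def interior_product_def by (intro smooth_on_wedge \<phi>)
  define m where "m p = vol0 (\<lambda>i. L p (e7 ! i))" for p
  have b: "b p x y = 6 * (L p x \<bullet> L p y) * m p" if "p \<in> S" for p x y
    unfolding b_def \<phi>L[OF that] wedge_pullback_phi0 by (simp add: pullback_def m_def)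
  have m0: "m p \<noteq> 0" if "p \<in> S" for p
    using linear_bijection.det_pullback_nonzero[OF L[OF that]] by (simp add: m_def)
  define B :: "real^7 \<Rightarrow> real^7^7" where "B p = (\<chi> i j. b p (axis i 1) (axis j 1))" for p
  have detB: "det (B p) = 6 ^ 7 * m p ^ 9" if "p \<in> S" for p
    by (rule linear_bijection.gram_det[OF L[OF that] m_def]) (simp add: B_def b[OF that])
  have detB0: "det (B p) \<noteq> 0" if "p \<in> S" for p using detB[OF that] m0[OF that] by simp
  have detB_smooth: "smooth_on S (\<lambda>p. det (B p))"
    by (intro smooth_on_det) (simp add: B_def b_smooth)
  have m_smooth: "smooth_on S m"
  proof (rule smooth_on_cong[OF S])
    show "smooth_on S (\<lambda>p. root 9 (det (B p) * inverse (6 ^ 7)))"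
      using detB0 by (intro smooth_on_root smooth_on_mult detB_smooth smooth_on_const) auto
    show "root 9 (det (B p) * inverse (6 ^ 7)) = m p" if "p \<in> S" for p
      by (simp add: detB[OF that] odd_real_root_power_cancel)
  qed
  define x y z w where "x = v 0" and "y = v 1" and "z = v 2" and "w = v 3"
  \<comment> \<open>The system g(u, -) = phi(z, w, -) multiplied by 6 m: its matrix is then B
    itself, whose entries and determinant are already known to be smooth.\<close>
  define c :: "real^7 \<Rightarrow> real^7" where "c p = (\<chi> i. 6 * m p * \<phi> p ((!) [z, w, axis i 1]))" for p
  define u :: "real^7 \<Rightarrow> real^7" where
    "u p = (\<chi> k. det (\<chi> i j. if j = k then c p $ i else B p $ i $ j) / det (B p))" for p
  have u_smooth: "smooth_on S (\<lambda>p. u p $ k)" for k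
  proof -
    have "smooth_on S (\<lambda>p. (\<chi> i j. if j = k then c p $ i else B p $ i $ j) $ i $ j)" for i j
      by (cases "j = k") (simp_all add: c_def B_def b_smooth smooth_on_mult smooth_on_const m_smooth \<phi>)
    thus ?thesis
      unfolding u_def using detB0 by (simp add: smooth_on_divide smooth_on_det detB_smooth)
  qed
  have main: "pullback (L p) psi0 v = (\<Sum>k\<in>UNIV. u p $ k * \<phi> p ((!) [x, y, axis k 1]))
      - (b p x z / (6 * m p)) * (b p y w / (6 * m p)) + (b p x w / (6 * m p)) * (b p y z / (6 * m p))"
    if p: "p \<in> S" for p
  proof -
    interpret linear_bijection "L p" by (rule L[OF p])
    have \<phi>3: "alternating_form 3 (\<phi> p)"
      unfolding \<phi>L[OF p] by (rule alternating_pullback[OF alternating_phi0 lin])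
    have expand: "A q = (\<Sum>k\<in>UNIV. q $ k * A (axis k 1))" if "linear A" for A :: "real^7 \<Rightarrow> real" and q
      using linear_ebasis_expand[OF that, of q] by (simp add: sum_UNIV_7 ebasis_def)
    have "B p *v u p = c p" unfolding cramer[OF detB0[OF p]] u_def ..
    hence "(\<Sum>j\<in>UNIV. B p $ i $ j * u p $ j) = c p $ i" for i
      by (auto simp: matrix_vector_mult_def vec_eq_iff)
    hence "6 * m p * (\<Sum>j\<in>UNIV. u p $ j * (L p (axis i 1) \<bullet> L p (axis j 1))) = 6 * m p * \<phi> p ((!) [z, w, axis i 1])" for i
      by (simp add: B_def b[OF p] c_def sum_distrib_left mult_ac)
    moreover have "linear (\<lambda>q. L p r \<bullet> L p q)" for r
      by (intro linearI) (simp_all add: linear_add[OF lin] linear_scale[OF lin] inner_add_right)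
    \<comment> \<open>After cancelling 6 m this reads g(e_i, u) = phi(z, w, e_i); linearity extends
      it from basis vectors to all vectors.\<close>
    ultimately have "L p (axis i 1) \<bullet> L p (u p) = \<phi> p ((!) [z, w, axis i 1])" for i
      using m0[OF p] expand[of "\<lambda>q. L p (axis i 1) \<bullet> L p q" "u p"] by simp
    moreover have "linear (\<lambda>q. L p q \<bullet> L p (u p))"
      by (intro linearI) (simp_all add: linear_add[OF lin] linear_scale[OF lin] inner_add_left)
    ultimately have "L p q \<bullet> L p (u p) = \<phi> p ((!) [z, w, q])" for q
      using expand[of "\<lambda>q. L p q \<bullet> L p (u p)" q]
        expand[OF alternating_3_linear(3)[OF \<phi>3], of z w q] by simp
    moreover have nth: "\<phi> p ((!) [r, s, t]) = phi0 ((!) [L p r, L p s, L p t])" for r s t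
      unfolding \<phi>L[OF p] pullback_def
      by (rule alternating_cong[OF alternating_phi0]) (auto simp: less_Suc_eq numeral_eq_Suc)
    \<comment> \<open>Surjectivity of \<open>L p\<close> moves the identity to the model, where
      \<open>L p (u p)\<close> is the cross product of the images of z and w.\<close>
    ultimately have "L p (u p) \<bullet> q = phi0 ((!) [L p z, L p w, q])" for q
      by (metis L_inv inner_commute)
    from psi0_identity[OF this, of "L p x" "L p y"]
    have "psi0 ((!) [L p x, L p y, L p z, L p w]) = \<phi> p ((!) [x, y, u p])
        - (b p x z / (6 * m p)) * (b p y w / (6 * m p)) + (b p x w / (6 * m p)) * (b p y z / (6 * m p))"
      using m0[OF p] by (simp add: nth b[OF p])
    moreover have "pullback (L p) psi0 v = psi0 ((!) [L p x, L p y, L p z, L p w])"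
      unfolding pullback_def x_def y_def z_def w_def
      by (rule alternating_cong[OF alternating_psi0]) (auto simp: less_Suc_eq numeral_eq_Suc)
    ultimately show ?thesis
      using expand[OF alternating_3_linear(3)[OF \<phi>3], of x y "u p"] by simp
  qed
  have "smooth_on S (\<lambda>p. (\<Sum>k\<in>UNIV. u p $ k * \<phi> p ((!) [x, y, axis k 1]))
      - (b p x z / (6 * m p)) * (b p y w / (6 * m p)) + (b p x w / (6 * m p)) * (b p y z / (6 * m p)))"
    using m0 by (intro smooth_on_add smooth_on_diff smooth_on_sum smooth_on_mult smooth_on_divide
        u_smooth \<phi> b_smooth smooth_on_const m_smooth) auto
  thus ?thesis by (rule smooth_on_cong[OF S, rotated]) (simp add: main)
qed

section \<open>Contraction with the bracket\<close>

text \<open>At constant vectors v0, v1, v2 all hypotheses become linear relations between values of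
  \<psi> and of its first derivatives; the computation behind Cartan's formula is a combination of
  them.\<close>

lemma bracket_contraction_local:
  fixes \<psi> :: "'v::euclidean_space \<Rightarrow> 'v form" and X Y :: "'v \<Rightarrow> 'v"
  assumes V: "open V" "x \<in> V"
    and alt: "\<And>y. y \<in> V \<Longrightarrow> alternating_form 4 (\<psi> y)"
    and \<psi>: "\<And>v. smooth_on V (\<lambda>y. \<psi> y v)"
    and X: "smooth_on V X" and Y: "smooth_on V Y"
    and lieX: "has_lie_derivative V X \<psi> x (\<lambda>v. 0)" and lieY: "has_lie_derivative V Y \<psi> x (\<lambda>v. 0)"
    and closed: "ext_deriv 4 \<psi> x = (\<lambda>v. 0)"
  shows "interior_product (lie_bracket X Y x) (\<psi> x) =
    ext_deriv 2 (\<lambda>y. interior_product (X y) (interior_product (Y y) (\<psi> y))) x"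
proof
  fix v :: "nat \<Rightarrow> 'v"
  define X' Y' where "X' = frechet_derivative X (at x)" and "Y' = frechet_derivative Y (at x)"
  have X': "(X has_derivative X') (at x)" and Y': "(Y has_derivative Y') (at x)"
    unfolding X'_def Y'_def using smooth_on_has_frechet_derivative V X Y by blast+
  define D where "D v = frechet_derivative (\<lambda>y. \<psi> y v) (at x)" for v
  have D: "((\<lambda>y. \<psi> y v) has_derivative D v) (at x)" for v
    unfolding D_def using smooth_on_has_frechet_derivative[OF \<psi>] V by blast
  have D_cong: "D v = D w" if "\<And>i. i < 4 \<Longrightarrow> v i = w i" for v w
  proof -
    have "((\<lambda>y. \<psi> y w) has_derivative D v) (at x)"
      by (rule has_derivative_transform_within_open[OF D V]) (rule alternating_cong[OF alt that])
    thus ?thesis using has_derivative_unique[OF _ D] by blast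
  qed
  define F where "F a b c d = \<psi> x ((!) [a, b, c, d])" for a b c d
  define G where "G a b c d = D ((!) [a, b, c, d])" for a b c d
  note alt_x = alt[OF V(2)]
  have F01: "F b a c d = - F a b c d" and F12: "F a c b d = - F a b c d" and F23: "F a b d c = - F a b c d"
    for a b c d
    unfolding F_def
    using alternating_nth_swap[OF alt_x, of 0 1 "[a, b, c, d]"] alternating_nth_swap[OF alt_x, of 1 2 "[a, b, c, d]"]
      alternating_nth_swap[OF alt_x, of 2 3 "[a, b, c, d]"]
    by (simp_all add: numeral_eq_Suc)
  have lin: "linear (\<lambda>u. F u b c d)" "linear (\<lambda>u. F a b u d)" "linear (\<lambda>u. F a b c u)" for a b c d
    unfolding F_def
    using alternating_nth_linear[OF alt_x, of 0 "[0, b, c, d]"] alternating_nth_linear[OF alt_x, of 2 "[a, b, 0, d]"]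
      alternating_nth_linear[OF alt_x, of 3 "[a, b, c, 0]"] by (simp_all add: numeral_eq_Suc)
  have four: "{..<4} = {0, 1, 2, 3 :: nat}" by auto
  have upd: "((!) [a, b, c, d])(0 := u) = (!) [u, b, c, d]" "((!) [a, b, c, d])(1 := u) = (!) [a, u, c, d]"
    "((!) [a, b, c, d])(2 := u) = (!) [a, b, u, d]" "((!) [a, b, c, d])(3 := u) = (!) [a, b, c, u]"
    for a b c d u :: 'v
    by (simp_all add: nth_list_update_fun[symmetric] numeral_eq_Suc)
  have lie: "G a b c d (Z x) + F (Z' a) b c d + F a (Z' b) c d + F a b (Z' c) d + F a b c (Z' d) = 0"
    if "has_lie_derivative V Z \<psi> x (\<lambda>v. 0)" "(Z has_derivative Z') (at x)" for Z Z' a b c d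
    using lie_derivative_formula[OF that(1) V(1) that(2) alt D, of "(!) [a, b, c, d]"]
    unfolding four F_def G_def by (simp add: upd upd(2)[unfolded One_nat_def])
  define v0 v1 v2 where "v0 = v 0" and "v1 = v 1" and "v2 = v 2"
  \<comment> \<open>Closedness at (Y, X, v0, v1, v2): three of its terms are the derivatives of
    \<psi> occurring in d\<sigma>, the other two those in the Lie equations for X and Y.\<close>
  have closed': "G (X x) v0 v1 v2 (Y x) - G (Y x) v0 v1 v2 (X x) + G (Y x) (X x) v1 v2 v0
    - G (Y x) (X x) v0 v2 v1 + G (Y x) (X x) v0 v1 v2 = 0"
  proof -
    define w where "w = (!) [Y x, X x, v0, v1, v2]"
    have "(\<Sum>i\<le>4. (-1) ^ i * D (\<lambda>j. w (if j < i then j else Suc j)) (w i)) = 0"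
      using fun_cong[OF closed, of w] unfolding ext_deriv_def D_def .
    moreover have "{..4} = {0, 1, 2, 3, 4 :: nat}" by auto
    moreover have "D (\<lambda>j. w (if j < 0 then j else Suc j)) = G (X x) v0 v1 v2"
      "D (\<lambda>j. w (if j < 1 then j else Suc j)) = G (Y x) v0 v1 v2"
      "D (\<lambda>j. w (if j < 2 then j else Suc j)) = G (Y x) (X x) v1 v2"
      "D (\<lambda>j. w (if j < 3 then j else Suc j)) = G (Y x) (X x) v0 v2"
      "D (\<lambda>j. w (if j < 4 then j else Suc j)) = G (Y x) (X x) v0 v1"
      unfolding G_def w_def by (rule D_cong; auto simp: less_Suc_eq numeral_eq_Suc)+
    ultimately show ?thesis by (simp add: w_def)
  qed
  define \<sigma> where "\<sigma> = (\<lambda>y. interior_product (X y) (interior_product (Y y) (\<psi> y)))"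
  have d\<sigma>: "frechet_derivative (\<lambda>y. \<sigma> y u) (at x) h =
      G (Y x) (X x) (u 0) (u 1) h + F (Y' h) (X x) (u 0) (u 1) + F (Y x) (X' h) (u 0) (u 1)" for u h
  proof -
    \<comment> \<open>Only the first two arguments of \<psi> depend on the point, hence the zero
      derivatives in the later slots.\<close>
    define w where "w i y = (case i of 0 \<Rightarrow> Y y | Suc j \<Rightarrow> case_nat (X y) u j)" for i y
    define w' where "w' i h = (case i of 0 \<Rightarrow> Y' h | Suc j \<Rightarrow> case_nat (X' h) (\<lambda>_. 0) j)" for i h
    have w: "(w i has_derivative w' i) (at x)" for i
    proof (cases i)
      case 0
      thus ?thesis using Y' by (simp add: w_def[abs_def] w'_def[abs_def])
    next
      case (Suc j)
      thus ?thesis using X' by (cases j) (simp_all add: w_def[abs_def] w'_def[abs_def])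
    qed
    have "(\<lambda>y. \<sigma> y u) = (\<lambda>y. \<psi> y (\<lambda>i. w i y))"
      by (simp add: \<sigma>_def interior_product_def w_def)
    with alternating_has_derivative[OF V alt D w]
    have "((\<lambda>y. \<sigma> y u) has_derivative (\<lambda>h. D (\<lambda>i. w i x) h + (\<Sum>i<4. \<psi> x ((\<lambda>i. w i x)(i := w' i h))))) (at x)"
      by simp
    from frechet_derivative_at[OF this]
    have "frechet_derivative (\<lambda>y. \<sigma> y u) (at x) h = D (\<lambda>i. w i x) h + (\<Sum>i<4. \<psi> x ((\<lambda>i. w i x)(i := w' i h)))"
      by (rule fun_cong[OF sym])
    moreover have "D (\<lambda>i. w i x) = G (Y x) (X x) (u 0) (u 1)"
      unfolding G_def by (rule D_cong) (auto simp: w_def less_Suc_eq numeral_eq_Suc)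
    moreover have "\<psi> x ((\<lambda>i. w i x)(0 := a)) = F a (X x) (u 0) (u 1)"
      "\<psi> x ((\<lambda>i. w i x)(1 := a)) = F (Y x) a (u 0) (u 1)"
      "\<psi> x ((\<lambda>i. w i x)(2 := a)) = F (Y x) (X x) a (u 1)"
      "\<psi> x ((\<lambda>i. w i x)(3 := a)) = F (Y x) (X x) (u 0) a" for a
      unfolding F_def by (rule alternating_cong[OF alt_x]; auto simp: w_def less_Suc_eq numeral_eq_Suc)+
    moreover have "w' 0 h = Y' h" "w' 1 h = X' h" "w' 2 h = 0" "w' 3 h = 0"
      by (simp_all add: w'_def numeral_eq_Suc)
    ultimately show ?thesis
      unfolding four using linear_0[OF lin(2)] linear_0[OF lin(3)] by simp
  qed
  have three: "{..2} = {0, 1, 2 :: nat}" by auto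
  have "ext_deriv 2 \<sigma> x v = frechet_derivative (\<lambda>y. \<sigma> y (\<lambda>j. v (Suc j))) (at x) v0
     - frechet_derivative (\<lambda>y. \<sigma> y (\<lambda>j. v (if j < 1 then j else Suc j))) (at x) v1
     + frechet_derivative (\<lambda>y. \<sigma> y (\<lambda>j. v (if j < 2 then j else Suc j))) (at x) v2"
    unfolding ext_deriv_def three by (simp add: v0_def v1_def v2_def)
  also have "\<dots> = (G (Y x) (X x) v1 v2 v0 + F (Y' v0) (X x) v1 v2 + F (Y x) (X' v0) v1 v2)
     - (G (Y x) (X x) v0 v2 v1 + F (Y' v1) (X x) v0 v2 + F (Y x) (X' v1) v0 v2)
     + (G (Y x) (X x) v0 v1 v2 + F (Y' v2) (X x) v0 v1 + F (Y x) (X' v2) v0 v1)"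
    unfolding d\<sigma> by (simp add: v0_def v1_def v2_def numeral_2_eq_2)
  \<comment> \<open>Closedness trades the derivatives of \<psi> along v0, v1, v2 for those along X
    and Y, and the Lie equations remove these. The terms with \<open>X'\<close> or \<open>Y'\<close>
    applied to v0, v1 or v2 cancel once the listed transpositions order their arguments alike; the
    two terms of the bracket remain.\<close>
  also have "\<dots> = F (Y' (X x)) v0 v1 v2 - F (X' (Y x)) v0 v1 v2"
    using closed' lie[OF lieX X', of "Y x" v0 v1 v2] lie[OF lieY Y', of "X x" v0 v1 v2]
      F01[of "X x" "Y' v0" v1 v2] F01[of "X x" "Y' v1" v0 v2] F12[of "X x" v0 "Y' v1" v2]
      F01[of "X x" "Y' v2" v0 v1] F12[of "X x" v0 "Y' v2" v1] F23[of "X x" v0 v1 "Y' v2"]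
      F12[of "Y x" v0 "X' v1" v2] F12[of "Y x" v0 "X' v2" v1] F23[of "Y x" v0 v1 "X' v2"]
    by linarith
  also have "\<dots> = F (lie_bracket X Y x) v0 v1 v2"
    by (simp add: lie_bracket_def X'_def[symmetric] Y'_def[symmetric] linear_diff[OF lin(1)])
  also have "\<dots> = interior_product (lie_bracket X Y x) (\<psi> x) v"
    unfolding F_def interior_product_def
    by (rule alternating_cong[OF alt_x]) (auto simp: v0_def v1_def v2_def less_Suc_eq numeral_eq_Suc)
  finally show "interior_product (lie_bracket X Y x) (\<psi> x) v =
    ext_deriv 2 (\<lambda>y. interior_product (X y) (interior_product (Y y) (\<psi> y))) x v"
    by (simp add: \<sigma>_def)
qed

section \<open>Change of charts for the dual 4-form\<close>

lemma phi0_nondegenerate: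
  assumes "\<And>y z. phi0 ((!) [x, y, z]) = 0"
  shows "x = 0"
proof -
  \<comment> \<open>Every coordinate occurs in a monomial of \<open>phi0\<close>; the other two
    basis vectors of that monomial return the coordinate up to sign.\<close>
  have "x $ 1 = 0" "x $ 2 = 0" "x $ 3 = 0" "x $ 4 = 0" "x $ 5 = 0" "x $ 6 = 0" "x $ 7 = 0"
    using assms[of "ebasis 1" "ebasis 2"] assms[of "ebasis 0" "ebasis 2"] assms[of "ebasis 0" "ebasis 1"]
      assms[of "ebasis 0" "ebasis 4"] assms[of "ebasis 0" "ebasis 3"] assms[of "ebasis 0" "ebasis 6"]
      assms[of "ebasis 0" "ebasis 5"]
    by (simp_all add: phi0_nth ebasis_component)
  hence "x \<bullet> x = 0" by (simp add: inner_7)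
  thus ?thesis by simp
qed

text \<open>If K kills h, then L h contracts \<open>phi0\<close> to zero, so h = 0 by nondegeneracy.
  In a change of charts this yields an invertible composed frame without inverting the transition
  map.\<close>

lemma linear_bijection_of_pullback:
  assumes L: "linear_bijection L" and K: "linear K" and eq: "pullback K phi0 = pullback L phi0"
  shows "linear_bijection K"
proof -
  interpret linear_bijection L by (rule L)
  have "h = 0" if "K h = 0" for h
  proof -
    have "phi0 ((!) [L h, y, z]) = 0" for y z
    proof -
      define w where "w = (!) [h, inv L y, inv L z]"
      have "phi0 ((!) [L h, y, z]) = pullback L phi0 w"
        unfolding pullback_def w_def
        by (rule alternating_cong[OF alternating_phi0]) (auto simp: less_Suc_eq numeral_eq_Suc)
      also have "\<dots> = phi0 (\<lambda>i. K (w i))" using fun_cong[OF eq, of w] by (simp add: pullback_def)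
      also have "\<dots> = phi0 ((\<lambda>i. K (w i))(0 := 0))"
        using that by (intro arg_cong[where f = phi0]) (auto simp: w_def)
      also have "\<dots> = 0" using linear_0[OF alternating_linear[OF alternating_phi0, of 0]] by simp
      finally show ?thesis .
    qed
    hence "L h = 0" by (rule phi0_nondegenerate)
    thus ?thesis using inv_L[of h] linear_0[OF linear_inv] by simp
  qed
  hence "inj K" using K linear_injective_0 by blast
  moreover from this have "surj K" using K linear_injective_imp_surjective by blast
  ultimately show ?thesis using K by (simp add: linear_bijection_def bij_def)
qed

lemma differential_form_g2_star:
  assumes M: "smooth_7_manifold T A" and \<phi>: "g2_structure A \<phi>"
  shows "differential_form A 4 (g2_star \<phi>)"
proof -
  have "\<exists>L. linear_bijection L \<and> \<phi> c x = pullback L phi0" if "c \<in> A" "x \<in> chart_image c" for c x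
    using \<phi> that unfolding g2_structure_def linear_bijection_def by blast
  then obtain L where L: "\<And>c x. c \<in> A \<Longrightarrow> x \<in> chart_image c \<Longrightarrow> linear_bijection (L c x)"
    and \<phi>L: "\<And>c x. c \<in> A \<Longrightarrow> x \<in> chart_image c \<Longrightarrow> \<phi> c x = pullback (L c x) phi0"
    by metis
  \<comment> \<open>Any frame carrying phi to the model computes the star, not just the chosen
    \<open>L\<close>; the change of charts relies on this freedom.\<close>
  have star: "g2_star \<phi> c x = pullback K psi0" if "linear_bijection K" "\<phi> c x = pullback K phi0" for c x K
    unfolding g2_star_def that(2) by (rule linear_bijection.g2_star_pullback[OF that(1)])
  have dform: "differential_form A 3 \<phi>" using \<phi> by (simp add: g2_structure_def)
  show ?thesis
    unfolding differential_form_def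
  proof (intro conjI ballI allI)
    fix c x assume cx: "c \<in> A" "x \<in> chart_image c"
    show "alternating_form 4 (g2_star \<phi> c x)"
      unfolding star[OF L[OF cx] \<phi>L[OF cx]]
      by (rule alternating_pullback[OF alternating_psi0 linear_bijection.lin[OF L[OF cx]]])
  next
    fix c v assume c: "c \<in> A"
    have S: "open (chart_image c)" using M c by (simp add: smooth_7_manifold_def)
    have "smooth_on (chart_image c) (\<lambda>x. pullback (L c x) psi0 v)"
      by (rule smooth_on_pullback_psi0[OF S L[OF c] \<phi>L[OF c]])
        (use dform c in \<open>simp_all add: differential_form_def\<close>)
    thus "smooth_on (chart_image c) (\<lambda>x. g2_star \<phi> c x v)"
      by (rule smooth_on_cong[OF S, rotated]) (simp add: star[OF L[OF c] \<phi>L[OF c]])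
  next
    fix c d p assume c: "c \<in> A" and d: "d \<in> A" and p: "p \<in> fst c \<inter> fst d"
    define D where "D = frechet_derivative (transition c d) (at (snd c p))"
    have x: "snd c p \<in> chart_image c" and y: "snd d p \<in> chart_image d"
      using p by (auto simp: chart_image_def)
    have "smooth_on (snd c ` (fst c \<inter> fst d)) (transition c d)"
      using M c d by (simp add: smooth_7_manifold_def)
    hence D: "linear D"
      unfolding D_def using smooth_on_has_frechet_derivative p by (blast intro: has_derivative_linear)
    interpret L': linear_bijection "L d (snd d p)" by (rule L[OF d y])
    \<comment> \<open>The frame of chart d, pulled back along the transition map, is a second frame
      for phi at the same point of chart c.\<close>
    let ?K = "L d (snd d p) \<circ> D"
    have "\<phi> c (snd c p) = pullback D (\<phi> d (snd d p))"
      using dform c d p unfolding differential_form_def D_def by blast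
    hence K: "\<phi> c (snd c p) = pullback ?K phi0"
      unfolding \<phi>L[OF d y] by (simp add: pullback_def)
    have "linear_bijection ?K"
      by (rule linear_bijection_of_pullback[OF L[OF c x] linear_compose[OF D L'.lin]])
        (simp add: K[symmetric] \<phi>L[OF c x, symmetric])
    from star[OF this K] show "g2_star \<phi> c (snd c p) =
        pullback (frechet_derivative (transition c d) (at (snd c p))) (g2_star \<phi> d (snd d p))"
      unfolding star[OF L[OF d y] \<phi>L[OF d y]] D_def by (simp add: pullback_def)
  qed
qed

lemma differential_form_contraction:
  assumes M: "smooth_7_manifold T A" and \<omega>: "differential_form A (Suc k) \<omega>" and X: "vector_field A X"
  shows "differential_form A k (contraction X \<omega>)"
  unfolding differential_form_def contraction_def
proof (intro conjI ballI allI)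
  fix c x assume "c \<in> A" "x \<in> chart_image c"
  thus "alternating_form k (interior_product (X c x) (\<omega> c x))"
    using \<omega> by (intro alternating_interior) (simp add: differential_form_def)
next
  fix c v assume c: "c \<in> A"
  have S: "open (chart_image c)" using M c by (simp add: smooth_7_manifold_def)
  define w where "w i x = (case i of 0 \<Rightarrow> X c x | Suc j \<Rightarrow> v j)" for i x
  have "smooth_on (chart_image c) (\<lambda>x. \<omega> c x (\<lambda>i. w i x))"
  proof (rule alternating_smooth[OF S, where \<omega> = "\<omega> c" and w = w and k = "Suc k"])
    show "smooth_on (chart_image c) (w i)" for i
      unfolding w_def using X c by (cases i) (simp_all add: vector_field_def smooth_on_const)
  qed (use \<omega> c in \<open>auto simp: differential_form_def\<close>)
  thus "smooth_on (chart_image c) (\<lambda>x. interior_product (X c x) (\<omega> c x) v)"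
    by (simp add: interior_product_def w_def)
next
  fix c d p assume c: "c \<in> A" and d: "d \<in> A" and p: "p \<in> fst c \<inter> fst d"
  have "\<omega> c (snd c p) = pullback (frechet_derivative (transition c d) (at (snd c p))) (\<omega> d (snd d p))"
    using \<omega> c d p unfolding differential_form_def by blast
  moreover have "X d (snd d p) = frechet_derivative (transition c d) (at (snd c p)) (X c (snd c p))"
    using X c d p unfolding vector_field_def by blast
  ultimately show "interior_product (X c (snd c p)) (\<omega> c (snd c p)) =
    pullback (frechet_derivative (transition c d) (at (snd c p))) (interior_product (X d (snd d p)) (\<omega> d (snd d p)))"
    by (simp add: interior_pullback)
qed

theorem proposition2p4:
  fixes T :: "'a topology" and A :: "'a chart set"
    and \<phi> :: "'a dform" and X\<^sub>1 X\<^sub>2 :: "'a vfield"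
  assumes "smooth_7_manifold T A"
    and "coclosed_g2_structure A \<phi>"
    and "cog2_vector_field A \<phi> X\<^sub>1"
    and "cog2_vector_field A \<phi> X\<^sub>2"
  shows "\<exists>\<sigma>. differential_form A 2 \<sigma> \<and>
           form_eq A (contraction (vf_bracket X\<^sub>1 X\<^sub>2) (g2_star \<phi>)) (exterior_derivative 2 \<sigma>)"
proof (intro exI conjI)
  let ?\<psi> = "g2_star \<phi>"
  let ?\<sigma> = "contraction X\<^sub>1 (contraction X\<^sub>2 ?\<psi>)"
  have X: "vector_field A X\<^sub>1" "vector_field A X\<^sub>2"
    using assms(3,4) by (simp_all add: cog2_vector_field_def)
  have \<psi>: "differential_form A 4 ?\<psi>"
    using differential_form_g2_star[OF assms(1)] assms(2) by (simp add: coclosed_g2_structure_def)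
  show "differential_form A 2 ?\<sigma>"
    using differential_form_contraction[OF assms(1) differential_form_contraction[OF assms(1) _ X(2)] X(1)] \<psi>
    by (simp add: numeral_eq_Suc)
  show "form_eq A (contraction (vf_bracket X\<^sub>1 X\<^sub>2) ?\<psi>) (exterior_derivative 2 ?\<sigma>)"
    unfolding form_eq_def
  proof (intro ballI)
    fix c x assume c: "c \<in> A" and x: "x \<in> chart_image c"
    have V: "open (chart_image c)" using assms(1) c by (simp add: smooth_7_manifold_def)
    have closed: "ext_deriv 4 (?\<psi> c) x = (\<lambda>v. 0)"
      using assms(2) c x by (simp add: coclosed_g2_structure_def form_eq_def exterior_derivative_def)
    have lie: "has_lie_derivative (chart_image c) (X\<^sub>1 c) (?\<psi> c) x (\<lambda>v. 0)"
      "has_lie_derivative (chart_image c) (X\<^sub>2 c) (?\<psi> c) x (\<lambda>v. 0)"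
      using assms(3,4) c x by (simp_all add: cog2_vector_field_def)
    have smooth: "smooth_on (chart_image c) (X\<^sub>1 c)" "smooth_on (chart_image c) (X\<^sub>2 c)"
      using X c by (simp_all add: vector_field_def)
    show "contraction (vf_bracket X\<^sub>1 X\<^sub>2) ?\<psi> c x = exterior_derivative 2 ?\<sigma> c x"
      unfolding contraction_def vf_bracket_def exterior_derivative_def
      by (rule bracket_contraction_local[OF V x _ _ smooth lie closed])
        (use \<psi> c in \<open>simp_all add: differential_form_def\<close>)
  qed
qed

end
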